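(* Let $M$ be a proper hypersurface of Euclidean space $\mathbb E^{n+1}$ with induced metric $g$. If $(M,g,\mathbf x^T,\lambda,\mu)$ is a quasi-Yamabe soliton with $\mu\neq 0$ everywhere, then $M$ is an open portion of a rotational hypersurface whose axis of rotation contains the origin.
   Context: $(M,g,X,\lambda,\mu)$ is a quasi-Yamabe soliton if $(M,g)$ is a Riemannian manifold, $X$ is a vector field on $M$ (the soliton field), $\lambda$ is a real constant and $\mu$ is a function on $M$ such that $\frac12\mathcal L_X g=(R-\lambda)g+\mu X^\#\otimes X^\#$, where $\mathcal L_X$ is the Lie derivative, $X^\#$ is the 1-form dual to $X$, and $R$ is the scalar curvature of $(M,g)$, with the convention $R=\sum_{1\le i\ne j\le n}K_{ij}$ ($K_{ij}$ the sectional curvature of the plane spanned by $e_i,e_j$ for an orthonormal basis $e_1,\dots,e_n$ of the tangent space). $\mathbf x$ denotes the position vector field of $M$ in $\mathbb E^{n+1}$ (with respect to the origin), and $\mathbf x^T$, $\mathbf x^N$ denote its components tangential and normal to $M$. A Euclidean submanifold $M$ is called proper if both $\mathbf x^T$ and $\mathbf x^N$ are nowhere zero on some dense open subset of $M$. A rotational hypersurface $S^{n-1}\times\gamma$ in $\mathbb E^{n+1}$ is a hypersurface which, up to a rigid motion of $\mathbb E^{n+1}$, can be expressed as $(\rho(u)y_1,\dots,\rho(u)y_n,u)$ with $y_1^2+\cdots+y_n^2=1$, where $\gamma(u)=(\rho(u),u)$, $\rho(u)>0$, $u\in I$, is a plane curve defined on an open interval $I$ (the profile curve); the $u$-axis is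 called the axis of rotation. It is called a spherical cylinder if $\gamma$ is a horizontal line segment ($\rho$ a nonzero constant), and a spherical cone if $\gamma$ is a non-horizontal line segment ($\rho=cu$, $0\neq c\in\mathbb R$). Convention of the paper: only rotational hypersurfaces which contain no open portions of hyperspheres, spherical cylinders, or spherical cones are considered.
   Formalization: Added: M connected, n≥2, and λ≠−1 if n=2 (false otherwise). Points where x^T or x^N vanishes are only put on the axis; the rest of M is the open portion. If λ=−1 the profile is a regular embedded curve, perhaps not a graph. The sphere/cylinder/cone convention holds if M obeys it. *)

theory Defs
  imports "HOL-Analysis.Analysis"
begin

section \<open>Smooth maps\<close>

primrec Ck_on :: "nat \<Rightarrow> ('a::real_normed_vector \<Rightarrow> 'b::real_normed_vector) \<Rightarrow> 'a set \<Rightarrow> bool" where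
  "Ck_on 0 f S \<longleftrightarrow> continuous_on S f"
| "Ck_on (Suc k) f S \<longleftrightarrow> (\<forall>x\<in>S. f differentiable (at x)) \<and>
     (\<forall>v. Ck_on k (\<lambda>x. frechet_derivative f (at x) v) S)"

text \<open>Intended for open \<open>S\<close>.\<close>

definition smooth_on :: "('a::real_normed_vector \<Rightarrow> 'b::real_normed_vector) \<Rightarrow> 'a set \<Rightarrow> bool" where
  "smooth_on f S \<longleftrightarrow> (\<forall>k. Ck_on k f S)"

section \<open>Riemannian geometry on a coordinate domain\<close>

text \<open>A metric on an open \<open>V \<subseteq> \<real>\<^sup>n\<close> is a function \<open>g\<close> with \<open>g v a b\<close> the
  inner product at \<open>v\<close> of the tangent vectors with components \<open>a\<close> and \<open>b\<close>.  Below,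
  \<open>a\<close>, \<open>b\<close>, \<open>c\<close>, \<open>d\<close> double as the constant (hence pairwise commuting) vector fields
  with these components.\<close>

type_synonym 'n metric = "real^'n \<Rightarrow> real^'n \<Rightarrow> real^'n \<Rightarrow> real"

definition riemannian_metric_on :: "(real^'n) set \<Rightarrow> 'n::finite metric \<Rightarrow> bool" where
  "riemannian_metric_on V g \<longleftrightarrow>
     (\<forall>v\<in>V. bilinear (g v) \<and> (\<forall>a b. g v a b = g v b a) \<and> (\<forall>a. a \<noteq> 0 \<longrightarrow> g v a a > 0)) \<and>
     (\<forall>a b. smooth_on (\<lambda>v. g v a b) V)"

text \<open>The Levi-Civita connection is \<open>\<nabla>\<^sub>a Y = D\<^sub>a Y + christoffel g v a Y\<close>; the
  Christoffel term is determined by the Koszul formula.\<close>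

definition christoffel :: "'n::finite metric \<Rightarrow> real^'n \<Rightarrow> real^'n \<Rightarrow> real^'n \<Rightarrow> real^'n" where
  "christoffel g v a b = (THE c. \<forall>d. 2 * g v c d =
       frechet_derivative (\<lambda>w. g w b d) (at v) a
     + frechet_derivative (\<lambda>w. g w a d) (at v) b
     - frechet_derivative (\<lambda>w. g w a b) (at v) d)"

text \<open>\<open>R(a,b)c = \<nabla>\<^sub>a \<nabla>\<^sub>b c - \<nabla>\<^sub>b \<nabla>\<^sub>a c\<close>.\<close>

definition curvature :: "'n::finite metric \<Rightarrow> real^'n \<Rightarrow> real^'n \<Rightarrow> real^'n \<Rightarrow> real^'n \<Rightarrow> real^'n" where
  "curvature g v a b c =
       frechet_derivative (\<lambda>w. christoffel g w b c) (at v) a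
     - frechet_derivative (\<lambda>w. christoffel g w a c) (at v) b
     + christoffel g v a (christoffel g v b c)
     - christoffel g v b (christoffel g v a c)"

definition sectional_curvature :: "'n::finite metric \<Rightarrow> real^'n \<Rightarrow> real^'n \<Rightarrow> real^'n \<Rightarrow> real" where
  "sectional_curvature g v a b =
     g v (curvature g v a b b) a / (g v a a * g v b b - (g v a b)\<^sup>2)"

definition orthonormal_frame :: "'n::finite metric \<Rightarrow> real^'n \<Rightarrow> ('n \<Rightarrow> real^'n) \<Rightarrow> bool" where
  "orthonormal_frame g v e \<longleftrightarrow> (\<forall>i j. g v (e i) (e j) = (if i = j then 1 else 0))"

text \<open>The sum runs over ordered pairs \<open>i \<noteq> j\<close>, so that a unit \<open>n\<close>-sphere has scalar
  curvature \<open>n (n - 1)\<close>.  The value does not depend on the frame.\<close>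

definition scalar_curvature :: "'n::finite metric \<Rightarrow> real^'n \<Rightarrow> real" where
  "scalar_curvature g v =
     (let e = (SOME e. orthonormal_frame g v e)
      in \<Sum>i\<in>UNIV. \<Sum>j\<in>UNIV - {i}. sectional_curvature g v (e i) (e j))"

definition lie_derivative_metric ::
    "(real^'n \<Rightarrow> real^'n) \<Rightarrow> 'n::finite metric \<Rightarrow> 'n metric" where
  "lie_derivative_metric X g v a b =
       frechet_derivative (\<lambda>w. g w a b) (at v) (X v)
     + g v (frechet_derivative X (at v) a) b
     + g v a (frechet_derivative X (at v) b)"

definition dual_form ::
    "'n::finite metric \<Rightarrow> (real^'n \<Rightarrow> real^'n) \<Rightarrow> real^'n \<Rightarrow> real^'n \<Rightarrow> real" where
  "dual_form g X v a = g v (X v) a"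

definition quasi_yamabe_soliton_on ::
    "(real^'n) set \<Rightarrow> 'n::finite metric \<Rightarrow> (real^'n \<Rightarrow> real^'n) \<Rightarrow> real \<Rightarrow> (real^'n \<Rightarrow> real) \<Rightarrow> bool"
  where
  "quasi_yamabe_soliton_on V g X lam mu \<longleftrightarrow>
     riemannian_metric_on V g \<and> smooth_on X V \<and> smooth_on mu V \<and>
     (\<forall>v\<in>V. \<forall>a b. 1/2 * lie_derivative_metric X g v a b =
        (scalar_curvature g v - lam) * g v a b + mu v * (dual_form g X v a * dual_form g X v b))"

section \<open>Hypersurfaces\<close>

text \<open>Euclidean \<open>(n+1)\<close>-space is \<open>(real^'n) \<times> real\<close> with \<open>n = CARD('n)\<close>.  A
  hypersurface is a topological space \<open>M\<close> with a map \<open>x\<close> (the position vector) which is an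
  immersion.  Its smooth structure is the one for which the maps \<open>\<phi>\<close> with
  \<open>local_param M x V \<phi>\<close> are the inverse charts: since \<open>x \<circ> \<phi>\<close> is a smooth immersion,
  the transition maps between any two of them are automatically smooth.  Embedded
  hypersurfaces are the case \<open>M = top_of_set S\<close>, \<open>x = id\<close>.\<close>

definition local_param ::
    "'m topology \<Rightarrow> ('m \<Rightarrow> (real^'n) \<times> real) \<Rightarrow> (real^'n) set \<Rightarrow> (real^'n::finite \<Rightarrow> 'm) \<Rightarrow> bool" where
  "local_param M x V \<phi> \<longleftrightarrow>
     open V \<and> embedding_map (top_of_set V) M \<phi> \<and> openin M (\<phi> ` V) \<and>
     smooth_on (x \<circ> \<phi>) V \<and> (\<forall>v\<in>V. inj (frechet_derivative (x \<circ> \<phi>) (at v)))"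

definition hypersurface :: "'m topology \<Rightarrow> ('m \<Rightarrow> (real^'n::finite) \<times> real) \<Rightarrow> bool" where
  "hypersurface M x \<longleftrightarrow>
     topspace M \<noteq> {} \<and> Hausdorff_space M \<and> second_countable M \<and>
     (\<forall>m\<in>topspace M. \<exists>V \<phi>. local_param M x V \<phi> \<and> m \<in> \<phi> ` V)"

text \<open>In the following, \<open>F\<close> stands for \<open>x \<circ> \<phi>\<close>.\<close>

definition induced_metric :: "(real^'n \<Rightarrow> (real^'n) \<times> real) \<Rightarrow> 'n::finite metric" where
  "induced_metric F v a b = frechet_derivative F (at v) a \<bullet> frechet_derivative F (at v) b"

text \<open>The components, with respect to the coordinates, of the orthogonal projection of the
  position vector onto the tangent space.\<close>

definition position_tangential :: "(real^'n \<Rightarrow> (real^'n) \<times> real) \<Rightarrow> real^'n::finite \<Rightarrow> real^'n" where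
  "position_tangential F v =
     (THE a. \<forall>b. (F v - frechet_derivative F (at v) a) \<bullet> frechet_derivative F (at v) b = 0)"

definition position_normal :: "(real^'n \<Rightarrow> (real^'n) \<times> real) \<Rightarrow> real^'n::finite \<Rightarrow> (real^'n) \<times> real" where
  "position_normal F v = F v - frechet_derivative F (at v) (position_tangential F v)"

text \<open>The points at which neither \<open>x\<^sup>T\<close> nor \<open>x\<^sup>N\<close> vanishes.\<close>

definition nondegenerate_points :: "'m topology \<Rightarrow> ('m \<Rightarrow> (real^'n::finite) \<times> real) \<Rightarrow> 'm set" where
  "nondegenerate_points M x = {m \<in> topspace M. \<exists>V \<phi>. local_param M x V \<phi> \<and>
     (\<exists>v\<in>V. \<phi> v = m \<and> position_tangential (x \<circ> \<phi>) v \<noteq> 0 \<and> position_normal (x \<circ> \<phi>) v \<noteq> 0)}"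

definition proper_hypersurface :: "'m topology \<Rightarrow> ('m \<Rightarrow> (real^'n::finite) \<times> real) \<Rightarrow> bool" where
  "proper_hypersurface M x \<longleftrightarrow> hypersurface M x \<and>
     (\<exists>D. openin M D \<and> M closure_of D = topspace M \<and> D \<subseteq> nondegenerate_points M x)"

text \<open>\<open>(M, g, x\<^sup>T, lam, mu)\<close> is a quasi-Yamabe soliton, \<open>g\<close> being the induced metric.\<close>

definition position_quasi_yamabe_soliton ::
    "'m topology \<Rightarrow> ('m \<Rightarrow> (real^'n::finite) \<times> real) \<Rightarrow> real \<Rightarrow> ('m \<Rightarrow> real) \<Rightarrow> bool" where
  "position_quasi_yamabe_soliton M x lam mu \<longleftrightarrow>
     (\<forall>V \<phi>. local_param M x V \<phi> \<longrightarrow>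
        quasi_yamabe_soliton_on V (induced_metric (x \<circ> \<phi>)) (position_tangential (x \<circ> \<phi>)) lam (mu \<circ> \<phi>))"

section \<open>Rotational hypersurfaces\<close>

definition rigid_motion :: "('a::metric_space \<Rightarrow> 'a) \<Rightarrow> bool" where
  "rigid_motion f \<longleftrightarrow> (\<forall>p q. dist (f p) (f q) = dist p q)"

definition open_interval :: "real set \<Rightarrow> bool" where
  "open_interval I \<longleftrightarrow> open I \<and> is_interval I \<and> I \<noteq> {}"

definition sphere_times_curve ::
    "real set \<Rightarrow> (real \<Rightarrow> real) \<Rightarrow> (real \<Rightarrow> real) \<Rightarrow> ((real^'n::finite) \<times> real) set" where
  "sphere_times_curve I \<rho> z = {(\<rho> t *\<^sub>R y, z t) | t y. t \<in> I \<and> norm y = 1}"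

definition standard_axis :: "((real^'n::finite) \<times> real) set" where
  "standard_axis = {(0, u) | u. True}"

text \<open>\<open>S\<close> is a rotational hypersurface with axis of rotation \<open>L\<close>, the profile curve being
  the graph \<open>(\<rho>(u), u)\<close>.\<close>

definition rotational_hypersurface ::
    "((real^'n::finite) \<times> real) set \<Rightarrow> ((real^'n) \<times> real) set \<Rightarrow> bool" where
  "rotational_hypersurface S L \<longleftrightarrow>
     (\<exists>f I \<rho>. rigid_motion f \<and> open_interval I \<and> smooth_on \<rho> I \<and> (\<forall>u\<in>I. \<rho> u > 0) \<and>
        S = f ` sphere_times_curve I \<rho> (\<lambda>u. u) \<and> L = f ` standard_axis)"

text \<open>The same with an arbitrary embedded regular profile curve \<open>(\<rho>(t), z(t))\<close> in the open
  half-plane \<open>\<rho> > 0\<close>, whose tangent may be orthogonal to the axis.\<close>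

definition rotational_hypersurface_regular_profile ::
    "((real^'n::finite) \<times> real) set \<Rightarrow> ((real^'n) \<times> real) set \<Rightarrow> bool" where
  "rotational_hypersurface_regular_profile S L \<longleftrightarrow>
     (\<exists>f I \<rho> z. rigid_motion f \<and> open_interval I \<and> smooth_on \<rho> I \<and> smooth_on z I \<and>
        (\<forall>t\<in>I. \<rho> t > 0 \<and> (deriv \<rho> t \<noteq> 0 \<or> deriv z t \<noteq> 0)) \<and>
        (\<exists>h. homeomorphism I ((\<lambda>t. (\<rho> t, z t)) ` I) (\<lambda>t. (\<rho> t, z t)) h) \<and>
        S = f ` sphere_times_curve I \<rho> z \<and> L = f ` standard_axis)"

definition hypersphere :: "((real^'n::finite) \<times> real) set \<Rightarrow> bool" where
  "hypersphere H \<longleftrightarrow> (\<exists>c r. r > 0 \<and> H = sphere c r)"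

definition spherical_cylinder :: "((real^'n::finite) \<times> real) set \<Rightarrow> bool" where
  "spherical_cylinder H \<longleftrightarrow>
     (\<exists>f I c. rigid_motion f \<and> open_interval I \<and> c > 0 \<and>
        H = f ` sphere_times_curve I (\<lambda>u. c) (\<lambda>u. u))"

definition spherical_cone :: "((real^'n::finite) \<times> real) set \<Rightarrow> bool" where
  "spherical_cone H \<longleftrightarrow>
     (\<exists>f I c. rigid_motion f \<and> open_interval I \<and> c \<noteq> 0 \<and> (\<forall>u\<in>I. c * u > 0) \<and>
        H = f ` sphere_times_curve I (\<lambda>u. c * u) (\<lambda>u. u))"

definition contains_excluded_portion :: "((real^'n::finite) \<times> real) set \<Rightarrow> bool" where
  "contains_excluded_portion S \<longleftrightarrow>
     (\<exists>H P. (hypersphere H \<or> spherical_cylinder H \<or> spherical_cone H) \<and>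
        openin (top_of_set H) P \<and> P \<noteq> {} \<and> P \<subseteq> S)"

end

theory Submission
  imports Defs
begin

text \<open>
  The soliton equation prescribes the shape operator of the hypersurface. Split the position
  vector as \<open>x = x\<^sup>T + \<nu>\<close> with \<open>\<nu> = x\<^sup>N\<close>, let \<open>\<xi> = d(\<bar>x\<bar>\<^sup>2/2)\<close> be the form dual to \<open>x\<^sup>T\<close>, and put
  \<open>\<kappa> = R - lam - 1\<close>. Half the Lie derivative of \<open>g\<close> along \<open>x\<^sup>T\<close> is \<open>g\<close> plus the second fundamental form
  in the direction \<open>\<nu>\<close>, so the latter is \<open>\<kappa> g + mu \<xi> \<otimes> \<xi>\<close>. Up to the factor \<open>\<bar>\<nu>\<bar>\<close>, the principal
  curvatures are thus \<open>\<kappa>\<close> on the hyperplane orthogonal to \<open>x\<^sup>T\<close> and \<open>\<beta> = \<kappa> + mu \<bar>x\<^sup>T\<bar>\<^sup>2\<close> along \<open>x\<^sup>T\<close>. If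
  \<open>\<nu>\<close> vanishes at a point, then so does \<open>x\<^sup>T\<close>, because in dimension at least 2 a form of rank one is
  not a multiple of \<open>g\<close>.

  The axis is found in a chart, near a point with \<open>x\<^sup>T \<noteq> 0\<close>. Differentiating \<open>\<omega> = \<bar>\<nu>\<bar>\<^sup>2\<close> gives
  \<open>d\<omega> = -2\<beta>\<xi>\<close>, hence \<open>d\<beta> \<and> \<xi> = 0\<close>. By the Gauss equation, \<open>\<omega>\<close>, \<open>\<kappa>\<close> and \<open>\<beta>\<close> satisfy an algebraic relation,
  so \<open>d\<kappa>\<close> is a multiple of \<open>\<xi>\<close> as well (\<open>horizontal_deriv_kappa\<close>; for surfaces with \<open>lam = -1\<close> the
  relation may fail to determine \<open>\<kappa>\<close>). The Codazzi equation, in the form of the symmetry of the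
  second derivatives of \<open>\<nu>\<close>, yields the factor, and it follows that the derivative of the vector
  \<open>\<nu> + \<kappa> x\<close> is a multiple of this vector (\<open>deriv_axial\<close>). Its direction \<open>e\<close> is therefore locally
  constant; the line through the origin in this direction is the axis.

  At a zero of \<open>x\<^sup>T\<close> we have \<open>\<kappa> \<noteq> -1\<close>: the pair \<open>(x\<^sup>T, 1 + \<kappa>)\<close> satisfies a homogeneous linear
  differential equation along segments, and if it vanished at a point it would vanish on an open
  set, which contradicts properness (\<open>degenerate_kappa\<close>). Since the derivative of \<open>x\<^sup>T\<close> at such a
  point is \<open>1 + \<kappa>\<close> times the identity, the zeros are isolated. In dimension at least 2 their
  complement \<open>M'\<close> in \<open>M\<close> is still connected, so \<open>e\<close> is the same everywhere, and at a zero with \<open>x \<noteq> 0\<close>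
  the equation \<open>\<nu> + \<kappa> x = (1 + \<kappa>) x\<close> puts \<open>x\<close> on the axis.

  For the profile, let \<open>q = \<bar>x\<bar>\<^sup>2\<close>, which has no critical points on \<open>M'\<close>. The formulas for \<open>d\<omega>\<close> and \<open>d\<kappa>\<close>
  say that, as functions of \<open>q\<close>, \<open>\<omega>\<close> and \<open>\<kappa>\<close> solve a system of ordinary differential equations that
  involves only \<open>lam\<close> and the dimension. Uniqueness of solutions and connectedness of \<open>M'\<close> make \<open>\<omega>\<close>
  and \<open>\<kappa>\<close> functions of \<open>q\<close> on the interval \<open>q(M')\<close> (\<open>global_profile\<close>), and then so are the height
  \<open>\<langle>x, e\<rangle> = (\<omega> + \<kappa> q)/\<bar>\<nu> + \<kappa> x\<bar>\<close> and the distance to the axis. The profile curve parametrised by \<open>q\<close>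
  is embedded, as \<open>q\<close> is its squared distance to the origin. The derivative of the height is a
  multiple of \<open>\<kappa>\<close>, which has no zeros when \<open>lam \<noteq> -1\<close>; in this case the curve is a graph over the
  axis. The image of \<open>M'\<close> is open in the resulting hypersurface by invariance of domain, and it
  meets every orbit of the rotations, so that an excluded piece of the hypersurface can be
  rotated onto the image.

  To speak of \<open>\<nu>\<close> and \<open>\<kappa>\<close> as functions on \<open>M\<close> one has to know that they do not depend on the chart.
  This is derived from the fact that the vanishing of the derivative of a function at a point
  has this property (\<open>zero_derivative_transfer\<close>).
\<close>

section \<open>Calculus of smooth maps\<close>

abbreviation dir_deriv :: "('a::real_normed_vector \<Rightarrow> 'b::real_normed_vector) \<Rightarrow> 'a \<Rightarrow> 'a \<Rightarrow> 'b" where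
  "dir_deriv f x a \<equiv> frechet_derivative f (at x) a"

lemma dir_deriv_eqI: "(f has_derivative f') (at x) \<Longrightarrow> dir_deriv f x a = f' a"
  using frechet_derivative_at by fastforce

lemma has_derivative_dir_deriv:
  "f differentiable (at x) \<Longrightarrow> (f has_derivative dir_deriv f x) (at x)"
  by (simp add: frechet_derivative_works)

lemma dir_deriv_cong:
  assumes "open S" "x \<in> S" "\<And>y. y \<in> S \<Longrightarrow> f y = g y"
  shows "dir_deriv f x = dir_deriv g x"
proof -
  have "(f has_derivative f') (at x) \<longleftrightarrow> (g has_derivative f') (at x)" for f'
    using has_derivative_transform_within_open[OF _ assms(1,2)] assms(3) by metis
  then show ?thesis unfolding frechet_derivative_def by simp
qed

lemma dir_deriv_inner:
  "f differentiable (at x) \<Longrightarrow> g differentiable (at x) \<Longrightarrow>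
    dir_deriv (\<lambda>x. f x \<bullet> g x) x a = f x \<bullet> dir_deriv g x a + dir_deriv f x a \<bullet> g x"
  by (rule dir_deriv_eqI) (auto intro!: derivative_eq_intros has_derivative_dir_deriv)

lemma dir_deriv_scaleR:
  "f differentiable (at x) \<Longrightarrow> g differentiable (at x) \<Longrightarrow>
    dir_deriv (\<lambda>x. f x *\<^sub>R g x) x a = f x *\<^sub>R dir_deriv g x a + dir_deriv f x a *\<^sub>R g x"
  by (rule dir_deriv_eqI) (auto intro!: derivative_eq_intros has_derivative_dir_deriv)

lemma dir_deriv_mult:
  fixes f g :: "'a::real_normed_vector \<Rightarrow> real"
  shows "f differentiable (at x) \<Longrightarrow> g differentiable (at x) \<Longrightarrow>
    dir_deriv (\<lambda>x. f x * g x) x a = f x * dir_deriv g x a + dir_deriv f x a * g x"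
  by (rule dir_deriv_eqI) (auto intro!: derivative_eq_intros has_derivative_dir_deriv)

lemma dir_deriv_add:
  "f differentiable (at x) \<Longrightarrow> g differentiable (at x) \<Longrightarrow>
    dir_deriv (\<lambda>x. f x + g x) x a = dir_deriv f x a + dir_deriv g x a"
  by (rule dir_deriv_eqI) (auto intro!: derivative_eq_intros has_derivative_dir_deriv)

lemma dir_deriv_diff:
  "f differentiable (at x) \<Longrightarrow> g differentiable (at x) \<Longrightarrow>
    dir_deriv (\<lambda>x. f x - g x) x a = dir_deriv f x a - dir_deriv g x a"
  by (rule dir_deriv_eqI) (auto intro!: derivative_eq_intros has_derivative_dir_deriv)

lemma has_real_derivative_dir_deriv:
  fixes f :: "real \<Rightarrow> real"
  assumes "f differentiable (at x)"
  shows "(f has_real_derivative dir_deriv f x 1) (at x)"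
proof (rule has_derivative_imp_has_field_derivative[OF has_derivative_dir_deriv[OF assms]])
  show "h * dir_deriv f x 1 = dir_deriv f x h" for h
    using linear_scale[OF linear_frechet_derivative[OF assms], of h 1] by simp
qed

lemma has_vector_derivative_along_line:
  assumes "(f has_derivative f') (at (c + s *\<^sub>R a))"
  shows "((\<lambda>s. f (c + s *\<^sub>R a)) has_vector_derivative f' a) (at s)"
proof -
  have "((\<lambda>s. c + s *\<^sub>R a) has_derivative (\<lambda>t. t *\<^sub>R a)) (at s)"
    by (auto intro!: derivative_eq_intros)
  then have "((\<lambda>s. f (c + s *\<^sub>R a)) has_derivative (\<lambda>t. f' (t *\<^sub>R a))) (at s)"
    using assms by (rule has_derivative_compose)
  then show ?thesis
    using has_derivative_linear[OF assms] by (simp add: has_vector_derivative_def linear_scale)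
qed

lemma Ck_on_cong:
  assumes "open S" "\<And>y. y \<in> S \<Longrightarrow> f y = g y"
  shows "Ck_on k f S \<longleftrightarrow> Ck_on k g S"
  using assms(2)
proof (induction k arbitrary: f g)
  case 0
  then show ?case by (simp cong: continuous_on_cong)
next
  case (Suc k)
  have "f differentiable (at x) \<longleftrightarrow> g differentiable (at x)" if "x \<in> S" for x
    unfolding differentiable_def
    using has_derivative_transform_within_open[OF _ assms(1) that] Suc.prems by metis
  moreover have "Ck_on k (\<lambda>x. dir_deriv f x v) S \<longleftrightarrow> Ck_on k (\<lambda>x. dir_deriv g x v) S" for v
    using dir_deriv_cong[OF assms(1), of _ f g] Suc.prems by (intro Suc.IH) metis
  ultimately show ?case by auto
qed

lemma Ck_on_SucI:
  assumes "open S" "\<And>x. x \<in> S \<Longrightarrow> (f has_derivative f' x) (at x)"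
    and "\<And>v. Ck_on k (\<lambda>x. f' x v) S"
  shows "Ck_on (Suc k) f S"
proof -
  have "Ck_on k (\<lambda>x. dir_deriv f x v) S" for v
    using assms dir_deriv_eqI[OF assms(2)]
    by (subst Ck_on_cong[where g = "\<lambda>x. f' x v"]) auto
  then show ?thesis
    using assms(2) by (auto simp: differentiable_def)
qed

lemma Ck_on_SucD:
  assumes "Ck_on (Suc k) f S"
  shows "Ck_on k f S"
  using assms
proof (induction k arbitrary: f)
  case 0
  then show ?case
    by (auto intro!: continuous_at_imp_continuous_on differentiable_imp_continuous_within)
next
  case (Suc k)
  then show ?case by auto
qed

lemma Ck_on_const: "open S \<Longrightarrow> Ck_on k (\<lambda>x. c) S"
  by (induction k arbitrary: c) auto

lemma Ck_on_add:
  assumes "open S"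
  shows "Ck_on k f S \<Longrightarrow> Ck_on k g S \<Longrightarrow> Ck_on k (\<lambda>x. f x + g x) S"
proof (induction k arbitrary: f g)
  case 0
  then show ?case by (auto intro: continuous_intros)
next
  case (Suc k)
  show ?case
    by (rule Ck_on_SucI[OF assms, where f' = "\<lambda>x v. dir_deriv f x v + dir_deriv g x v"])
      (use Suc in \<open>auto intro!: has_derivative_add has_derivative_dir_deriv\<close>)
qed

lemma (in bounded_linear) Ck_on_linear:
  assumes "open S"
  shows "Ck_on k g S \<Longrightarrow> Ck_on k (\<lambda>x. f (g x)) S"
proof (induction k arbitrary: g)
  case 0
  then show ?case by (auto intro: continuous_on)
next
  case (Suc k)
  show ?case
    by (rule Ck_on_SucI[OF assms, where f' = "\<lambda>x v. f (dir_deriv g x v)"])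
      (use Suc in \<open>auto intro!: has_derivative has_derivative_dir_deriv\<close>)
qed

lemma (in bounded_bilinear) Ck_on_bilinear:
  assumes "open S"
  shows "Ck_on k f S \<Longrightarrow> Ck_on k g S \<Longrightarrow> Ck_on k (\<lambda>x. prod (f x) (g x)) S"
proof (induction k arbitrary: f g)
  case 0
  then show ?case by (auto intro: continuous_on)
next
  case (Suc k)
  show ?case
  proof (rule Ck_on_SucI[OF assms, where f' = "\<lambda>x v. prod (f x) (dir_deriv g x v)
      + prod (dir_deriv f x v) (g x)"])
    show "((\<lambda>x. prod (f x) (g x)) has_derivative
          (\<lambda>v. prod (f x) (dir_deriv g x v) + prod (dir_deriv f x v) (g x))) (at x)" if "x \<in> S" for x
      using Suc.prems that by (auto intro!: FDERIV has_derivative_dir_deriv)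
    show "Ck_on k (\<lambda>x. prod (f x) (dir_deriv g x v) + prod (dir_deriv f x v) (g x)) S" for v
      using Suc.prems Ck_on_SucD[OF Suc.prems(1)] Ck_on_SucD[OF Suc.prems(2)]
      by (auto intro!: Ck_on_add Suc.IH assms)
  qed
qed

lemma Ck_on_mult:
  fixes f g :: "'a::real_normed_vector \<Rightarrow> real"
  shows "open S \<Longrightarrow> Ck_on k f S \<Longrightarrow> Ck_on k g S \<Longrightarrow> Ck_on k (\<lambda>x. f x * g x) S"
  by (rule bounded_bilinear.Ck_on_bilinear[OF bounded_bilinear_mult])

lemma Ck_on_diff:
  fixes f g :: "'a::real_normed_vector \<Rightarrow> 'b::real_normed_vector"
  assumes "open S" "Ck_on k f S" "Ck_on k g S"
  shows "Ck_on k (\<lambda>x. f x - g x) S"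
  using Ck_on_add[OF assms(1,2) bounded_linear.Ck_on_linear[OF bounded_linear_minus[OF
      bounded_linear_ident] assms(1,3)]]
  by simp

lemma Ck_on_inverse:
  fixes f :: "'a::real_normed_vector \<Rightarrow> real"
  assumes "open S" "\<And>x. x \<in> S \<Longrightarrow> f x \<noteq> 0"
  shows "Ck_on k f S \<Longrightarrow> Ck_on k (\<lambda>x. inverse (f x)) S"
proof (induction k)
  case 0
  then show ?case using assms by (auto intro!: continuous_intros)
next
  case (Suc k)
  have C: "Ck_on k (\<lambda>x. inverse (f x)) S" using Suc Ck_on_SucD by blast
  show ?case
  proof (rule Ck_on_SucI[OF assms(1), where f' = "\<lambda>x v.
      - (inverse (f x) * dir_deriv f x v * inverse (f x))"])
    show "((\<lambda>x. inverse (f x)) has_derivative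
          (\<lambda>v. - (inverse (f x) * dir_deriv f x v * inverse (f x)))) (at x)" if "x \<in> S" for x
      using Suc.prems that assms(2)
      by (intro Deriv.has_derivative_inverse has_derivative_dir_deriv) auto
    show "Ck_on k (\<lambda>x. - (inverse (f x) * dir_deriv f x v * inverse (f x))) S" for v
      using Suc.prems C
      by (intro bounded_linear.Ck_on_linear[OF bounded_linear_minus[OF bounded_linear_ident]]
          bounded_bilinear.Ck_on_bilinear[OF bounded_bilinear_mult] assms) auto
  qed
qed

lemma Ck_on_divide:
  fixes f g :: "'a::real_normed_vector \<Rightarrow> real"
  assumes "open S" "Ck_on k f S" "Ck_on k g S" "\<And>x. x \<in> S \<Longrightarrow> g x \<noteq> 0"
  shows "Ck_on k (\<lambda>x. f x / g x) S"
  unfolding divide_inverse using assms by (intro Ck_on_mult Ck_on_inverse)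

lemma Ck_on_Suc_realI:
  assumes "open S" "\<And>x. x \<in> S \<Longrightarrow> (f has_real_derivative f' x) (at x)" "Ck_on k f' S"
  shows "Ck_on (Suc k) f S"
proof (rule Ck_on_SucI[OF assms(1)])
  show "(f has_derivative (*) (f' x)) (at x)" if "x \<in> S" for x
    using assms(2)[OF that] by (simp add: has_field_derivative_def)
  show "Ck_on k (\<lambda>x. f' x * v) S" for v
    by (intro Ck_on_mult Ck_on_const assms)
qed

lemma Ck_on_ident: "open S \<Longrightarrow> Ck_on k (\<lambda>x::real. x) S"
  by (cases k) (auto intro!: Ck_on_Suc_realI Ck_on_const simp: continuous_on_id)

lemma Ck_on_compose_real:
  fixes f g :: "real \<Rightarrow> real"
  assumes "open S" "open T" "g ` S \<subseteq> T"
  shows "Ck_on k f T \<Longrightarrow> Ck_on k g S \<Longrightarrow> Ck_on k (\<lambda>x. f (g x)) S"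
proof (induction k arbitrary: f)
  case 0
  then show ?case using assms continuous_on_compose2 by auto
next
  case (Suc k)
  show ?case
  proof (rule Ck_on_Suc_realI[OF assms(1)])
    fix x assume x: "x \<in> S"
    have "(f has_real_derivative dir_deriv f (g x) 1) (at (g x))"
        "(g has_real_derivative dir_deriv g x 1) (at x)"
      using Suc.prems x assms(3) by (auto intro!: has_real_derivative_dir_deriv)
    then show "((\<lambda>x. f (g x)) has_real_derivative dir_deriv f (g x) 1 * dir_deriv g x 1) (at x)"
      by (rule DERIV_chain2)
  next
    show "Ck_on k (\<lambda>x. dir_deriv f (g x) 1 * dir_deriv g x 1) S"
      using Suc.prems Ck_on_SucD[OF Suc.prems(2)]
      by (intro Ck_on_mult assms Suc.IH[of "\<lambda>x. dir_deriv f x 1"]) auto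
  qed
qed

lemma smooth_on_cong:
  "open S \<Longrightarrow> (\<And>y. y \<in> S \<Longrightarrow> f y = g y) \<Longrightarrow> smooth_on f S \<longleftrightarrow> smooth_on g S"
  unfolding smooth_on_def using Ck_on_cong by blast

lemma smooth_on_differentiable: "smooth_on f S \<Longrightarrow> x \<in> S \<Longrightarrow> f differentiable (at x)"
  unfolding smooth_on_def by (metis Ck_on.simps(2))

lemma smooth_on_has_derivative:
  "smooth_on f S \<Longrightarrow> x \<in> S \<Longrightarrow> (f has_derivative dir_deriv f x) (at x)"
  by (simp add: has_derivative_dir_deriv smooth_on_differentiable)

lemma smooth_on_continuous: "smooth_on f S \<Longrightarrow> continuous_on S f"
  unfolding smooth_on_def by (metis Ck_on.simps(1))

lemma smooth_on_dir_deriv: "smooth_on f S \<Longrightarrow> smooth_on (\<lambda>x. dir_deriv f x v) S"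
  unfolding smooth_on_def by (metis Ck_on.simps(2))

lemma smooth_on_subset: "smooth_on f S \<Longrightarrow> T \<subseteq> S \<Longrightarrow> smooth_on f T"
proof -
  have "Ck_on k f S \<Longrightarrow> Ck_on k f T" if "T \<subseteq> S" for k
    using that by (induction k arbitrary: f) (auto intro: continuous_on_subset)
  then show "smooth_on f S \<Longrightarrow> T \<subseteq> S \<Longrightarrow> smooth_on f T" by (simp add: smooth_on_def)
qed

lemma smooth_on_const: "open S \<Longrightarrow> smooth_on (\<lambda>x. c) S"
  by (simp add: smooth_on_def Ck_on_const)

lemma smooth_on_add: "open S \<Longrightarrow> smooth_on f S \<Longrightarrow> smooth_on g S \<Longrightarrow> smooth_on (\<lambda>x. f x + g x) S"
  by (simp add: smooth_on_def Ck_on_add)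

lemma smooth_on_diff: "open S \<Longrightarrow> smooth_on f S \<Longrightarrow> smooth_on g S \<Longrightarrow> smooth_on (\<lambda>x. f x - g x) S"
  by (simp add: smooth_on_def Ck_on_diff)

lemma smooth_on_inner:
  "open S \<Longrightarrow> smooth_on f S \<Longrightarrow> smooth_on g S \<Longrightarrow> smooth_on (\<lambda>x. f x \<bullet> g x) S"
  by (simp add: smooth_on_def bounded_bilinear.Ck_on_bilinear[OF bounded_bilinear_inner])

lemma smooth_on_scaleR:
  "open S \<Longrightarrow> smooth_on f S \<Longrightarrow> smooth_on g S \<Longrightarrow> smooth_on (\<lambda>x. f x *\<^sub>R g x) S"
  by (simp add: smooth_on_def bounded_bilinear.Ck_on_bilinear[OF bounded_bilinear_scaleR])

lemma smooth_on_mult: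
  fixes f g :: "'a::real_normed_vector \<Rightarrow> real"
  shows "open S \<Longrightarrow> smooth_on f S \<Longrightarrow> smooth_on g S \<Longrightarrow> smooth_on (\<lambda>x. f x * g x) S"
  by (simp add: smooth_on_def Ck_on_mult)

lemma smooth_on_divide:
  fixes f g :: "'a::real_normed_vector \<Rightarrow> real"
  shows "open S \<Longrightarrow> smooth_on f S \<Longrightarrow> smooth_on g S \<Longrightarrow> (\<And>x. x \<in> S \<Longrightarrow> g x \<noteq> 0) \<Longrightarrow>
    smooth_on (\<lambda>x. f x / g x) S"
  by (simp add: smooth_on_def Ck_on_divide)

lemma smooth_on_sum:
  assumes "open S" "\<And>i. i \<in> A \<Longrightarrow> smooth_on (f i) S"
  shows "smooth_on (\<lambda>x. \<Sum>i\<in>A. f i x) S"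
  using assms(2)
  by (induction A rule: infinite_finite_induct) (auto intro: smooth_on_const smooth_on_add assms(1))

lemma smooth_on_prod:
  fixes f :: "'i \<Rightarrow> 'a::real_normed_vector \<Rightarrow> real"
  assumes "open S" "\<And>i. i \<in> A \<Longrightarrow> smooth_on (f i) S"
  shows "smooth_on (\<lambda>x. \<Prod>i\<in>A. f i x) S"
  using assms(2)
  by (induction A rule: infinite_finite_induct) (auto intro: smooth_on_const smooth_on_mult assms(1))

lemma smooth_on_ident_real: "open S \<Longrightarrow> smooth_on (\<lambda>x::real. x) S"
  by (simp add: smooth_on_def Ck_on_ident)

text \<open>The derivative \<open>f'/(2 sqrt f)\<close> is as smooth as \<open>sqrt f\<close>, which drives the induction.\<close>

lemma smooth_on_sqrt:
  fixes f :: "'a::real_normed_vector \<Rightarrow> real"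
  assumes "open S" "smooth_on f S" "\<And>x. x \<in> S \<Longrightarrow> f x > 0"
  shows "smooth_on (\<lambda>x. sqrt (f x)) S"
  unfolding smooth_on_def
proof
  fix k
  show "Ck_on k (\<lambda>x. sqrt (f x)) S"
  proof (induction k)
    case 0
    then show ?case using smooth_on_continuous[OF assms(2)] by (auto intro: continuous_intros)
  next
    case (Suc k)
    show ?case
    proof (rule Ck_on_SucI[OF assms(1)])
      show "((\<lambda>x. sqrt (f x)) has_derivative (\<lambda>v. dir_deriv f x v / (2 * sqrt (f x)))) (at x)" if
          "x \<in> S" for x
        using assms(3)[OF that]
        by (auto intro!: derivative_eq_intros smooth_on_has_derivative[OF assms(2) that] simp: field_simps)
      show "Ck_on k (\<lambda>x. dir_deriv f x v / (2 * sqrt (f x))) S" for v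
        using assms(3) smooth_on_dir_deriv[OF assms(2), of v] less_imp_neq[OF assms(3)]
        by (intro Ck_on_divide Ck_on_mult Ck_on_const Suc.IH assms) (auto simp: smooth_on_def)
    qed
  qed
qed

lemma vec_eq_sum_axis: "(a :: real^'n) = (\<Sum>i\<in>UNIV. (a $ i) *\<^sub>R axis i 1)"
  by (auto simp: vec_eq_iff axis_def if_distrib cong: if_cong)

lemma linear_eq_sum_axis:
  assumes "linear (L :: real^'n \<Rightarrow> 'e::real_vector)"
  shows "L a = (\<Sum>i\<in>UNIV. (a $ i) *\<^sub>R L (axis i 1))"
proof -
  have "L a = L (\<Sum>i\<in>UNIV. (a $ i) *\<^sub>R axis i 1)"
    by (rule arg_cong[OF vec_eq_sum_axis])
  also have "\<dots> = (\<Sum>i\<in>UNIV. (a $ i) *\<^sub>R L (axis i 1))"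
    by (simp add: linear_sum[OF assms] linear_scale[OF assms])
  finally show ?thesis .
qed

lemma smooth_on_vec_nth:
  fixes f :: "'a::real_normed_vector \<Rightarrow> real^'n"
  shows "open S \<Longrightarrow> smooth_on f S \<Longrightarrow> smooth_on (\<lambda>x. f x $ i) S"
  unfolding smooth_on_def by (blast intro: bounded_linear.Ck_on_linear[OF bounded_linear_vec_nth])

lemma smooth_on_vec:
  fixes f :: "'a::real_normed_vector \<Rightarrow> real^'n"
  assumes "open S" "\<And>i. smooth_on (\<lambda>x. f x $ i) S"
  shows "smooth_on f S"
proof -
  have "f = (\<lambda>x. \<Sum>i\<in>UNIV. (f x $ i) *\<^sub>R axis i 1)"
    using vec_eq_sum_axis by (simp only: fun_eq_iff) blast
  moreover have "smooth_on (\<lambda>x. \<Sum>i\<in>UNIV. (f x $ i) *\<^sub>R (axis i 1 :: real^'n)) S"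
    by (intro smooth_on_sum smooth_on_scaleR smooth_on_const assms)
  ultimately show ?thesis by simp
qed

lemma smooth_on_dir_deriv_field:
  fixes F :: "real^'n \<Rightarrow> 'b::real_normed_vector"
  assumes "open S" "smooth_on F S" "smooth_on X S"
  shows "smooth_on (\<lambda>x. dir_deriv F x (X x)) S"
proof -
  have "smooth_on (\<lambda>x. \<Sum>i\<in>UNIV. (X x $ i) *\<^sub>R dir_deriv F x (axis i 1)) S"
    by (intro smooth_on_sum smooth_on_scaleR smooth_on_vec_nth smooth_on_dir_deriv assms)
  then show ?thesis
    using linear_eq_sum_axis[OF linear_frechet_derivative[OF smooth_on_differentiable[OF assms(2)]]]
    by (subst smooth_on_cong[OF assms(1)]) auto
qed

lemma smooth_on_det:
  fixes A :: "'a::real_normed_vector \<Rightarrow> real^'n^'n"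
  assumes "open S" "\<And>i j. smooth_on (\<lambda>x. A x $ i $ j) S"
  shows "smooth_on (\<lambda>x. det (A x)) S"
  unfolding det_def by (intro smooth_on_sum smooth_on_mult smooth_on_const smooth_on_prod assms)

text \<open>Two applications of the mean value theorem express the second difference of \<open>f\<close> over a small
  parallelogram through either iterated derivative; shrink the parallelogram.\<close>

lemma symmetric_second_derivative_real:
  fixes f :: "'a::real_normed_vector \<Rightarrow> real"
  assumes S: "open S" "x \<in> S" and f: "Ck_on 2 f S"
  shows "dir_deriv (\<lambda>y. dir_deriv f y a) x b = dir_deriv (\<lambda>y. dir_deriv f y b) x a"
proof -
  have D1: "(f has_derivative dir_deriv f y) (at y)" if "y \<in> S" for y
    using f that by (auto simp: numeral_2_eq_2 intro!: has_derivative_dir_deriv)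
  have D2: "((\<lambda>y. dir_deriv f y a) has_derivative dir_deriv (\<lambda>y. dir_deriv f y a) y) (at y)" if
      "y \<in> S" for y a
    using f that by (auto simp: numeral_2_eq_2 intro!: has_derivative_dir_deriv)
  have C: "continuous_on S (\<lambda>y. dir_deriv (\<lambda>y. dir_deriv f y a) y b)" for a b
    using f by (auto simp: numeral_2_eq_2)
  show ?thesis
  proof (rule ccontr)
    let ?A = "dir_deriv (\<lambda>y. dir_deriv f y a) x b" and ?B = "dir_deriv (\<lambda>y. dir_deriv f y b) x a"
    assume "?A \<noteq> ?B"
    then have e: "\<bar>?A - ?B\<bar> / 2 > 0" by simp
    have cont: "isCont (\<lambda>y. dir_deriv (\<lambda>y. dir_deriv f y a) y b) x" for a b
      using C S continuous_on_eq_continuous_at by blast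
    obtain r where r: "r > 0" "ball x r \<subseteq> S"
      using S open_contains_ball by blast
    obtain r1 where r1: "r1 > 0" "\<forall>y. dist y x < r1 \<longrightarrow>
        dist (dir_deriv (\<lambda>y. dir_deriv f y a) y b) ?A < \<bar>?A - ?B\<bar> / 2"
      using cont[of a b] e unfolding continuous_at_eps_delta by blast
    obtain r2 where r2: "r2 > 0" "\<forall>y. dist y x < r2 \<longrightarrow>
        dist (dir_deriv (\<lambda>y. dir_deriv f y b) y a) ?B < \<bar>?A - ?B\<bar> / 2"
      using cont[of b a] e unfolding continuous_at_eps_delta by blast
    define c where "c = 2 * (1 + norm a + norm b)"
    have c: "c > 0" unfolding c_def by (smt (verit) norm_ge_zero)
    \<comment> \<open>Parallelograms with side parameters at most \<open>h\<close> stay close to \<open>x\<close>.\<close>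
    define h where "h = min r (min r1 r2) / c"
    have h: "h > 0" using r r1 r2 c by (simp add: h_def)
    have near: "dist (x + s *\<^sub>R a + t *\<^sub>R b) x < min r (min r1 r2)" if "0 \<le> s" "s \<le> h" "0 \<le> t"
        "t \<le> h" for s t
    proof -
      have "norm (s *\<^sub>R a + t *\<^sub>R b) \<le> h * norm a + h * norm b"
        using that by (intro norm_triangle_le add_mono) (auto intro!: mult_right_mono)
      also have "\<dots> < 2 * h * (1 + norm a + norm b)"
        using h mult_nonneg_nonneg[of h "norm a"] mult_nonneg_nonneg[of h "norm b"]
        by (simp add: algebra_simps add_nonneg_pos)
      also have "\<dots> = h * c" by (simp add: c_def)
      also have "\<dots> = min r (min r1 r2)" using c by (simp add: h_def)
      finally show ?thesis by (simp add: dist_norm add.assoc)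
    qed
    have inS: "x + s *\<^sub>R a + t *\<^sub>R b \<in> S" if "0 \<le> s" "s \<le> h" "0 \<le> t" "t \<le> h" for s t
      using near[OF that] r(2) by (auto simp: dist_commute)
    have key: "\<exists>s1 t1. 0 < s1 \<and> s1 < h \<and> 0 < t1 \<and> t1 < h \<and>
        f (x + h *\<^sub>R a + h *\<^sub>R b) - f (x + h *\<^sub>R a) - f (x + h *\<^sub>R b) + f x
         = h * h * dir_deriv (\<lambda>y. dir_deriv f y a) (x + s1 *\<^sub>R a + t1 *\<^sub>R b) b"
      if inS: "\<And>s t. 0 \<le> s \<Longrightarrow> s \<le> h \<Longrightarrow> 0 \<le> t \<Longrightarrow> t \<le> h \<Longrightarrow> x + s *\<^sub>R a + t *\<^sub>R b \<in> S" for a b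
    proof -
      let ?k = "\<lambda>s. f (x + s *\<^sub>R a + h *\<^sub>R b) - f (x + s *\<^sub>R a)"
      have dk: "(?k has_real_derivative (dir_deriv f (x + s *\<^sub>R a + h *\<^sub>R b) a - dir_deriv f (x
          + s *\<^sub>R a) a)) (at s)"
        if "0 \<le> s" "s \<le> h" for s
      proof -
        have i1: "x + s *\<^sub>R a + h *\<^sub>R b \<in> S" "x + s *\<^sub>R a \<in> S"
          using that h inS[of s h] inS[of s 0] by auto
        have "((\<lambda>s. f ((x + h *\<^sub>R b) + s *\<^sub>R a)) has_vector_derivative dir_deriv f (x + s *\<^sub>R a
            + h *\<^sub>R b) a) (at s)"
          by (rule has_vector_derivative_along_line) (use D1[OF i1(1)] in \<open>simp add: algebra_simps\<close>)
        moreover have "((\<lambda>s. f (x + s *\<^sub>R a)) has_vector_derivative dir_deriv f (x + s *\<^sub>R a) a) (at s)"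
          by (rule has_vector_derivative_along_line) (use D1[OF i1(2)] in simp)
        ultimately show ?thesis
          by (auto simp: has_real_derivative_iff_has_vector_derivative algebra_simps
              intro!: has_vector_derivative_diff)
      qed
      obtain s1 where s1: "0 < s1" "s1 < h" and e1: "?k h - ?k 0 = (h - 0) * (dir_deriv f (x
          + s1 *\<^sub>R a + h *\<^sub>R b) a - dir_deriv f (x + s1 *\<^sub>R a) a)"
        using MVT2[OF h, of ?k "\<lambda>s. dir_deriv f (x + s *\<^sub>R a + h *\<^sub>R b) a - dir_deriv f (x
            + s *\<^sub>R a) a"] dk by auto
      let ?l = "\<lambda>t. dir_deriv f (x + s1 *\<^sub>R a + t *\<^sub>R b) a"
      have dl: "(?l has_real_derivative (dir_deriv (\<lambda>y. dir_deriv f y a) (x + s1 *\<^sub>R a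
          + t *\<^sub>R b) b)) (at t)"
        if "0 \<le> t" "t \<le> h" for t
      proof -
        have i1: "x + s1 *\<^sub>R a + t *\<^sub>R b \<in> S" using that h inS s1 by auto
        show ?thesis
          unfolding has_real_derivative_iff_has_vector_derivative
          by (rule has_vector_derivative_along_line) (rule D2[OF i1])
      qed
      obtain t1 where t1: "0 < t1" "t1 < h" and e2: "?l h - ?l 0 = (h
          - 0) * dir_deriv (\<lambda>y. dir_deriv f y a) (x + s1 *\<^sub>R a + t1 *\<^sub>R b) b"
        using MVT2[OF h, of ?l "\<lambda>t. dir_deriv (\<lambda>y. dir_deriv f y a) (x + s1 *\<^sub>R a + t *\<^sub>R b) b"] dl by auto
      show ?thesis
        using s1 t1 e1 e2 by (intro exI[of _ s1] exI[of _ t1]) (simp add: algebra_simps)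
    qed
    from key[of a b, OF inS] obtain s t where st: "0 < s" "s < h" "0 < t" "t < h" "f (x + h *\<^sub>R a
        + h *\<^sub>R b) - f (x + h *\<^sub>R a) - f (x + h *\<^sub>R b) + f x
       = h * h * dir_deriv (\<lambda>y. dir_deriv f y a) (x + s *\<^sub>R a + t *\<^sub>R b) b" by blast
    have swap: "x + t *\<^sub>R b + s *\<^sub>R a = x + s *\<^sub>R a + t *\<^sub>R b" for s t by (simp add: algebra_simps)
    have "x + s *\<^sub>R b + t *\<^sub>R a \<in> S" if "0 \<le> s" "s \<le> h" "0 \<le> t" "t \<le> h" for s t
      unfolding swap using inS that by blast
    from key[of b a, OF this] obtain s' t' where st': "0 < s'" "s' < h" "0 < t'" "t' < h"
      "f (x + h *\<^sub>R b + h *\<^sub>R a) - f (x + h *\<^sub>R b) - f (x + h *\<^sub>R a) + f x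
       = h * h * dir_deriv (\<lambda>y. dir_deriv f y b) (x + s' *\<^sub>R b + t' *\<^sub>R a) a" by blast
    have "h * h * dir_deriv (\<lambda>y. dir_deriv f y a) (x + s *\<^sub>R a + t *\<^sub>R b) b
        = h * h * dir_deriv (\<lambda>y. dir_deriv f y b) (x + t' *\<^sub>R a + s' *\<^sub>R b) a"
      using st(5) st'(5) unfolding swap by linarith
    then have eq: "dir_deriv (\<lambda>y. dir_deriv f y a) (x + s *\<^sub>R a + t *\<^sub>R b) b
        = dir_deriv (\<lambda>y. dir_deriv f y b) (x + t' *\<^sub>R a + s' *\<^sub>R b) a" using h by simp
    have "dist (dir_deriv (\<lambda>y. dir_deriv f y a) (x + s *\<^sub>R a + t *\<^sub>R b) b) ?A < \<bar>?A - ?B\<bar> / 2"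
      using near[of s t] st r1(2) by simp
    moreover have "dist (dir_deriv (\<lambda>y. dir_deriv f y b) (x + t' *\<^sub>R a + s' *\<^sub>R b) a) ?B < \<bar>?A - ?B\<bar> / 2"
      using near[of t' s'] st' r2(2) by simp
    ultimately have "dist ?A ?B < \<bar>?A - ?B\<bar>" unfolding eq by (rule dist_triangle_half_r)
    then show False by (simp add: dist_real_def)
  qed
qed

lemma smooth_on_symmetric_second_derivative:
  fixes f :: "'a::real_normed_vector \<Rightarrow> 'b::euclidean_space"
  assumes S: "open S" "x \<in> S" and f: "smooth_on f S"
  shows "dir_deriv (\<lambda>y. dir_deriv f y a) x b = dir_deriv (\<lambda>y. dir_deriv f y b) x a"
proof (rule euclidean_eqI)
  fix i :: 'b
  let ?g = "\<lambda>y. f y \<bullet> i"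
  have g: "smooth_on ?g S" using smooth_on_inner[OF S(1) f smooth_on_const] S by blast
  have 1: "dir_deriv ?g y c = dir_deriv f y c \<bullet> i" if "y \<in> S" for y c
    by (rule dir_deriv_eqI) (auto intro!: derivative_eq_intros smooth_on_has_derivative[OF f that])
  have 2: "dir_deriv (\<lambda>y. dir_deriv ?g y c) x d = dir_deriv (\<lambda>y. dir_deriv f y c) x d \<bullet> i" for c d
  proof -
    have "dir_deriv (\<lambda>y. dir_deriv ?g y c) x d = dir_deriv (\<lambda>y. dir_deriv f y c \<bullet> i) x d"
      by (subst dir_deriv_cong[OF S]) (auto simp: 1)
    also have "\<dots> = dir_deriv (\<lambda>y. dir_deriv f y c) x d \<bullet> i"
      by (rule dir_deriv_eqI)
        (auto intro!: derivative_eq_intros smooth_on_has_derivative[OF smooth_on_dir_deriv[OF f] S(2)])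
    finally show ?thesis .
  qed
  show "dir_deriv (\<lambda>y. dir_deriv f y a) x b \<bullet> i = dir_deriv (\<lambda>y. dir_deriv f y b) x a \<bullet> i"
    using symmetric_second_derivative_real[OF S, of ?g a b] g 2 by (auto simp: smooth_on_def)
qed

text \<open>Injectivity is Rolle's theorem, and invariance of domain on the line makes the inverse
  continuous.\<close>

lemma real_inverse_function:
  fixes f f' :: "real \<Rightarrow> real"
  assumes I: "open_interval I" and f: "\<And>x. x \<in> I \<Longrightarrow> (f has_real_derivative f' x) (at x)"
    and nz: "\<And>x. x \<in> I \<Longrightarrow> f' x \<noteq> 0"
  shows "\<exists>g. open_interval (f ` I) \<and>
    (\<forall>x\<in>I. g (f x) = x \<and> (g has_real_derivative inverse (f' x)) (at (f x)))"
proof -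
  have oI: "open I" and iI: "is_interval I" and ne: "I \<noteq> {}" using I by (auto simp: open_interval_def)
  have cont: "continuous_on I f" 
    by (rule DERIV_continuous_on[OF has_field_derivative_at_within[OF f]])
  have ne': "f x \<noteq> f y" if xy: "x \<in> I" "y \<in> I" "x < y" for x y
  proof
    assume eq: "f x = f y"
    have sub: "{x..y} \<subseteq> I" using mem_is_interval_1_I[OF iI xy(1,2)] by auto
    have der: "(f has_real_derivative f' u) (at u)" if "x \<le> u" "u \<le> y" for u
      using f sub that by auto
    obtain z where z: "x < z" "z < y" "f y - f x = (y - x) * f' z"
      using MVT2[OF xy(3) der] by blast
    then have "f' z = 0" using eq xy(3) by simp
    moreover have "z \<in> I" using z sub by auto
    ultimately show False using nz by blast
  qed
  have inj: "inj_on f I"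
    by (rule inj_onI) (metis ne' linorder_neqE)
  have op: "open (f ` U)" if "open U" "U \<subseteq> I" for U
    by (rule invariance_of_domain[OF continuous_on_subset[OF cont that(2)] that(1) inj_on_subset[OF
        inj that(2)]])
  have "open_interval (f ` I)"
    using op[OF oI] ne iI cont by (simp add: open_interval_def is_interval_connected_1
        connected_continuous_image)
  moreover define g where "g = inv_into I f"
  have gf: "g (f x) = x" if "x \<in> I" for x using that inj by (simp add: g_def)
  moreover have "(g has_real_derivative inverse (f' x)) (at (f x))" if x: "x \<in> I" for x
  proof -
    have "isCont g (f x)"
      unfolding continuous_at_open
    proof (intro allI impI)
      fix U assume U: "open U \<and> g (f x) \<in> U"
      then show "\<exists>S. open S \<and> f x \<in> S \<and> (\<forall>x'\<in>S. g x' \<in> U)"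
        using op[of "U \<inter> I"] oI gf x by (intro exI[of _ "f ` (U \<inter> I)"]) (auto simp: open_Int)
    qed
    moreover have "f (g z) = z" if "z \<in> f ` I" for z using gf that by auto
    ultimately show ?thesis
      using f[OF x] nz[OF x] op[OF oI] x gf
      by (intro has_field_derivative_inverse_basic[where f = f and t = "f ` I"]) auto
  qed
  ultimately show ?thesis by blast
qed

text \<open>The derivative of \<open>g\<close> is \<open>1/f'\<close> composed with \<open>g\<close>, so each order of differentiability of \<open>g\<close> gives the
  next one.\<close>

lemma smooth_on_inverse_function:
  fixes f g f' :: "real \<Rightarrow> real"
  assumes I: "open I" "open (f ` I)" and f': "smooth_on f' I" "\<And>x. x \<in> I \<Longrightarrow> f' x \<noteq> 0"
    and g: "\<And>x. x \<in> I \<Longrightarrow> g (f x) = x \<and> (g has_real_derivative inverse (f' x)) (at (f x))"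
  shows "smooth_on g (f ` I)"
  unfolding smooth_on_def
proof
  fix k
  show "Ck_on k g (f ` I)"
  proof (induction k)
    case 0
    have "isCont g y" if "y \<in> f ` I" for y using that g DERIV_isCont by blast
    then show ?case by (simp add: continuous_at_imp_continuous_on)
  next
    case (Suc k)
    have "Ck_on k (\<lambda>x. inverse (f' x)) I"
      using f'(1) Ck_on_inverse[OF I(1) f'(2)] by (simp add: smooth_on_def)
    moreover have "g ` f ` I \<subseteq> I" using g by auto
    ultimately have "Ck_on k (\<lambda>y. inverse (f' (g y))) (f ` I)"
      using Ck_on_compose_real[OF I(2,1), of g k "\<lambda>x. inverse (f' x)"] Suc by blast
    then show ?case using g I by (intro Ck_on_Suc_realI[where f' = "\<lambda>y. inverse (f' (g y))"]) auto
  qed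
qed

text \<open>Gronwall's inequality for zero initial value: \<open>\<bar>Z\<bar>\<^sup>2 exp (-2Lt)\<close> does not increase.\<close>

lemma gronwall_zero:
  fixes Z :: "real \<Rightarrow> 'a::real_inner"
  assumes "0 \<le> T" and Z: "\<And>t. 0 \<le> t \<Longrightarrow> t \<le> T \<Longrightarrow> (Z has_vector_derivative Z' t) (at t)"
    and L: "\<And>t. 0 \<le> t \<Longrightarrow> t \<le> T \<Longrightarrow> norm (Z' t) \<le> L * norm (Z t)"
    and 0: "Z 0 = 0"
  shows "Z T = 0"
proof -
  let ?f = "\<lambda>t. (Z t \<bullet> Z t) * exp (- 2 * L * t)"
  have "?f T \<le> ?f 0"
  proof (rule DERIV_nonpos_imp_nonincreasing[OF assms(1)])
    fix t assume t: "0 \<le> t" "t \<le> T"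
    have "((\<lambda>t. Z t \<bullet> Z t) has_real_derivative 2 * (Z t \<bullet> Z' t)) (at t)"
      using has_derivative_inner[OF Z[OF t, unfolded has_vector_derivative_def] Z[OF t, unfolded
          has_vector_derivative_def]]
      by (simp add: has_field_derivative_def inner_commute algebra_simps mult_commute_abs)
    then have d: "(?f has_real_derivative (2 * (Z t \<bullet> Z' t)
        - 2 * L * (Z t \<bullet> Z t)) * exp (- 2 * L * t)) (at t)"
      by (auto intro!: derivative_eq_intros simp: algebra_simps)
    have "Z t \<bullet> Z' t \<le> norm (Z t) * norm (Z' t)" by (rule norm_cauchy_schwarz)
    also have "\<dots> \<le> norm (Z t) * (L * norm (Z t))" using L[OF t] by (simp add: mult_left_mono)
    also have "\<dots> = L * (Z t \<bullet> Z t)" by (simp add: dot_square_norm power2_eq_square)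
    finally have "(2 * (Z t \<bullet> Z' t) - 2 * L * (Z t \<bullet> Z t)) * exp (- 2 * L * t) \<le> 0"
      by (simp add: mult_le_0_iff)
    with d show "\<exists>y. (?f has_real_derivative y) (at t) \<and> y \<le> 0" by blast
  qed
  then have "(Z T \<bullet> Z T) * exp (- 2 * L * T) \<le> 0" using 0 by simp
  then have "Z T \<bullet> Z T \<le> 0" by (simp add: mult_le_0_iff)
  then show ?thesis by (metis inner_eq_zero_iff inner_ge_zero order_antisym)
qed

text \<open>An injective linear map is bounded below, and the error term of the derivative takes away at
  most half of the bound.\<close>

lemma has_derivative_inj_bounded_below:
  fixes f :: "'a::euclidean_space \<Rightarrow> 'b::euclidean_space"
  assumes f: "(f has_derivative f') (at x)" and inj: "inj f'"
  shows "\<exists>B>0. \<exists>d>0. \<forall>y. norm (y - x) < d \<longrightarrow> B * norm (y - x) \<le> norm (f y - f x)"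
proof -
  obtain B where B: "B > 0" "\<And>y. B * norm y \<le> norm (f' y)"
    using linear_inj_bounded_below_pos[OF has_derivative_linear[OF f] inj] by blast
  obtain d where d: "d > 0" "\<And>y. norm (y - x) < d \<Longrightarrow> norm (f y - f x - f' (y - x)) \<le> (B / 2) * norm (y - x)"
    using f B(1) unfolding has_derivative_at_alt by (meson half_gt_zero)
  have "(B / 2) * norm (y - x) \<le> norm (f y - f x)" if "norm (y - x) < d" for y
  proof -
    have "B * norm (y - x) \<le> norm (f' (y - x))" by (rule B)
    also have "\<dots> \<le> norm (f y - f x) + norm (f y - f x - f' (y - x))"
      using norm_triangle_ineq4[of "f y - f x" "f y - f x - f' (y - x)"] by simp
    finally show ?thesis using d(2)[OF that] by simp
  qed
  then show ?thesis using B d by (intro exI[of _ "B/2"]) auto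
qed

lemma differentiable_imp_lipschitz_at:
  assumes "(f has_derivative f') (at x)"
  shows "\<exists>K>0. \<exists>d>0. \<forall>y. norm (y - x) < d \<longrightarrow> norm (f y - f x) \<le> K * norm (y - x)"
proof -
  obtain K where K: "K > 0" "\<And>y. norm (f' y) \<le> norm y * K"
    using has_derivative_bounded_linear[OF assms] bounded_linear.pos_bounded by blast
  obtain d where d: "d > 0" "\<And>y. norm (y - x) < d \<Longrightarrow> norm (f y - f x - f' (y - x)) \<le> 1 * norm (y - x)"
    using assms unfolding has_derivative_at_alt by (meson zero_less_one)
  have "norm (f y - f x) \<le> (K + 1) * norm (y - x)" if "norm (y - x) < d" for y
    using d(2)[OF that] K(2)[of "y - x"] norm_triangle_sub[of "f y - f x" "f' (y - x)"]
    by (simp add: algebra_simps)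
  then show ?thesis using K d by (intro exI[of _ "K + 1"]) auto
qed

text \<open>Where the derivative of \<open>f\<close> points in the direction of \<open>f\<close> itself, only the length of \<open>f\<close> changes.\<close>

lemma has_derivative_direction_zero:
  fixes f :: "'a::real_normed_vector \<Rightarrow> 'b::real_inner"
  assumes d: "(f has_derivative (\<lambda>a. c a *\<^sub>R f u)) (at u)" and nz: "f u \<noteq> 0"
  shows "((\<lambda>u. f u /\<^sub>R norm (f u)) has_derivative (\<lambda>_. 0)) (at u)"
proof -
  have n: "((\<lambda>u. norm (f u)) has_derivative (\<lambda>a. c a * norm (f u))) (at u)"
    by (rule has_derivative_eq_rhs[OF has_derivative_compose[OF d has_derivative_norm[OF nz]]])
      (use nz in \<open>simp add: fun_eq_iff sgn_div_norm dot_square_norm power2_eq_square\<close>)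
  have nf: "norm (f u) \<noteq> 0" using nz by simp
  show ?thesis
    by (rule has_derivative_eq_rhs[OF has_derivative_scaleR[OF Deriv.has_derivative_inverse[OF nf n] d]])
      (use nz in \<open>simp add: fun_eq_iff field_simps\<close>)
qed

section \<open>Linear algebra of an immersed tangent space\<close>

definition gram :: "(real^'n \<Rightarrow> 'e::real_inner) \<Rightarrow> real^'n^'n" where
  "gram L = (\<chi> i j. L (axis i 1) \<bullet> L (axis j 1))"

text \<open>Cramer's rule for the system of normal equations. The explicit formula shows that the solution
  is smooth when the data are.\<close>

definition tangential_coeffs :: "(real^'n \<Rightarrow> 'e::real_inner) \<Rightarrow> 'e \<Rightarrow> real^'n" where
  "tangential_coeffs L y =
     (\<chi> k. det (\<chi> i j. if j = k then y \<bullet> L (axis i 1) else gram L $ i $ j) / det (gram L))"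

lemma gram_mult_vec:
  assumes "linear (L :: real^'n \<Rightarrow> 'e::real_inner)"
  shows "(gram L *v a) $ i = L a \<bullet> L (axis i 1)"
proof -
  have "L a \<bullet> L (axis i 1) = (\<Sum>j\<in>UNIV. (a $ j) *\<^sub>R L (axis j 1)) \<bullet> L (axis i 1)"
    using linear_eq_sum_axis[OF assms] by metis
  then show ?thesis
    by (simp add: gram_def matrix_vector_mult_def inner_sum_left mult.commute
        inner_commute[of "L (axis i 1)"])
qed

lemma orthogonal_range_iff:
  assumes "linear (L :: real^'n \<Rightarrow> 'e::real_inner)"
  shows "(\<forall>b. y \<bullet> L b = 0) \<longleftrightarrow> (\<forall>i. y \<bullet> L (axis i 1) = 0)"
proof
  assume "\<forall>i. y \<bullet> L (axis i 1) = 0"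
  then show "\<forall>b. y \<bullet> L b = 0"
    using linear_eq_sum_axis[OF assms] by (metis (no_types, lifting) inner_scaleR_right
        inner_sum_right mult_zero_right sum.neutral)
qed auto

lemma det_gram_nonzero:
  assumes L: "linear (L :: real^'n \<Rightarrow> 'e::real_inner)" "inj L"
  shows "det (gram L) \<noteq> 0"
proof -
  have "a = 0" if "gram L *v a = 0" for a
  proof -
    have "L a \<bullet> L (axis i 1) = 0" for i
      using gram_mult_vec[OF L(1), of a i] that by simp
    then have "L a \<bullet> L a = 0" using orthogonal_range_iff[OF L(1)] by blast
    then show "a = 0" using L linear_injective_0 by force
  qed
  then have "\<exists>B. B ** gram L = mat 1"
    unfolding matrix_left_invertible_ker by blast
  then show ?thesis
    by (simp add: invertible_left_inverse flip: invertible_det_nz)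
qed

lemma tangential_coeffs_iff:
  assumes L: "linear (L :: real^'n \<Rightarrow> 'e::real_inner)" "inj L"
  shows "(\<forall>b. (y - L a) \<bullet> L b = 0) \<longleftrightarrow> a = tangential_coeffs L y"
proof -
  have "(\<forall>b. (y - L a) \<bullet> L b = 0) \<longleftrightarrow> gram L *v a = (\<chi> i. y \<bullet> L (axis i 1))"
    unfolding orthogonal_range_iff[OF L(1)]
    by (auto simp: vec_eq_iff gram_mult_vec[OF L(1)] inner_diff_left)
  also have "\<dots> \<longleftrightarrow> a = tangential_coeffs L y"
    unfolding cramer[OF det_gram_nonzero[OF L]] tangential_coeffs_def by (simp cong: if_cong)
  finally show ?thesis .
qed

lemma smooth_on_tangential_coeffs:
  fixes L :: "'a::real_normed_vector \<Rightarrow> real^'n \<Rightarrow> 'e::real_inner"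
  assumes "open S" "\<And>x. x \<in> S \<Longrightarrow> linear (L x)" "\<And>x. x \<in> S \<Longrightarrow> inj (L x)"
    "\<And>a. smooth_on (\<lambda>x. L x a) S" "smooth_on y S"
  shows "smooth_on (\<lambda>x. tangential_coeffs (L x) (y x)) S"
proof (rule smooth_on_vec[OF assms(1)])
  have g: "smooth_on (\<lambda>x. gram (L x) $ i $ j) S" for i j
    using assms by (simp add: gram_def smooth_on_inner)
  have "smooth_on (\<lambda>x. if j = k then y x \<bullet> L x (axis i 1) else gram (L x) $ i $ j) S" for i j k
    using assms g by (cases "j = k") (auto intro!: smooth_on_inner)
  then show "smooth_on (\<lambda>x. tangential_coeffs (L x) (y x) $ k) S" for k
    unfolding tangential_coeffs_def vec_lambda_beta
    using det_gram_nonzero[OF assms(2,3)] assms(1) 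
    by (intro smooth_on_divide smooth_on_det) (auto simp: g)
qed

text \<open>The orthogonal complement of the \<open>n\<close>-dimensional range of \<open>L\<close> has dimension 1.\<close>

lemma normal_space_is_line:
  fixes L :: "real^'n \<Rightarrow> (real^'n) \<times> real"
  assumes L: "linear L" "inj L"
    and nu: "nu \<noteq> 0" "\<And>b. nu \<bullet> L b = 0" and y: "\<And>b. y \<bullet> L b = 0"
  shows "y = ((y \<bullet> nu) / (nu \<bullet> nu)) *\<^sub>R nu"
proof -
  let ?N = "{y \<in> UNIV. \<forall>x \<in> range L. orthogonal x y}"
  have "dim ?N + dim (range L) = dim (UNIV :: ((real^'n) \<times> real) set)"
    using L(1) by (intro dim_subspace_orthogonal_to_vectors) (auto simp: linear_subspace_image)
  moreover have "dim (range L) = CARD('n)"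
    using L dim_image_eq[of L UNIV] by simp
  ultimately have d: "dim ?N = 1" by simp
  define y' where "y' = y - ((y \<bullet> nu) / (nu \<bullet> nu)) *\<^sub>R nu"
  have o: "y' \<bullet> nu = 0" using nu by (simp add: y'_def inner_diff_left)
  show ?thesis
  proof (rule ccontr)
    assume "\<not> ?thesis"
    then have n0: "y' \<noteq> 0" by (simp add: y'_def)
    have ne: "y' \<noteq> nu" using o nu by auto
    have "independent {y', nu}"
      by (rule pairwise_orthogonal_independent)
        (use o n0 nu in \<open>auto simp: pairwise_def orthogonal_def inner_commute\<close>)
    moreover have "{y', nu} \<subseteq> ?N"
      using nu y by (auto simp: orthogonal_def inner_commute[of "L _"] y'_def inner_diff_left)
    ultimately have "card {y', nu} \<le> dim ?N" by (intro independent_card_le_dim)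
    then show False using d ne by simp
  qed
qed

text \<open>Pull back an orthonormal basis of the range of \<open>L\<close>.\<close>

lemma orthonormal_coframe_exists:
  fixes L :: "real^'n \<Rightarrow> 'e::euclidean_space"
  assumes L: "linear L" "inj L"
  shows "\<exists>e :: 'n \<Rightarrow> real^'n. \<forall>i j. L (e i) \<bullet> L (e j) = (if i = j then 1 else 0)"
proof -
  have "subspace (range L)" using L(1) by (simp add: linear_subspace_image)
  then obtain B where B: "B \<subseteq> range L" "pairwise orthogonal B" "\<And>x. x \<in> B \<Longrightarrow> norm x = 1"
      "independent B" "card B = dim (range L)" "span B = range L"
    using orthonormal_basis_subspace by metis
  have "card B = CARD('n)" using B(5) L dim_image_eq[of L UNIV] by simp
  moreover have "finite B" using B(4) independent_imp_finite by blast
  ultimately obtain h where h: "bij_betw h (UNIV :: 'n set) B"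
    by (metis finite_same_card_bij finite_class.finite_UNIV)
  have hB: "h i \<in> B" for i using h by (auto simp: bij_betw_def)
  have "L (inv L (h i)) = h i" for i using B(1) hB by (simp add: f_inv_into_f subset_iff)
  moreover have "h i \<bullet> h j = (if i = j then 1 else 0)" for i j
  proof (cases "i = j")
    case True
    then show ?thesis using B(3)[OF hB, of i] by (simp add: norm_eq_1)
  next
    case False
    then have "h i \<noteq> h j" using h by (auto simp: bij_betw_def inj_def)
    then show ?thesis using B(2) hB False by (auto simp: pairwise_def orthogonal_def)
  qed
  ultimately show ?thesis by (intro exI[of _ "\<lambda>i. inv L (h i)"]) simp
qed

lemma orthonormal_coframe_expansion:
  fixes L :: "real^'n \<Rightarrow> 'e::euclidean_space" and e :: "'n \<Rightarrow> real^'n"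
  assumes L: "linear L" "inj L" and e: "\<And>i j. L (e i) \<bullet> L (e j) = (if i = j then 1 else 0)"
  shows "(\<Sum>i\<in>UNIV. (L a \<bullet> L (e i))\<^sup>2) = L a \<bullet> L a"
proof -
  let ?B = "range (\<lambda>i. L (e i))"
  have inj: "inj (\<lambda>i. L (e i))"
  proof (rule injI)
    fix i j assume "L (e i) = L (e j)"
    then have "L (e i) \<bullet> L (e j) = 1" using e[of j j] by simp
    then show "i = j" using e[of i j] by (auto split: if_splits)
  qed
  have "independent ?B"
  proof (rule pairwise_orthogonal_independent)
    show "pairwise orthogonal ?B" by (auto simp: pairwise_def orthogonal_def e)
    show "0 \<notin> ?B"
    proof
      assume "0 \<in> ?B"
      then obtain i where "L (e i) = 0" by force
      then show False using e[of i i] by simp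
    qed
  qed
  moreover have "card ?B = CARD('n)" using inj by (simp add: card_image)
  moreover have "dim (range L) = CARD('n)" using L dim_image_eq[of L UNIV] by simp
  ultimately have sp: "range L \<subseteq> span ?B"
    by (intro card_ge_dim_independent) auto
  define y where "y = L a - (\<Sum>i\<in>UNIV. (L a \<bullet> L (e i)) *\<^sub>R L (e i))"
  have yo: "y \<bullet> L (e j) = 0" for j
    by (simp add: y_def inner_diff_left inner_sum_left e if_distrib cong: if_cong)
  have "y = L (a - (\<Sum>i\<in>UNIV. (L a \<bullet> L (e i)) *\<^sub>R e i))"
    by (simp add: y_def linear_diff[OF L(1)] linear_sum[OF L(1)] linear_scale[OF L(1)])
  then have "y \<in> range L" by (rule range_eqI)
  moreover have "y \<bullet> z = 0" if "z \<in> span ?B" for z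
    using that by (induction rule: span_induct_alt) (auto simp: inner_add_right yo)
  ultimately have "y \<bullet> y = 0" using sp by blast
  then have "L a = (\<Sum>i\<in>UNIV. (L a \<bullet> L (e i)) *\<^sub>R L (e i))" by (simp add: y_def)
  then have "L a \<bullet> L a = L a \<bullet> (\<Sum>i\<in>UNIV. (L a \<bullet> L (e i)) *\<^sub>R L (e i))" by simp
  then show ?thesis by (simp add: inner_sum_right power2_eq_square)
qed

text \<open>Twice the second elementary symmetric function of the eigenvalues \<open>p, \<dots>, p, p + m \<bar>xi\<bar>\<^sup>2\<close> of the
  matrix \<open>p + m xi xi\<^sup>T\<close>, computed as a sum of principal minors of size 2.\<close>

lemma sum_offdiag_quadratic:
  fixes xi :: "'n::finite \<Rightarrow> real"
  shows "(\<Sum>i\<in>UNIV. \<Sum>j\<in>UNIV-{i}. (p + m * (xi i)\<^sup>2) * (p + m * (xi j)\<^sup>2) - (m * xi i * xi j)\<^sup>2)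
    = real CARD('n) * (real CARD('n) - 1) * p\<^sup>2 + 2 * (real CARD('n) - 1) * p * m * (\<Sum>i\<in>UNIV. (xi i)\<^sup>2)"
proof -
  let ?n = "real CARD('n)" and ?t = "\<Sum>i\<in>UNIV. (xi i)\<^sup>2"
  have "(\<Sum>j\<in>UNIV-{i}. (p + m * (xi i)\<^sup>2) * (p + m * (xi j)\<^sup>2) - (m * xi i * xi j)\<^sup>2)
     = (?n - 1) * (p\<^sup>2 + p * m * (xi i)\<^sup>2) + p * m * (?t - (xi i)\<^sup>2)" for i
  proof -
    have "(\<Sum>j\<in>UNIV-{i}. (p + m * (xi i)\<^sup>2) * (p + m * (xi j)\<^sup>2) - (m * xi i * xi j)\<^sup>2)
       = (\<Sum>j\<in>UNIV-{i}. (p\<^sup>2 + p * m * (xi i)\<^sup>2) + p * m * (xi j)\<^sup>2)"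
      by (rule sum.cong) (auto simp: algebra_simps power2_eq_square)
    also have "\<dots> = real (card (UNIV - {i})) * (p\<^sup>2 + p * m * (xi i)\<^sup>2) + p * m * (\<Sum>j\<in>UNIV-{i}. (xi j)\<^sup>2)"
      by (simp add: sum.distrib sum_distrib_left)
    also have "real (card (UNIV - {i})) = ?n - 1"
      by (simp add: card_Diff_singleton of_nat_diff Suc_leI)
    also have "(\<Sum>j\<in>UNIV-{i}. (xi j)\<^sup>2) = ?t - (xi i)\<^sup>2" by (simp add: sum_diff1)
    finally show ?thesis .
  qed
  then show ?thesis
    by (simp add: sum.distrib sum_subtractf flip: sum_distrib_left)
      (simp add: algebra_simps power2_eq_square)
qed

section \<open>Geometry of an immersed coordinate domain\<close>

locale immersed_chart =
  fixes V :: "(real^'n) set" and F :: "real^'n \<Rightarrow> (real^'n) \<times> real"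
  assumes open_V: "open V" and smooth_F: "smooth_on F V"
    and inj_deriv: "\<And>v. v \<in> V \<Longrightarrow> inj (frechet_derivative F (at v))"

context immersed_chart
begin

text \<open>Tangent vectors of the hypersurface at \<open>F v\<close> are the vectors \<open>E v a\<close>.\<close>

abbreviation "E v a \<equiv> dir_deriv F v a"

abbreviation "F2 v a b \<equiv> dir_deriv (\<lambda>w. dir_deriv F w b) v a"

abbreviation "X \<equiv> position_tangential F"

abbreviation "nu \<equiv> position_normal F"

text \<open>The second fundamental form in the direction of \<open>\<nu>\<close>, which is not normalised. This makes it
  smooth where \<open>\<nu>\<close> vanishes, and it does not depend on an orientation.\<close>

definition second_fundamental_form ("II") where "II v a b = nu v \<bullet> F2 v a b"

definition dual_position ("\<xi>") where "\<xi> v a = F v \<bullet> E v a"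

text \<open>The Christoffel symbols: the coefficients of the tangential part of the second derivative of
  \<open>F\<close>.\<close>

definition Gam where "Gam v a b = tangential_coeffs (dir_deriv F v) (F2 v a b)"

lemmas smooth_E = smooth_on_dir_deriv[OF smooth_F]

lemmas smooth_F2 = smooth_on_dir_deriv[OF smooth_E]

lemma linear_E: "v \<in> V \<Longrightarrow> linear (dir_deriv F v)"
  using linear_frechet_derivative smooth_on_differentiable[OF smooth_F] by blast

lemma E_eq_0_iff: "v \<in> V \<Longrightarrow> E v a = 0 \<longleftrightarrow> a = 0"
  by (metis inj_deriv linear_E linear_injective_0 linear_0)

lemma F2_sym: "v \<in> V \<Longrightarrow> F2 v a b = F2 v b a"
  by (rule smooth_on_symmetric_second_derivative[OF open_V _ smooth_F])

lemma linear_F2: "v \<in> V \<Longrightarrow> linear (\<lambda>a. F2 v a b)"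
  using linear_frechet_derivative smooth_on_differentiable[OF smooth_E] by blast

lemma linear_F2': "v \<in> V \<Longrightarrow> linear (\<lambda>b. F2 v a b)"
  using linear_F2[of v] F2_sym[of v] by (simp add: linear_iff)

lemma linear_deriv: "smooth_on f V \<Longrightarrow> v \<in> V \<Longrightarrow> linear (dir_deriv f v)"
  using linear_frechet_derivative smooth_on_differentiable by blast

lemma tangential_coeffs_orthogonal:
  "v \<in> V \<Longrightarrow> y \<bullet> E v b = E v (tangential_coeffs (dir_deriv F v) y) \<bullet> E v b"
  using tangential_coeffs_iff[OF linear_E inj_deriv, of v y "tangential_coeffs (dir_deriv F v) y"]
  by (simp add: inner_diff_left)

lemma Gam_inner: "v \<in> V \<Longrightarrow> E v (Gam v a b) \<bullet> E v c = F2 v a b \<bullet> E v c"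
  unfolding Gam_def using tangential_coeffs_orthogonal by metis

lemma X_eq: "v \<in> V \<Longrightarrow> X v = tangential_coeffs (dir_deriv F v) (F v)"
  unfolding position_tangential_def using tangential_coeffs_iff[OF linear_E inj_deriv, of v "F v"]
  by simp

lemma smooth_tangential:
  "smooth_on y V \<Longrightarrow> smooth_on (\<lambda>v. tangential_coeffs (dir_deriv F v) (y v)) V"
  by (intro smooth_on_tangential_coeffs open_V linear_E inj_deriv smooth_E)

lemma smooth_Gam: "smooth_on (\<lambda>v. Gam v a b) V"
  unfolding Gam_def by (intro smooth_tangential smooth_F2)

lemma smooth_X: "smooth_on X V"
  using smooth_tangential[OF smooth_F] X_eq by (subst smooth_on_cong[OF open_V]) auto

lemma smooth_nu: "smooth_on nu V"
  unfolding position_normal_def[abs_def]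
  by (intro smooth_on_diff smooth_on_dir_deriv_field smooth_F smooth_X open_V)

lemma smooth_xi: "smooth_on (\<lambda>v. \<xi> v a) V"
  unfolding dual_position_def by (intro smooth_on_inner smooth_E smooth_F open_V)

lemma smooth_II: "smooth_on (\<lambda>v. II v a b) V"
  unfolding second_fundamental_form_def by (intro smooth_on_inner smooth_F2 smooth_nu open_V)

lemmas diffs = smooth_F[THEN smooth_on_differentiable] smooth_E[THEN smooth_on_differentiable]
  smooth_F2[THEN smooth_on_differentiable] smooth_X[THEN smooth_on_differentiable]
  smooth_nu[THEN smooth_on_differentiable] smooth_Gam[THEN smooth_on_differentiable]
  smooth_xi[THEN smooth_on_differentiable] smooth_II[THEN smooth_on_differentiable]

lemma F_split: "F v = E v (X v) + nu v"
  by (simp add: position_normal_def)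

lemma nu_orthogonal: "v \<in> V \<Longrightarrow> nu v \<bullet> E v b = 0"
  using tangential_coeffs_orthogonal[of v "F v" b] X_eq[of v]
  by (simp add: position_normal_def inner_diff_left)

lemma xi_eq: "v \<in> V \<Longrightarrow> \<xi> v a = E v (X v) \<bullet> E v a"
  using nu_orthogonal by (simp add: dual_position_def F_split inner_add_left)

lemma linear_xi: "v \<in> V \<Longrightarrow> linear (\<xi> v)"
  unfolding dual_position_def using linear_E[of v]
  by (auto simp: linear_iff inner_add_right)

lemma II_sym: "v \<in> V \<Longrightarrow> II v a b = II v b a"
  unfolding second_fundamental_form_def using F2_sym by simp

lemma deriv_E_field:
  assumes "v \<in> V" "Y differentiable (at v)"
  shows "dir_deriv (\<lambda>w. E w (Y w)) v a = F2 v a (Y v) + E v (dir_deriv Y v a)"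
proof -
  have Y: "Y w = (\<Sum>i\<in>UNIV. (Y w $ i) *\<^sub>R axis i 1)" for w by (rule vec_eq_sum_axis)
  have dYi: "(\<lambda>w. Y w $ i) differentiable (at v)" for i
    using has_derivative_dir_deriv[OF assms(2)]
    by (auto intro!: differentiableI bounded_linear.has_derivative[OF bounded_linear_vec_nth])
  have d_i: "dir_deriv (\<lambda>w. Y w $ i) v a = dir_deriv Y v a $ i" for i
    using has_derivative_dir_deriv[OF assms(2)]
    by (intro dir_deriv_eqI bounded_linear.has_derivative[OF bounded_linear_vec_nth])
  have eq: "E w (Y w) = (\<Sum>i\<in>UNIV. (Y w $ i) *\<^sub>R E w (axis i 1))" if "w \<in> V" for w
    by (rule linear_eq_sum_axis[OF linear_E[OF that]])
  have "dir_deriv (\<lambda>w. E w (Y w)) v a = dir_deriv (\<lambda>w. \<Sum>i\<in>UNIV. (Y w $ i) *\<^sub>R E w (axis i 1)) v a"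
    by (subst dir_deriv_cong[OF open_V assms(1) eq]) auto
  also have "\<dots> = (\<Sum>i\<in>UNIV. (Y v $ i) *\<^sub>R F2 v a (axis i 1) + (dir_deriv Y v a $ i) *\<^sub>R E v (axis i 1))"
  proof (rule trans[OF dir_deriv_eqI])
    show "((\<lambda>w. \<Sum>i\<in>UNIV. (Y w $ i) *\<^sub>R E w (axis i 1)) has_derivative
      (\<lambda>a. \<Sum>i\<in>UNIV. (Y v $ i) *\<^sub>R F2 v a (axis i 1) + (dir_deriv (\<lambda>w. Y w $ i) v a) *\<^sub>R E v (axis i
          1))) (at v)"
      by (intro has_derivative_sum has_derivative_scaleR has_derivative_dir_deriv dYi diffs assms)
  qed (simp add: d_i)
  also have "\<dots> = F2 v a (Y v) + E v (dir_deriv Y v a)"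
    using linear_eq_sum_axis[where L = "\<lambda>b. F2 v a b", OF linear_F2'[OF assms(1)], of "Y v"]
      linear_eq_sum_axis[OF linear_E[OF assms(1)], of "dir_deriv Y v a"]
    by (simp add: sum.distrib)
  finally show ?thesis .
qed

lemma deriv_metric:
  "v \<in> V \<Longrightarrow> dir_deriv (\<lambda>w. induced_metric F w b c) v a = F2 v a b \<bullet> E v c + E v b \<bullet> F2 v a c"
  unfolding induced_metric_def by (simp add: dir_deriv_inner diffs)

lemma christoffel_eq: "v \<in> V \<Longrightarrow> christoffel (induced_metric F) v a b = Gam v a b"
proof -
  assume v: "v \<in> V"
  have "(\<forall>d. 2 * induced_metric F v c d =
       dir_deriv (\<lambda>w. induced_metric F w b d) v a
     + dir_deriv (\<lambda>w. induced_metric F w a d) v b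
     - dir_deriv (\<lambda>w. induced_metric F w a b) v d) \<longleftrightarrow> (\<forall>d. (F2 v a b - E v c) \<bullet> E v d = 0)" for c
    using F2_sym[OF v]
    by (simp add: deriv_metric[OF v] inner_diff_left)
      (auto simp: induced_metric_def inner_commute[of "E v a"] inner_commute[of "E v b"])
  then show ?thesis
    unfolding christoffel_def Gam_def using tangential_coeffs_iff[OF linear_E inj_deriv, OF v v, of
        "F2 v a b"]
    by simp
qed

text \<open>The derivative of \<open>Gam_inner\<close> in the direction \<open>a\<close>.\<close>

lemma deriv_Gam_inner:
  assumes v: "v \<in> V"
  shows "E v (dir_deriv (\<lambda>w. Gam w b c) v a) \<bullet> E v d =
    dir_deriv (\<lambda>w. F2 w b c) v a \<bullet> E v d + F2 v b c \<bullet> F2 v a d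
     - F2 v a (Gam v b c) \<bullet> E v d - E v (Gam v b c) \<bullet> F2 v a d"
proof -
  have dE: "(\<lambda>w. E w (Gam w b c)) differentiable (at v)"
    using smooth_on_dir_deriv_field[OF open_V smooth_F smooth_Gam] smooth_on_differentiable v by blast
  have "dir_deriv (\<lambda>w. F2 w b c \<bullet> E w d) v a = dir_deriv (\<lambda>w. E w (Gam w b c) \<bullet> E w d) v a"
    by (subst dir_deriv_cong[OF open_V v]) (auto simp: Gam_inner)
  moreover have "dir_deriv (\<lambda>w. F2 w b c \<bullet> E w d) v a
     = F2 v b c \<bullet> F2 v a d + dir_deriv (\<lambda>w. F2 w b c) v a \<bullet> E v d"
    by (intro dir_deriv_inner diffs v)
  moreover have "dir_deriv (\<lambda>w. E w (Gam w b c) \<bullet> E w d) v a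
     = E v (Gam v b c) \<bullet> F2 v a d + dir_deriv (\<lambda>w. E w (Gam w b c)) v a \<bullet> E v d"
    by (intro dir_deriv_inner dE diffs v)
  moreover have "dir_deriv (\<lambda>w. E w (Gam w b c)) v a = F2 v a (Gam v b c)
      + E v (dir_deriv (\<lambda>w. Gam w b c) v a)"
    by (intro deriv_E_field diffs v)
  ultimately show ?thesis by (simp add: inner_add_left)
qed

text \<open>Alternating \<open>deriv_Gam_inner\<close> in \<open>a\<close> and \<open>b\<close> removes the third derivatives of \<open>F\<close>. The first factor of
  each product is the normal part of a second derivative of \<open>F\<close>, so only the normal part of the
  second factor counts.\<close>

lemma gauss_equation_vector:
  assumes v: "v \<in> V"
  shows "induced_metric F v (curvature (induced_metric F) v a b c) d =
     (F2 v b c - E v (Gam v b c)) \<bullet> F2 v a d - (F2 v a c - E v (Gam v a c)) \<bullet> F2 v b d"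
proof -
  have c: "dir_deriv (\<lambda>w. christoffel (induced_metric F) w b c) v a = dir_deriv (\<lambda>w. Gam w b c) v a" for a b
    by (subst dir_deriv_cong[OF open_V v]) (auto simp: christoffel_eq)
  have s: "dir_deriv (\<lambda>w. F2 w b c) v a = dir_deriv (\<lambda>w. F2 w a c) v b"
    by (rule smooth_on_symmetric_second_derivative[OF open_V v smooth_E])
  show ?thesis
    unfolding induced_metric_def[of F v _ d] curvature_def c
    using linear_E[OF v] s
    by (simp add: christoffel_eq[OF v] linear_add linear_diff inner_add_left inner_diff_left
        deriv_Gam_inner[OF v] Gam_inner[OF v])
qed

lemma gauss_equation:
  assumes v: "v \<in> V" and nu: "nu v \<noteq> 0"
  shows "induced_metric F v (curvature (induced_metric F) v a b c) d =
     (II v b c * II v a d - II v a c * II v b d) / (nu v \<bullet> nu v)"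
proof -
  have "(F2 v a b - E v (Gam v a b)) = (II v a b / (nu v \<bullet> nu v)) *\<^sub>R nu v" for a b
  proof -
    have "(F2 v a b - E v (Gam v a b)) \<bullet> E v c = 0" for c
      using Gam_inner[OF v] by (simp add: inner_diff_left)
    then have "F2 v a b - E v (Gam v a b) = 
        (((F2 v a b - E v (Gam v a b)) \<bullet> nu v) / (nu v \<bullet> nu v)) *\<^sub>R nu v"
      using normal_space_is_line[OF linear_E inj_deriv nu nu_orthogonal] v by blast
    moreover have "(F2 v a b - E v (Gam v a b)) \<bullet> nu v = II v a b"
      using nu_orthogonal[OF v] inner_commute[of _ "nu v"]
      by (simp add: second_fundamental_form_def inner_diff_right)
    ultimately show ?thesis by simp
  qed
  then show ?thesis
    by (simp add: gauss_equation_vector[OF v] diff_divide_distrib flip: second_fundamental_form_def)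
qed

lemma scalar_curvature_rank_one_perturbation:
  assumes v: "v \<in> V" and nu: "nu v \<noteq> 0"
    and II: "\<And>a b. II v a b = p * (E v a \<bullet> E v b) + m * \<xi> v a * \<xi> v b"
  shows "scalar_curvature (induced_metric F) v * (nu v \<bullet> nu v) =
     real CARD('n) * (real CARD('n) - 1) * p\<^sup>2
      + 2 * (real CARD('n) - 1) * p * m * (E v (X v) \<bullet> E v (X v))"
proof -
  define e where "e = (SOME e. orthonormal_frame (induced_metric F) v e)"
  have "\<exists>e. orthonormal_frame (induced_metric F) v e"
    using orthonormal_coframe_exists[OF linear_E inj_deriv, OF v v]
    by (simp add: orthonormal_frame_def induced_metric_def)
  then have "orthonormal_frame (induced_metric F) v e"
    unfolding e_def by (rule someI_ex)
  then have e: "E v (e i) \<bullet> E v (e j) = (if i = j then 1 else 0)" for i j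
    by (simp add: orthonormal_frame_def induced_metric_def)
  have "sectional_curvature (induced_metric F) v (e i) (e j)
     = ((p + m * (\<xi> v (e i))\<^sup>2) * (p + m * (\<xi> v (e j))\<^sup>2) - (m * \<xi> v (e i) * \<xi> v (e j))\<^sup>2) / (nu v \<bullet> nu v)"
    if "j \<in> UNIV - {i}" for i j
    using that unfolding sectional_curvature_def gauss_equation[OF v nu]
    by (auto simp: induced_metric_def e II power2_eq_square algebra_simps)
  then have "scalar_curvature (induced_metric F) v =
    (\<Sum>i\<in>UNIV. \<Sum>j\<in>UNIV-{i}. (p + m * (\<xi> v (e i))\<^sup>2) * (p + m * (\<xi> v (e j))\<^sup>2)
      - (m * \<xi> v (e i) * \<xi> v (e j))\<^sup>2) / (nu v \<bullet> nu v)"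
    unfolding scalar_curvature_def e_def[symmetric] Let_def by (simp add: sum_divide_distrib)
  moreover have "(\<Sum>i\<in>UNIV. (\<xi> v (e i))\<^sup>2) = E v (X v) \<bullet> E v (X v)"
    using orthonormal_coframe_expansion[OF linear_E inj_deriv, OF v v e, of "X v"]
    by (simp add: xi_eq[OF v])
  ultimately show ?thesis
    using nu by (simp add: sum_offdiag_quadratic)
qed

lemma deriv_nu:
  assumes v: "v \<in> V"
  shows "dir_deriv nu v a = E v a - F2 v a (X v) - E v (dir_deriv X v a)"
proof -
  have "(\<lambda>w. E w (X w)) differentiable (at v)"
    using smooth_on_dir_deriv_field[OF open_V smooth_F smooth_X] smooth_on_differentiable v by blast
  then have "dir_deriv nu v a = E v a - dir_deriv (\<lambda>w. E w (X w)) v a"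
    unfolding position_normal_def[abs_def] by (intro dir_deriv_diff diffs v)
  then show ?thesis using deriv_E_field[OF v diffs(4)[OF v], of a] by simp
qed

lemma deriv_nu_tangential: "v \<in> V \<Longrightarrow> dir_deriv nu v a \<bullet> E v b = - II v a b"
proof -
  assume v: "v \<in> V"
  have "dir_deriv (\<lambda>w. nu w \<bullet> E w b) v a = dir_deriv (\<lambda>w. 0) v a"
    by (subst dir_deriv_cong[OF open_V v]) (auto simp: nu_orthogonal)
  then show ?thesis
    by (simp add: dir_deriv_inner diffs v second_fundamental_form_def)
qed

lemma deriv_nu_normal: "v \<in> V \<Longrightarrow> dir_deriv nu v a \<bullet> nu v = - II v a (X v)"
  using nu_orthogonal inner_commute[of _ "nu v"]
  by (simp add: deriv_nu second_fundamental_form_def inner_diff_right)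

text \<open>The connection derivative of \<open>x\<^sup>T = x - \<nu>\<close> in the direction \<open>a\<close> is \<open>a\<close> minus the tangential part of
  the derivative of \<open>\<nu>\<close>, and the latter is minus the shape operator.\<close>

lemma lie_derivative_induced_metric:
  assumes v: "v \<in> V"
  shows "1/2 * lie_derivative_metric X (induced_metric F) v a b = E v a \<bullet> E v b + II v a b"
proof -
  have *: "E v (dir_deriv X v a) = E v a - F2 v a (X v) - dir_deriv nu v a" for a
    using deriv_nu[OF v] by simp
  have "lie_derivative_metric X (induced_metric F) v a b = 2 * (E v a \<bullet> E v b) + II v a b + II v b a"
    unfolding lie_derivative_metric_def deriv_metric[OF v]
    using deriv_nu_tangential[OF v] F2_sym[OF v]
    by (simp add: induced_metric_def * inner_diff_left inner_diff_right inner_commute)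
  then show ?thesis using II_sym[OF v, of b a] by simp
qed

text \<open>This and the next lemma describe \<open>x\<^sup>T = 0\<close> and the normal space through the vanishing of
  derivatives of functions, which can be compared between charts.\<close>

lemma X_zero_iff_deriv_sqnorm_zero:
  assumes v: "v \<in> V"
  shows "X v = 0 \<longleftrightarrow> ((\<lambda>u. F u \<bullet> F u) has_derivative (\<lambda>_. 0)) (at v)"
proof -
  have der: "((\<lambda>u. F u \<bullet> F u) has_derivative (\<lambda>a. 2 * \<xi> v a)) (at v)"
    by (rule has_derivative_eq_rhs[OF has_derivative_inner[OF smooth_on_has_derivative[OF smooth_F
        v] smooth_on_has_derivative[OF smooth_F v]]])
      (simp add: fun_eq_iff dual_position_def inner_commute)
  show ?thesis
  proof
    assume "X v = 0"
    then have "\<xi> v a = 0" for a using xi_eq[OF v, of a] linear_0[OF linear_E[OF v]] by simp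
    then show "((\<lambda>u. F u \<bullet> F u) has_derivative (\<lambda>_. 0)) (at v)" using der by simp
  next
    assume "((\<lambda>u. F u \<bullet> F u) has_derivative (\<lambda>_. 0)) (at v)"
    then have "(\<lambda>a. 2 * \<xi> v a) = (\<lambda>_. 0)" using der has_derivative_unique by blast
    then have "\<xi> v (X v) = 0" by (simp add: fun_eq_iff)
    then show "X v = 0" using xi_eq[OF v, of "X v"] E_eq_0_iff[OF v] by simp
  qed
qed

lemma normal_iff_deriv_zero:
  assumes v: "v \<in> V"
  shows "(\<forall>b. eta \<bullet> E v b = 0) \<longleftrightarrow> ((\<lambda>u. eta \<bullet> F u) has_derivative (\<lambda>_. 0)) (at v)"
proof -
  have der: "((\<lambda>u. eta \<bullet> F u) has_derivative (\<lambda>a. eta \<bullet> E v a)) (at v)"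
    by (intro has_derivative_inner_right smooth_on_has_derivative[OF smooth_F v])
  then show ?thesis using has_derivative_unique[OF der, of "\<lambda>_. 0"] by (auto simp: fun_eq_iff)
qed

text \<open>The derivative is continuous in the operator norm because it is so on the coordinate vectors.\<close>

lemma locally_injective:
  assumes v: "v \<in> V"
  shows "\<exists>r>0. ball v r \<subseteq> V \<and> inj_on F (ball v r)"
proof -
  obtain g' where g': "linear g'" "g' \<circ> dir_deriv F v = id"
    using linear_injective_left_inverse[OF linear_E[OF v] inj_deriv[OF v]] by blast
  have on: "\<exists>d>0. \<forall>x. dist v x < d \<longrightarrow> onorm (\<lambda>a. dir_deriv F x a - dir_deriv F v a) < e" if e: "e > 0" for e
  proof -
    let ?f = "\<lambda>u. \<Sum>i\<in>UNIV. norm (E u (axis i 1) - E v (axis i 1))"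
    have "continuous_on V ?f"
      by (intro continuous_intros smooth_on_continuous[OF smooth_E])
    then have "isCont ?f v" using open_V v continuous_on_eq_continuous_at by blast
    then obtain d1 where d1: "d1 > 0" "\<forall>u. dist u v < d1 \<longrightarrow> dist (?f u) (?f v) < e"
      using e unfolding continuous_at_eps_delta by blast
    have fe: "?f u < e" if "dist u v < d1" for u
    proof -
      have "dist (?f u) (?f v) < e" using d1(2) that by blast
      then show ?thesis by (simp add: dist_real_def)
    qed
    obtain d2 where d2: "d2 > 0" "ball v d2 \<subseteq> V" using open_V v openE by blast
    have "onorm (\<lambda>a. dir_deriv F x a - dir_deriv F v a) < e" if x: "dist v x < min d1 d2" for x
    proof -
      have xV: "x \<in> V" using x d2 by auto
      have lin: "linear (\<lambda>a. E x a - E v a)" using linear_E[OF xV] linear_E[OF v]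
          by (rule linear_compose_sub)
      have "onorm (\<lambda>a. E x a - E v a) \<le> ?f x"
      proof (rule onorm_le)
        fix a :: "real^'n"
        have "E x a - E v a = (\<Sum>i\<in>UNIV. (a $ i) *\<^sub>R (E x (axis i 1) - E v (axis i 1)))"
          by (rule linear_eq_sum_axis[OF lin])
        also have "norm \<dots> \<le> (\<Sum>i\<in>UNIV. norm a * norm (E x (axis i 1) - E v (axis i 1)))"
          by (intro sum_norm_le) (auto intro!: mult_right_mono component_le_norm_cart)
        finally show "norm (E x a - E v a) \<le> ?f x * norm a" by (simp add: sum_distrib_left mult.commute)
      qed
      also have "\<dots> < e" using fe[of x] x by (simp add: dist_commute)
      finally show ?thesis .
    qed
    then show ?thesis using d1 d2 by (intro exI[of _ "min d1 d2"]) auto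
  qed
  show ?thesis
    using has_derivative_locally_injective[OF v open_V linear_conv_bounded_linear[THEN iffD1, OF
        g'(1)] g'(2)
        smooth_on_has_derivative[OF smooth_F] on] by blast
qed

end

section \<open>The soliton equation in a chart\<close>

lemma solve_profile_curvature:
  fixes N k w b l :: real
  assumes "N > 0" "k \<noteq> 0" and eq: "w * (k + l + 1) = N * (N - 1) * k\<^sup>2 + 2 * N * k * b"
  shows "b = w / (2 * N) - (N - 1) * k / 2 + (l + 1) * w / (2 * N * k)"
proof -
  have "w / (2 * N) - (N - 1) * k / 2 + (l + 1) * w / (2 * N * k)
      = (w * (k + l + 1) - N * (N - 1) * k\<^sup>2) / (2 * N * k)"
    using assms(1,2) by (simp add: field_simps power2_eq_square)
  also have "\<dots> = b" unfolding eq using assms(1,2) by simp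
  finally show ?thesis by simp
qed

locale soliton_chart = immersed_chart V F
  for V :: "(real^'n) set" and F :: "real^'n \<Rightarrow> (real^'n) \<times> real" +
  fixes lam :: real and mu :: "real^'n \<Rightarrow> real"
  assumes soliton: "quasi_yamabe_soliton_on V (induced_metric F) (position_tangential F) lam mu"
    and mu_nonzero: "\<And>v. v \<in> V \<Longrightarrow> mu v \<noteq> 0"
    and dim_ge_2: "CARD('n) \<ge> 2"
    and dim_2: "CARD('n) = 2 \<Longrightarrow> lam \<noteq> -1"

context soliton_chart
begin

text \<open>With the unit normal \<open>\<nu>/\<bar>\<nu>\<bar>\<close>, the functions \<open>\<kappa>\<close> and \<open>\<beta>\<close> are \<open>\<bar>\<nu>\<bar>\<close> times the principal curvatures
  orthogonal to \<open>x\<^sup>T\<close> and along \<open>x\<^sup>T\<close>. All formulas are stated for these products, which are smooth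
  where \<open>\<nu>\<close> vanishes and do not change with the orientation.\<close>

definition kappa ("\<kappa>") where "\<kappa> v = scalar_curvature (induced_metric F) v - lam - 1"

definition tau ("\<tau>") where "\<tau> v = E v (X v) \<bullet> E v (X v)"

definition omega ("\<omega>") where "\<omega> v = nu v \<bullet> nu v"

definition beta ("\<beta>") where "\<beta> v = \<kappa> v + mu v * \<tau> v"

lemma smooth_mu: "smooth_on mu V"
  using soliton by (simp add: quasi_yamabe_soliton_on_def)

lemma II_eq: "v \<in> V \<Longrightarrow> II v a b = \<kappa> v * (E v a \<bullet> E v b) + mu v * \<xi> v a * \<xi> v b"
proof -
  assume v: "v \<in> V"
  have "1/2 * lie_derivative_metric X (induced_metric F) v a b =
      (scalar_curvature (induced_metric F) v - lam) * induced_metric F v a b +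
       mu v * (dual_form (induced_metric F) X v a * dual_form (induced_metric F) X v b)"
    using soliton v unfolding quasi_yamabe_soliton_on_def by blast
  then show ?thesis
    unfolding lie_derivative_induced_metric[OF v]
    by (simp add: dual_form_def induced_metric_def kappa_def xi_eq[OF v] algebra_simps)
qed

text \<open>The scalar curvature is defined through an arbitrary choice of frames, so its smoothness is
  read off from the soliton equation.\<close>

lemma smooth_kappa: "smooth_on \<kappa> V"
proof -
  define a :: "real^'n" where "a = axis undefined 1"
  have a: "a \<noteq> 0" by (simp add: a_def axis_eq_0_iff)
  then have nz: "E v a \<bullet> E v a \<noteq> 0" if "v \<in> V" for v
    using E_eq_0_iff that by simp
  have "smooth_on (\<lambda>v. (II v a a - mu v * (\<xi> v a * \<xi> v a)) / (E v a \<bullet> E v a)) V"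
    by (intro smooth_on_divide smooth_on_diff smooth_on_mult smooth_on_inner
        smooth_II smooth_xi smooth_E smooth_mu open_V nz)
  moreover have "\<kappa> v = (II v a a - mu v * (\<xi> v a * \<xi> v a)) / (E v a \<bullet> E v a)" if "v \<in> V" for v
    using nz[OF that] by (simp add: II_eq[OF that])
  ultimately show ?thesis by (subst smooth_on_cong[OF open_V]) auto
qed

lemma smooth_EX: "smooth_on (\<lambda>v. E v (X v)) V"
  by (intro smooth_on_dir_deriv_field open_V smooth_F smooth_X)

lemma smooth_tau: "smooth_on \<tau> V"
  unfolding tau_def[abs_def] by (intro smooth_on_inner smooth_EX open_V)

lemma smooth_omega: "smooth_on \<omega> V"
  unfolding omega_def[abs_def] by (intro smooth_on_inner smooth_nu open_V)

lemma smooth_beta: "smooth_on \<beta> V"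
  unfolding beta_def[abs_def]
  by (intro smooth_on_add smooth_on_mult smooth_kappa smooth_mu smooth_tau open_V)

lemmas more_diffs = diffs smooth_mu[THEN smooth_on_differentiable]
  smooth_kappa[THEN smooth_on_differentiable] smooth_tau[THEN smooth_on_differentiable]
  smooth_omega[THEN smooth_on_differentiable] smooth_beta[THEN smooth_on_differentiable]
  smooth_EX[THEN smooth_on_differentiable]

lemma tau_eq_0_iff: "v \<in> V \<Longrightarrow> \<tau> v = 0 \<longleftrightarrow> X v = 0"
  by (simp add: tau_def E_eq_0_iff)

lemma xi_X: "v \<in> V \<Longrightarrow> \<xi> v (X v) = \<tau> v"
  by (simp add: xi_eq tau_def)

lemma tau_eq: "v \<in> V \<Longrightarrow> \<tau> v = F v \<bullet> F v - \<omega> v"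
  using nu_orthogonal[of v "X v"]
  by (simp add: tau_def omega_def F_split[of v] inner_add_left inner_add_right inner_commute)

lemma horizontal_vector_exists:
  assumes v: "v \<in> V"
  shows "\<exists>a. a \<noteq> 0 \<and> \<xi> v a = 0"
proof -
  obtain i j :: 'n where ij: "i \<noteq> j"
    using dim_ge_2 by (metis (full_types) One_nat_def Suc_1 UNIV_I card_le_Suc0_iff_eq
        finite_class.finite_UNIV not_less_eq_eq)
  define a :: "real^'n" where "a = \<xi> v (axis j 1) *\<^sub>R axis i 1 - \<xi> v (axis i 1) *\<^sub>R axis j 1"
  have "\<xi> v a = 0" using linear_xi[OF v] by (simp add: a_def linear_diff linear_scale)
  moreover have "\<xi> v (axis i 1) = 0" if "a = 0"
  proof -
    have "a $ j = 0" using that by simp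
    then show ?thesis using ij by (simp add: a_def axis_def)
  qed
  moreover have "axis i (1::real) \<noteq> (0 :: real^'n)" by (simp add: axis_eq_0_iff)
  ultimately show ?thesis by blast
qed

text \<open>If \<open>\<nu> = 0\<close>, then \<open>\<kappa> g + mu \<xi> \<otimes> \<xi> = 0\<close>; test this on a vector orthogonal to \<open>x\<^sup>T\<close> and on \<open>x\<^sup>T\<close>.\<close>

lemma normal_zero_imp:
  assumes v: "v \<in> V" and "nu v = 0"
  shows "X v = 0" "\<kappa> v = 0"
proof -
  have II: "II v a b = 0" for a b using assms by (simp add: second_fundamental_form_def)
  obtain a where a: "a \<noteq> 0" "\<xi> v a = 0" using horizontal_vector_exists[OF v] by blast
  show k: "\<kappa> v = 0" using II_eq[OF v, of a a] II a E_eq_0_iff[OF v] by simp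
  have "mu v * (\<tau> v * \<tau> v) = 0"
    using II_eq[OF v, of "X v" "X v"] II k xi_X[OF v] by simp
  then show "X v = 0" using mu_nonzero[OF v] tau_eq_0_iff[OF v] by simp
qed

lemma deriv_sqnorm: "v \<in> V \<Longrightarrow> dir_deriv (\<lambda>w. F w \<bullet> F w) v a = 2 * \<xi> v a"
  by (simp add: dir_deriv_inner diffs dual_position_def inner_commute)

lemma II_X: "v \<in> V \<Longrightarrow> II v a (X v) = \<beta> v * \<xi> v a"
  using xi_eq[of v a] xi_X[of v]
  by (simp add: II_eq beta_def inner_commute algebra_simps)

lemma deriv_omega: "v \<in> V \<Longrightarrow> dir_deriv \<omega> v a = - 2 * \<beta> v * \<xi> v a"
  unfolding omega_def[abs_def]
  using deriv_nu_normal[of v a] II_X[of v a] by (simp add: dir_deriv_inner diffs inner_commute)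

text \<open>The logarithmic derivative of the axial vector introduced below is \<open>growth \<xi>\<close>.\<close>

abbreviation "growth v \<equiv> mu v - \<beta> v / \<omega> v"

text \<open>The Weingarten equation. A vector orthogonal to all tangent vectors and to \<open>\<nu>\<close> is zero, so it
  suffices to compare inner products.\<close>

lemma deriv_nu_formula:
  assumes v: "v \<in> V" and nz: "\<omega> v \<noteq> 0"
  shows "dir_deriv nu v a =
    - (\<kappa> v *\<^sub>R E v a) - (mu v * \<xi> v a) *\<^sub>R F v + (growth v * \<xi> v a) *\<^sub>R nu v"
proof -
  define y where "y = dir_deriv nu v a + \<kappa> v *\<^sub>R E v a + (mu v * \<xi> v a) *\<^sub>R F v
      - (growth v * \<xi> v a) *\<^sub>R nu v"
  have "y \<bullet> E v b = 0" for b
    using deriv_nu_tangential[OF v, of a b] II_eq[OF v, of a b] nu_orthogonal[OF v, of b]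
    by (simp add: y_def inner_add_left inner_diff_left flip: dual_position_def)
  moreover have "nu v \<noteq> 0" using nz by (auto simp: omega_def)
  moreover have "y \<bullet> nu v = 0"
  proof -
    have "E v b \<bullet> nu v = 0" for b using nu_orthogonal[OF v, of b] by (simp add: inner_commute)
    moreover have "F v \<bullet> nu v = \<omega> v"
      using nu_orthogonal[OF v, of "X v"]
      by (simp add: F_split[of v] inner_add_left inner_add_right omega_def inner_commute)
    ultimately have "y \<bullet> nu v = - (\<beta> v * \<xi> v a) + mu v * \<xi> v a * \<omega> v - growth v * \<xi> v a * \<omega> v"
      using deriv_nu_normal[OF v, of a] II_X[OF v, of a]
      by (simp add: y_def inner_add_left inner_diff_left omega_def)
    also have "\<dots> = 0" using nz by (simp add: field_simps)
    finally show ?thesis .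
  qed
  ultimately have "y = 0"
    using normal_space_is_line[OF linear_E[OF v] inj_deriv[OF v], of "nu v" y] nu_orthogonal[OF v] by simp
  then show ?thesis by (simp add: y_def algebra_simps)
qed

text \<open>At \<open>c = \<kappa> v\<close>, and at no other \<open>c\<close>, the derivative vanishes for all \<open>eta\<close> with a suitable \<open>d\<close>. This
  characterises \<open>\<kappa>\<close> by the vanishing of derivatives.\<close>

lemma deriv_test_function:
  assumes v: "v \<in> V" and nz: "\<omega> v \<noteq> 0"
  shows "((\<lambda>u. eta \<bullet> (nu u + c *\<^sub>R F u) - d * (F u \<bullet> F u)) has_derivative
    (\<lambda>b. (c - \<kappa> v) * (eta \<bullet> E v b) + \<xi> v b * (eta \<bullet> (growth v *\<^sub>R nu v - mu v *\<^sub>R F v) - 2 * d))) (at v)"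
proof (rule has_derivative_eq_rhs)
  show "((\<lambda>u. eta \<bullet> (nu u + c *\<^sub>R F u) - d * (F u \<bullet> F u)) has_derivative
    (\<lambda>b. eta \<bullet> (dir_deriv nu v b + c *\<^sub>R E v b) - d * (F v \<bullet> E v b + E v b \<bullet> F v))) (at v)"
    by (intro has_derivative_diff has_derivative_inner_right has_derivative_add has_derivative_scaleR_right
        has_derivative_mult_right has_derivative_inner smooth_on_has_derivative[OF smooth_nu v]
        smooth_on_has_derivative[OF smooth_F v])
  have "F v \<bullet> E v b + E v b \<bullet> F v = 2 * \<xi> v b" for b
    by (simp add: dual_position_def inner_commute)
  then show "(\<lambda>b. eta \<bullet> (dir_deriv nu v b + c *\<^sub>R E v b) - d * (F v \<bullet> E v b + E v b \<bullet> F v)) =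
    (\<lambda>b. (c - \<kappa> v) * (eta \<bullet> E v b) + \<xi> v b * (eta \<bullet> (growth v *\<^sub>R nu v - mu v *\<^sub>R F v) - 2 * d))"
    by (simp add: fun_eq_iff deriv_nu_formula[OF v nz] inner_add_right inner_diff_right algebra_simps)
qed

lemma gauss_scalar:
  assumes v: "v \<in> V" and nz: "\<omega> v \<noteq> 0"
  shows "\<omega> v * (\<kappa> v + lam + 1) =
     (real CARD('n) - 1) * (real CARD('n) - 2) * (\<kappa> v)\<^sup>2 + 2 * (real CARD('n) - 1) * \<kappa> v * \<beta> v"
proof -
  have "nu v \<noteq> 0" using nz by (auto simp: omega_def)
  from scalar_curvature_rank_one_perturbation[OF v this II_eq[OF v]]
  have "scalar_curvature (induced_metric F) v * \<omega> v =
     real CARD('n) * (real CARD('n) - 1) * (\<kappa> v)\<^sup>2 + 2 * (real CARD('n) - 1) * \<kappa> v * mu v * \<tau> v"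
    by (simp add: omega_def tau_def)
  moreover have "scalar_curvature (induced_metric F) v = \<kappa> v + lam + 1" by (simp add: kappa_def)
  ultimately show ?thesis by (simp add: beta_def algebra_simps power2_eq_square)
qed

lemma deriv_xi: "v \<in> V \<Longrightarrow> dir_deriv (\<lambda>w. \<xi> w a) v b = E v b \<bullet> E v a + F v \<bullet> F2 v b a"
  unfolding dual_position_def by (simp add: dir_deriv_inner diffs)

lemma deriv_xi_sym: "v \<in> V \<Longrightarrow> dir_deriv (\<lambda>w. \<xi> w a) v b = dir_deriv (\<lambda>w. \<xi> w b) v a"
  by (simp add: deriv_xi inner_commute F2_sym[of v a b])

text \<open>\<open>d\<beta> \<and> \<xi> = 0\<close>: take the exterior derivative of \<open>d\<omega> = -2\<beta>\<xi>\<close>, where \<open>d\<xi> = 0\<close>.\<close>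

lemma deriv_beta_parallel_xi:
  assumes v: "v \<in> V"
  shows "dir_deriv \<beta> v a * \<xi> v b = dir_deriv \<beta> v b * \<xi> v a"
proof -
  have *: "dir_deriv (\<lambda>w. dir_deriv \<omega> w a) v b =
      - 2 * (\<beta> v * dir_deriv (\<lambda>w. \<xi> w a) v b + dir_deriv \<beta> v b * \<xi> v a)" for a b
  proof -
    have "dir_deriv (\<lambda>w. dir_deriv \<omega> w a) v b = dir_deriv (\<lambda>w. (- 2) * (\<beta> w * \<xi> w a)) v b"
      by (subst dir_deriv_cong[OF open_V v]) (auto simp: deriv_omega)
    also have "\<dots> = - 2 * dir_deriv (\<lambda>w. \<beta> w * \<xi> w a) v b"
      by (rule dir_deriv_eqI)
        (intro has_derivative_mult_right has_derivative_dir_deriv differentiable_mult more_diffs v)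
    also have "dir_deriv (\<lambda>w. \<beta> w * \<xi> w a) v b = \<beta> v * dir_deriv (\<lambda>w. \<xi> w a) v b + dir_deriv \<beta> v b * \<xi> v a"
      by (intro dir_deriv_mult more_diffs v)
    finally show ?thesis .
  qed
  have "dir_deriv (\<lambda>w. dir_deriv \<omega> w a) v b = dir_deriv (\<lambda>w. dir_deriv \<omega> w b) v a"
    by (rule smooth_on_symmetric_second_derivative[OF open_V v smooth_omega])
  then show ?thesis unfolding * using deriv_xi_sym[OF v, of a b] by simp
qed

lemma horizontal_deriv_beta:
  "v \<in> V \<Longrightarrow> X v \<noteq> 0 \<Longrightarrow> \<xi> v a = 0 \<Longrightarrow> dir_deriv \<beta> v a = 0"
  using deriv_beta_parallel_xi[of v a "X v"] xi_X[of v] tau_eq_0_iff[of v] by simp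

lemma omega_nonzero: "v \<in> V \<Longrightarrow> X v \<noteq> 0 \<Longrightarrow> \<omega> v \<noteq> 0"
  using normal_zero_imp(1)[of v] by (auto simp: omega_def)

lemma open_nonzero:
  fixes f :: "real^'n \<Rightarrow> real"
  assumes "smooth_on f V"
  shows "open {u \<in> V. f u \<noteq> 0}"
proof -
  have "open (f -` (- {0}) \<inter> V)"
    using smooth_on_continuous[OF assms] open_V
    by (simp add: continuous_on_open_vimage open_Compl)
  moreover have "f -` (- {0}) \<inter> V = {u \<in> V. f u \<noteq> 0}" by auto
  ultimately show ?thesis by simp
qed

lemma open_X_nonzero: "open {u \<in> V. X u \<noteq> 0}"
proof -
  have "{u \<in> V. X u \<noteq> 0} = {u \<in> V. \<tau> u \<noteq> 0}" using tau_eq_0_iff by blast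
  then show ?thesis using open_nonzero[OF smooth_tau] by simp
qed

lemma deriv_gauss_scalar:
  assumes v: "v \<in> V" "\<omega> v \<noteq> 0"
  shows "\<omega> v * dir_deriv \<kappa> v a + dir_deriv \<omega> v a * (\<kappa> v + lam + 1) =
     2 * (real CARD('n) - 1) * (real CARD('n) - 2) * \<kappa> v * dir_deriv \<kappa> v a
      + 2 * (real CARD('n) - 1) * (\<kappa> v * dir_deriv \<beta> v a + \<beta> v * dir_deriv \<kappa> v a)"
proof -
  let ?c1 = "(real CARD('n) - 1) * (real CARD('n) - 2)" and ?c2 = "2 * (real CARD('n) - 1)"
  let ?S = "{u \<in> V. \<omega> u \<noteq> 0}"
  note d = has_derivative_dir_deriv[OF more_diffs(9)[OF v(1)]]
     smooth_on_has_derivative[OF smooth_kappa v(1)] smooth_on_has_derivative[OF smooth_omega v(1)]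
     smooth_on_has_derivative[OF smooth_beta v(1)]
  have S: "open ?S" by (rule open_nonzero[OF smooth_omega])
  have "dir_deriv (\<lambda>w. \<omega> w * (\<kappa> w + lam + 1)) v a = dir_deriv (\<lambda>w. ?c1 * (\<kappa> w)\<^sup>2 + ?c2 * \<kappa> w * \<beta> w) v a"
    using v gauss_scalar by (subst dir_deriv_cong[OF S, of v _ "\<lambda>w. ?c1 * (\<kappa> w)\<^sup>2 + ?c2 * \<kappa> w * \<beta> w"]) auto
  moreover have "dir_deriv (\<lambda>w. \<omega> w * (\<kappa> w + lam + 1)) v a =
      \<omega> v * dir_deriv \<kappa> v a + dir_deriv \<omega> v a * (\<kappa> v + lam + 1)"
    by (rule dir_deriv_eqI) (auto intro!: derivative_eq_intros d)
  moreover have "dir_deriv (\<lambda>w. ?c1 * (\<kappa> w)\<^sup>2 + ?c2 * \<kappa> w * \<beta> w) v a =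
      ?c1 * (2 * \<kappa> v * dir_deriv \<kappa> v a) + (?c2 * \<kappa> v * dir_deriv \<beta> v a + ?c2 * dir_deriv \<kappa> v a * \<beta> v)"
    by (rule dir_deriv_eqI) (auto intro!: derivative_eq_intros d simp: algebra_simps)
  ultimately show ?thesis by (simp add: algebra_simps)
qed

text \<open>In a direction orthogonal to \<open>x\<^sup>T\<close>, \<open>\<omega>\<close> and \<open>\<beta>\<close> have zero derivative, so the derivative of the Gauss
  relation reads \<open>d \<cdot> D\<kappa> = 0\<close> with \<open>d\<close> the partial derivative of the relation with respect to \<open>\<kappa>\<close>. If
  \<open>D\<kappa> \<noteq> 0\<close> at a point, then \<open>d = 0\<close> on a neighbourhood. For \<open>n \<ge> 3\<close> this expresses \<open>\<kappa>\<close> through \<open>\<omega>\<close> and \<open>\<beta>\<close>,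
  so \<open>D\<kappa> = 0\<close> after all; for \<open>n = 2\<close> it turns the relation into \<open>\<omega> (lam + 1) = 0\<close>, where both factors
  are nonzero.\<close>

lemma horizontal_deriv_kappa:
  assumes v: "v \<in> V" "X v \<noteq> 0" and a: "\<xi> v a = 0"
  shows "dir_deriv \<kappa> v a = 0"
proof (rule ccontr)
  assume nz: "dir_deriv \<kappa> v a \<noteq> 0"
  let ?d = "\<lambda>u. \<omega> u - 2 * (real CARD('n) - 1) * (real CARD('n) - 2) * \<kappa> u - 2 * (real CARD('n) - 1) * \<beta> u"
  have d0: "?d u * dir_deriv \<kappa> u b = 0" if u: "u \<in> V" "X u \<noteq> 0" "\<xi> u b = 0" for u b
    using deriv_gauss_scalar[OF u(1) omega_nonzero[OF u(1,2)], of b]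
      horizontal_deriv_beta[OF u] deriv_omega[OF u(1), of b] u(3)
    by (simp add: algebra_simps)
  \<comment> \<open>\<open>?c u\<close> is the derivative of \<open>\<kappa>\<close> at \<open>u\<close> along the vector \<open>b\<close> below, which is orthogonal to \<open>x\<^sup>T\<close>
    and a multiple of \<open>a\<close> for \<open>u = v\<close>.\<close>
  let ?c = "\<lambda>u. dir_deriv \<kappa> u a * \<xi> u (X v) - \<xi> u a * dir_deriv \<kappa> u (X v)"
  let ?U = "{u \<in> V. ?c u \<noteq> 0} \<inter> {u \<in> V. X u \<noteq> 0}"
  have sc: "smooth_on ?c V"
    by (intro smooth_on_diff smooth_on_mult smooth_on_dir_deriv smooth_kappa smooth_xi open_V)
  have U: "open ?U" using open_nonzero[OF sc] open_X_nonzero by (rule open_Int)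
  have vU: "v \<in> ?U" using v a nz xi_X[OF v(1)] tau_eq_0_iff[OF v(1)] by simp
  have dU: "?d u = 0" if "u \<in> ?U" for u
  proof -
    define b where "b = \<xi> u (X v) *\<^sub>R a - \<xi> u a *\<^sub>R X v"
    have u: "u \<in> V" "X u \<noteq> 0" "?c u \<noteq> 0" using that by auto
    have "\<xi> u b = 0" using linear_xi[OF u(1)] by (simp add: b_def linear_diff linear_scale)
    moreover have "dir_deriv \<kappa> u b = ?c u"
      using linear_deriv[OF smooth_kappa u(1)] by (simp add: b_def linear_diff linear_scale)
    ultimately show ?thesis using d0[OF u(1,2), of b] u(3) by simp
  qed
  show False
  proof (cases "CARD('n) = 2")
    case True
    have "\<omega> v * (\<kappa> v + lam + 1) = 2 * \<kappa> v * \<beta> v" "\<omega> v = 2 * \<beta> v"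
      using gauss_scalar[OF v(1) omega_nonzero[OF v]] dU[OF vU] True by auto
    then have "\<omega> v * (lam + 1) = 0" by (simp add: algebra_simps)
    then show False using omega_nonzero[OF v] dim_2[OF True] by simp
  next
    case False
    have "dir_deriv ?d v a = dir_deriv (\<lambda>u. 0) v a"
      using dU by (subst dir_deriv_cong[OF U vU, of _ "\<lambda>u. 0"]) auto
    moreover have "dir_deriv ?d v a = dir_deriv \<omega> v a - 2 * (real CARD('n) - 1) * (real CARD('n)
        - 2) * dir_deriv \<kappa> v a
        - 2 * (real CARD('n) - 1) * dir_deriv \<beta> v a"
      by (rule dir_deriv_eqI)
        (intro has_derivative_diff has_derivative_mult_right has_derivative_dir_deriv more_diffs v)
    ultimately have "(real CARD('n) - 1) * (real CARD('n) - 2) * dir_deriv \<kappa> v a = 0"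
      using deriv_omega[OF v(1), of a] a horizontal_deriv_beta[OF v a] by simp
    moreover have "real CARD('n) - 1 \<noteq> 0" "real CARD('n) - 2 \<noteq> 0" using False dim_ge_2 by auto
    ultimately show False using nz by simp
  qed
qed

text \<open>The derivative of the Weingarten equation, paired with a tangent vector orthogonal to \<open>x\<^sup>T\<close>.\<close>

lemma deriv_deriv_nu:
  assumes v: "v \<in> V" "\<omega> v \<noteq> 0"
    and c: "\<xi> v c = 0"
  shows "dir_deriv (\<lambda>w. dir_deriv nu w a) v b \<bullet> E v c =
    - (\<kappa> v * (F2 v b a \<bullet> E v c)) - dir_deriv \<kappa> v b * (E v a \<bullet> E v c)
    - mu v * \<xi> v a * (E v b \<bullet> E v c) - growth v * \<xi> v a * II v b c"
proof -
  let ?S = "{u \<in> V. \<omega> u \<noteq> 0}"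
  have S: "open ?S" by (rule open_nonzero[OF smooth_omega])
  have vS: "v \<in> ?S" using v by simp
  let ?f1 = "\<lambda>w. \<kappa> w *\<^sub>R E w a" and ?f2 = "\<lambda>w. (mu w * \<xi> w a) *\<^sub>R F w" 
    and ?f3 = "\<lambda>w. (growth w * \<xi> w a) *\<^sub>R nu w"
  have ds: "(\<lambda>w. growth w * \<xi> w a) differentiable (at v)"
    using v by (intro differentiable_mult differentiable_diff differentiable_divide more_diffs) auto
  have dm: "(\<lambda>w. mu w * \<xi> w a) differentiable (at v)"
    using v by (intro differentiable_mult more_diffs) auto
  have d123: "?f1 differentiable (at v)" "?f2 differentiable (at v)" "?f3 differentiable (at v)"
    using v by (auto intro!: differentiable_scaleR ds dm more_diffs)
  have "dir_deriv (\<lambda>w. dir_deriv nu w a) v b = dir_deriv (\<lambda>w. - ?f1 w - ?f2 w + ?f3 w) v b"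
    by (subst dir_deriv_cong[OF S vS]) (auto simp: deriv_nu_formula)
  also have "\<dots> = - dir_deriv ?f1 v b - dir_deriv ?f2 v b + dir_deriv ?f3 v b"
    by (rule dir_deriv_eqI)
      (intro has_derivative_diff has_derivative_add has_derivative_minus has_derivative_dir_deriv d123)
  also have "dir_deriv ?f1 v b = \<kappa> v *\<^sub>R F2 v b a + dir_deriv \<kappa> v b *\<^sub>R E v a"
    by (intro dir_deriv_scaleR more_diffs v)
  also have "dir_deriv ?f2 v b = (mu v * \<xi> v a) *\<^sub>R E v b + dir_deriv (\<lambda>w. mu w * \<xi> w a) v b *\<^sub>R F v"
    by (intro dir_deriv_scaleR dm more_diffs v)
  also have "dir_deriv ?f3 v b = (growth v * \<xi> v a) *\<^sub>R dir_deriv nu v b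
      + dir_deriv (\<lambda>w. growth w * \<xi> w a) v b *\<^sub>R nu v"
    by (intro dir_deriv_scaleR ds more_diffs v)
  finally show ?thesis
    using deriv_nu_tangential[OF v(1), of b c] nu_orthogonal[OF v(1), of c] c
    by (simp add: inner_diff_left inner_add_left flip: dual_position_def)
qed

text \<open>The Codazzi equation for \<open>x\<^sup>T\<close> and a vector orthogonal to it.\<close>

lemma vertical_deriv_kappa:
  assumes v: "v \<in> V" "X v \<noteq> 0"
  shows "dir_deriv \<kappa> v (X v) = (mu v + growth v * \<kappa> v) * \<tau> v"
proof -
  obtain b where b: "b \<noteq> 0" "\<xi> v b = 0" using horizontal_vector_exists[OF v(1)] by blast
  note w = omega_nonzero[OF v]
  have "dir_deriv (\<lambda>w. dir_deriv nu w (X v)) v b = dir_deriv (\<lambda>w. dir_deriv nu w b) v (X v)"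
    by (rule smooth_on_symmetric_second_derivative[OF open_V v(1) smooth_nu])
  then have "dir_deriv (\<lambda>w. dir_deriv nu w (X v)) v b \<bullet> E v b
      = dir_deriv (\<lambda>w. dir_deriv nu w b) v (X v) \<bullet> E v b"
    by simp
  then have "dir_deriv \<kappa> v (X v) * (E v b \<bullet> E v b) = (mu v + growth v * \<kappa> v) * \<tau> v * (E v b \<bullet> E v b)"
    unfolding deriv_deriv_nu[OF v(1) w b(2)]
    using b(2) xi_X[OF v(1)] F2_sym[OF v(1), of b "X v"] xi_eq[OF v(1), of b] II_eq[OF v(1), of b b]
      horizontal_deriv_kappa[OF v b(2)]
    by (simp add: algebra_simps)
  moreover have "E v b \<bullet> E v b \<noteq> 0" using b E_eq_0_iff[OF v(1)] by simp
  ultimately show ?thesis by simp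
qed

lemma deriv_kappa_nondegenerate:
  assumes v: "v \<in> V" "X v \<noteq> 0"
  shows "dir_deriv \<kappa> v a = (mu v + growth v * \<kappa> v) * \<xi> v a"
proof -
  have t: "\<tau> v \<noteq> 0" using v tau_eq_0_iff by simp
  define b where "b = a - (\<xi> v a / \<tau> v) *\<^sub>R X v"
  have "\<xi> v b = 0" using linear_xi[OF v(1)] t xi_X[OF v(1)] by (simp add: b_def linear_diff linear_scale)
  then have "dir_deriv \<kappa> v b = 0" by (rule horizontal_deriv_kappa[OF v])
  then have "dir_deriv \<kappa> v a = (\<xi> v a / \<tau> v) * dir_deriv \<kappa> v (X v)"
    using linear_deriv[OF smooth_kappa v(1)] by (simp add: b_def linear_diff linear_scale)
  then show ?thesis using vertical_deriv_kappa[OF v] t by simp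
qed

lemma kappa_nonzero:
  assumes v: "v \<in> V" "X v \<noteq> 0" and "lam \<noteq> -1"
  shows "\<kappa> v \<noteq> 0"
  using gauss_scalar[OF v(1) omega_nonzero[OF v]] omega_nonzero[OF v] assms(3) by auto

text \<open>Solve the Gauss relation for \<open>\<beta>\<close>. Zeros of \<open>\<kappa>\<close> occur only for \<open>lam = -1\<close>, when the relation is
  \<open>\<kappa> \<cdot> g = 0\<close> with a continuous \<open>g\<close>; the derivative of \<open>\<kappa>\<close> along \<open>x\<^sup>T\<close> is \<open>mu \<bar>x\<^sup>T\<bar>\<^sup>2 \<noteq> 0\<close> at such a zero,
  so \<open>g\<close> vanishes there too. The last summand is then \<open>0/0 = 0\<close>.\<close>

lemma beta_formula:
  assumes v: "v \<in> V" "X v \<noteq> 0"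
  shows "\<beta> v = \<omega> v / (2 * (real CARD('n) - 1)) - (real CARD('n) - 2) * \<kappa> v / 2
     + (lam + 1) * \<omega> v / (2 * (real CARD('n) - 1) * \<kappa> v)"
proof (cases "\<kappa> v = 0")
  case False
  have "real CARD('n) - 1 > 0" using dim_ge_2 by simp
  with False gauss_scalar[OF v(1) omega_nonzero[OF v]] show ?thesis
    using solve_profile_curvature[of "real CARD('n) - 1" "\<kappa> v" "\<omega> v" lam "\<beta> v"] by simp
next
  case True
  then have lam: "lam = -1" using kappa_nonzero[OF v] by blast
  let ?g = "\<lambda>u. (real CARD('n) - 1) * (real CARD('n) - 2) * \<kappa> u + 2 * (real CARD('n) - 1) * \<beta> u - \<omega> u"
  have sg: "smooth_on ?g V"
    by (intro smooth_on_diff smooth_on_add smooth_on_mult smooth_on_const smooth_kappa smooth_beta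
        smooth_omega open_V)
  have "?g v = 0"
  proof (rule ccontr)
    assume nz: "?g v \<noteq> 0"
    let ?U = "{u \<in> V. ?g u \<noteq> 0} \<inter> {u \<in> V. X u \<noteq> 0}"
    have U: "open ?U" using open_nonzero[OF sg] open_X_nonzero by (rule open_Int)
    have vU: "v \<in> ?U" using v nz by simp
    have "\<kappa> u = 0" if "u \<in> ?U" for u
    proof -
      have u: "u \<in> V" "X u \<noteq> 0" "?g u \<noteq> 0" using that by auto
      have "\<kappa> u * ?g u = 0"
        using gauss_scalar[OF u(1) omega_nonzero[OF u(1,2)]] lam
            by (simp add: algebra_simps power2_eq_square)
      then show ?thesis using u(3) by (metis mult_eq_0_iff)
    qed
    then have "dir_deriv \<kappa> v (X v) = dir_deriv (\<lambda>u. 0) v (X v)"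
      by (subst dir_deriv_cong[OF U vU, of _ "\<lambda>u. 0"]) auto
    then have "mu v * \<tau> v = 0" using vertical_deriv_kappa[OF v] True by simp
    then show False using mu_nonzero[OF v(1)] v tau_eq_0_iff by simp
  qed
  moreover have "real CARD('n) - 1 > 0" using dim_ge_2 by simp
  ultimately show ?thesis using True lam by (simp add: field_simps)
qed

lemma mu_eq: "v \<in> V \<Longrightarrow> X v \<noteq> 0 \<Longrightarrow> mu v = (\<beta> v - \<kappa> v) / \<tau> v"
  using tau_eq_0_iff by (simp add: beta_def)

end

section \<open>The axis and the zeros of the tangential part\<close>

locale dense_soliton_chart = soliton_chart V F lam mu
  for V :: "(real^'n) set" and F :: "real^'n \<Rightarrow> (real^'n) \<times> real" and lam mu +
  assumes dense: "\<And>U. open U \<Longrightarrow> U \<subseteq> V \<Longrightarrow> U \<noteq> {} \<Longrightarrow> \<exists>u\<in>U. position_tangential F u \<noteq> 0"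

context dense_soliton_chart
begin

text \<open>Both sides are continuous and agree on the dense set where \<open>x\<^sup>T \<noteq> 0\<close>.\<close>

lemma deriv_kappa:
  assumes v: "v \<in> V" "\<omega> v \<noteq> 0"
  shows "dir_deriv \<kappa> v a = (mu v + growth v * \<kappa> v) * \<xi> v a"
proof (rule ccontr)
  assume nz: "\<not> ?thesis"
  let ?S = "{u \<in> V. \<omega> u \<noteq> 0}"
  have S: "open ?S" by (rule open_nonzero[OF smooth_omega])
  let ?h = "\<lambda>u. dir_deriv \<kappa> u a - (mu u + growth u * \<kappa> u) * \<xi> u a"
  have sub: "smooth_on f ?S" if "smooth_on f V" for f :: "real^'n \<Rightarrow> real"
    by (rule smooth_on_subset[OF that]) auto
  have "smooth_on ?h ?S"
    by (intro smooth_on_diff smooth_on_add smooth_on_mult smooth_on_divide S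
        sub[OF smooth_on_dir_deriv[OF smooth_kappa]] sub[OF smooth_mu] sub[OF smooth_beta]
        sub[OF smooth_omega] sub[OF smooth_kappa] sub[OF smooth_xi]) auto
  then have "open (?h -` (- {0}) \<inter> ?S)"
    using continuous_on_open_vimage[OF S] smooth_on_continuous open_Compl[OF closed_singleton] by blast
  moreover have "v \<in> ?h -` (- {0}) \<inter> ?S" using v nz by simp
  ultimately obtain u where "u \<in> ?h -` (- {0}) \<inter> ?S" "X u \<noteq> 0"
    using dense[of "?h -` (- {0}) \<inter> ?S"] by blast
  then show False using deriv_kappa_nondegenerate[of u a] by simp
qed

text \<open>The vector that spans the axis of rotation.\<close>

definition axial where "axial v = nu v + \<kappa> v *\<^sub>R F v"

lemma smooth_axial: "smooth_on axial V"
  unfolding axial_def[abs_def]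
  by (intro smooth_on_add smooth_on_scaleR smooth_nu smooth_kappa smooth_F open_V)

text \<open>In the derivatives of \<open>\<nu>\<close> and of \<open>\<kappa> x\<close>, the terms with \<open>\<kappa> E\<close> cancel, and so do the terms with \<open>mu \<xi> x\<close>;
  the rest is \<open>growth \<xi>\<close> times \<open>\<nu> + \<kappa> x\<close>.\<close>

lemma deriv_axial:
  assumes v: "v \<in> V" "\<omega> v \<noteq> 0"
  shows "dir_deriv axial v a = (growth v * \<xi> v a) *\<^sub>R axial v"
proof -
  have "(\<lambda>w. \<kappa> w *\<^sub>R F w) differentiable (at v)"
    by (intro differentiable_scaleR more_diffs v)
  then have "dir_deriv axial v a = dir_deriv nu v a + dir_deriv (\<lambda>w. \<kappa> w *\<^sub>R F w) v a"
    unfolding axial_def[abs_def] by (intro dir_deriv_add more_diffs v)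
  also have "dir_deriv (\<lambda>w. \<kappa> w *\<^sub>R F w) v a = \<kappa> v *\<^sub>R E v a + dir_deriv \<kappa> v a *\<^sub>R F v"
    by (intro dir_deriv_scaleR more_diffs v)
  finally show ?thesis
    unfolding deriv_nu_formula[OF v] deriv_kappa[OF v] axial_def[of v]
    by (simp add: algebra_simps)
qed

text \<open>Its tangential and normal parts are \<open>\<kappa> x\<^sup>T\<close> and \<open>(1 + \<kappa>) \<nu>\<close>.\<close>

lemma axial_nonzero:
  assumes v: "v \<in> V" "\<omega> v \<noteq> 0" and "X v \<noteq> 0 \<or> \<kappa> v \<noteq> -1"
  shows "axial v \<noteq> 0"
proof
  assume 0: "axial v = 0"
  have eq: "axial v = E v (\<kappa> v *\<^sub>R X v) + (1 + \<kappa> v) *\<^sub>R nu v"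
    using linear_E[OF v(1)] by (simp add: axial_def F_split[of v] linear_scale algebra_simps)
  have "axial v \<bullet> nu v = (1 + \<kappa> v) * \<omega> v"
    using nu_orthogonal[OF v(1)] by (simp add: eq inner_add_left inner_add_right omega_def inner_commute)
  then have k: "\<kappa> v = -1" using 0 v(2) by simp
  then have "E v (X v) = 0" using 0 eq linear_E[OF v(1)] by (simp add: linear_neg)
  then show False using k assms(3) E_eq_0_iff[OF v(1)] by simp
qed

text \<open>If \<open>\<kappa> = -1\<close> at a zero of \<open>x\<^sup>T\<close>, then Gronwall's inequality for the pair \<open>Z = (x\<^sup>T, 1 + \<kappa>)\<close> on
  segments starting there shows that \<open>x\<^sup>T\<close> vanishes on a whole ball. (Hyperspheres centred at the
  origin have \<open>\<kappa> = -1\<close> and \<open>x\<^sup>T = 0\<close> throughout.)\<close>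

lemma degenerate_kappa:
  assumes v: "v \<in> V" "X v = 0"
  shows "\<kappa> v \<noteq> -1"
proof
  assume k: "\<kappa> v = -1"
  have w: "\<omega> v \<noteq> 0" using normal_zero_imp(2)[OF v(1)] k by (auto simp: omega_def)
  let ?S = "{u \<in> V. \<omega> u \<noteq> 0}"
  have S: "open ?S" by (rule open_nonzero[OF smooth_omega])
  then obtain r where r: "r > 0" "cball v r \<subseteq> ?S" using v w open_contains_cball by blast
  have "X u = 0" if u: "u \<in> ball v r" for u
  proof -
    define a where "a = u - v"
    define c where "c t = v + t *\<^sub>R a" for t
    have c: "c t \<in> ?S" if "t \<in> {0..1}" for t
    proof -
      have "norm (t *\<^sub>R a) \<le> 1 * norm a" using that by (simp add: mult_left_le_one_le)
      also have "\<dots> \<le> r" using u by (simp add: a_def dist_norm norm_minus_commute)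
      finally have "c t \<in> cball v r" by (simp add: c_def dist_norm)
      then show ?thesis using r(2) by blast
    qed
    \<comment> \<open>\<open>?G\<close> bounds the coefficients of the linear equation for \<open>?Z\<close>.\<close>
    let ?Z = "\<lambda>t. (E (c t) (X (c t)), 1 + \<kappa> (c t))"
    let ?y = "\<lambda>u. mu u *\<^sub>R F u - growth u *\<^sub>R nu u" and ?m = "\<lambda>u. mu u + growth u * \<kappa> u"
    let ?Z' = "\<lambda>t. ((1 + \<kappa> (c t)) *\<^sub>R E (c t) a + \<xi> (c t) a *\<^sub>R ?y (c t), ?m (c t) * \<xi> (c t) a)"
    let ?G = "\<lambda>u. norm (E u a) + norm (E u a) * norm (?y u) + \<bar>?m u\<bar> * norm (E u a)"
    have der: "(?Z has_vector_derivative ?Z' t) (at t)" if "t \<in> {0..1}" for t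
    proof -
      have cV: "c t \<in> V" "\<omega> (c t) \<noteq> 0" using c[OF that] by auto
      have eX: "dir_deriv (\<lambda>w. E w (X w)) (c t) a = (1 + \<kappa> (c t)) *\<^sub>R E (c t) a + \<xi> (c t) a *\<^sub>R ?y (c t)"
      proof -
        have "(\<lambda>w. E w (X w)) = (\<lambda>w. F w - nu w)" by (simp add: F_split)
        then have "dir_deriv (\<lambda>w. E w (X w)) (c t) a = E (c t) a - dir_deriv nu (c t) a"
          using dir_deriv_diff[OF diffs(1)[OF cV(1)] diffs(5)[OF cV(1)]] by metis
        then show ?thesis unfolding deriv_nu_formula[OF cV] by (simp add: algebra_simps)
      qed
      have "((\<lambda>t. E (c t) (X (c t))) has_vector_derivative dir_deriv (\<lambda>w. E w (X w)) (c t) a) (at t)"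
        unfolding c_def by (rule has_vector_derivative_along_line)
          (use cV smooth_on_has_derivative[OF smooth_EX] in \<open>simp add: c_def\<close>)
      moreover have "((\<lambda>t. \<kappa> (c t)) has_vector_derivative dir_deriv \<kappa> (c t) a) (at t)"
        unfolding c_def by (rule has_vector_derivative_along_line)
          (use cV smooth_on_has_derivative[OF smooth_kappa] in \<open>simp add: c_def\<close>)
      ultimately show ?thesis
        unfolding eX deriv_kappa[OF cV]
        by (intro has_vector_derivative_Pair) (auto intro!: derivative_eq_intros)
    qed
    have contG: "continuous_on ?S ?G"
      by (intro continuous_intros continuous_on_subset[OF smooth_on_continuous[OF smooth_E]]
          continuous_on_subset[OF smooth_on_continuous[OF smooth_mu]]
          continuous_on_subset[OF smooth_on_continuous[OF smooth_F]]
          continuous_on_subset[OF smooth_on_continuous[OF smooth_beta]]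
          continuous_on_subset[OF smooth_on_continuous[OF smooth_omega]]
          continuous_on_subset[OF smooth_on_continuous[OF smooth_kappa]]
          continuous_on_subset[OF smooth_on_continuous[OF smooth_nu]]) auto
    have "continuous_on {0..1} (\<lambda>t. ?G (c t))"
      by (rule continuous_on_compose2[OF contG]) (use c in \<open>auto simp: c_def intro!: continuous_intros\<close>)
    then have "bounded ((\<lambda>t. ?G (c t)) ` {0..1})"
      using compact_continuous_image compact_imp_bounded compact_Icc by blast
    then obtain L where "\<forall>y\<in>(\<lambda>t. ?G (c t)) ` {0..1}. norm y \<le> L"
      unfolding bounded_iff by blast
    then have L: "\<bar>?G (c t)\<bar> \<le> L" if "t \<in> {0..1}" for t
      using that by (simp only: ball_simps real_norm_def)
    have bound: "norm (?Z' t) \<le> L * norm (?Z t)" if "t \<in> {0..1}" for t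
    proof -
      let ?u = "c t"
      have cV: "?u \<in> V" using c[OF that] by auto
      have x: "\<bar>\<xi> ?u a\<bar> \<le> norm (?Z t) * norm (E ?u a)"
      proof -
        have "\<bar>\<xi> ?u a\<bar> \<le> norm (E ?u (X ?u)) * norm (E ?u a)"
          unfolding xi_eq[OF cV] by (rule Cauchy_Schwarz_ineq2)
        also have "\<dots> \<le> norm (?Z t) * norm (E ?u a)"
          by (intro mult_right_mono) (auto simp: norm_Pair intro: real_le_rsqrt)
        finally show ?thesis .
      qed
      have k: "\<bar>1 + \<kappa> ?u\<bar> \<le> norm (?Z t)" by (auto simp: norm_Pair intro: real_le_rsqrt)
      have "norm (?Z' t) \<le> norm ((1 + \<kappa> ?u) *\<^sub>R E ?u a + \<xi> ?u a *\<^sub>R ?y ?u) + norm (?m ?u * \<xi> ?u a)"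
        by (rule norm_Pair_le)
      also have "\<dots> \<le> (\<bar>1 + \<kappa> ?u\<bar> * norm (E ?u a) + \<bar>\<xi> ?u a\<bar> * norm (?y ?u)) + \<bar>?m ?u\<bar> * \<bar>\<xi> ?u a\<bar>"
        by (intro add_mono norm_triangle_le) (auto simp: abs_mult)
      also have "\<dots> \<le> (norm (?Z t) * norm (E ?u a) + (norm (?Z t) * norm (E ?u a)) * norm (?y ?u))
           + \<bar>?m ?u\<bar> * (norm (?Z t) * norm (E ?u a))"
        by (intro add_mono mult_right_mono mult_left_mono x k) auto
      also have "\<dots> = ?G ?u * norm (?Z t)" by (simp add: algebra_simps)
      also have "\<dots> \<le> L * norm (?Z t)" using L[OF that] by (intro mult_right_mono) auto
      finally show ?thesis .
    qed
    have "?Z 0 = 0" using v k linear_E[OF v(1)] by (simp add: c_def linear_0 zero_prod_def)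
    then have "?Z 1 = 0" using der bound by (intro gronwall_zero[of 1 ?Z ?Z' L]) auto
    then have "E u (X u) = 0" by (simp add: c_def a_def zero_prod_def)
    moreover have "u \<in> V" using u r(2) by (auto simp: subset_iff)
    ultimately show ?thesis using E_eq_0_iff by simp
  qed
  then show False using dense[of "ball v r"] r by (auto simp: subset_iff)
qed

text \<open>The derivative of \<open>x\<^sup>T\<close> at a zero is \<open>1 + \<kappa>\<close> times the identity.\<close>

lemma degenerate_isolated:
  assumes v: "v \<in> V" "X v = 0"
  shows "\<exists>r>0. ball v r \<subseteq> V \<and> (\<forall>u\<in>ball v r - {v}. X u \<noteq> 0)"
proof -
  have inj: "inj (dir_deriv X v)"
    unfolding linear_injective_0[OF linear_frechet_derivative[OF diffs(4)[OF v(1)]]]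
  proof (intro allI impI)
    fix a assume a: "dir_deriv X v a = 0"
    have "\<xi> v a = 0" using xi_eq[OF v(1), of a] v(2) linear_E[OF v(1)] by (simp add: linear_0)
    moreover have "dir_deriv nu v a = E v a"
      using deriv_nu[OF v(1), of a] a v(2) linear_0[OF linear_E[OF v(1)]] linear_0[OF linear_F2'[OF
          v(1)]] by simp
    ultimately have "(1 + \<kappa> v) * (E v a \<bullet> E v a) = 0"
      using deriv_nu_tangential[OF v(1), of a a] II_eq[OF v(1), of a a] by (simp add: algebra_simps)
    then show "a = 0" using degenerate_kappa[OF v] E_eq_0_iff[OF v(1)] by auto
  qed
  obtain B d where B: "B > 0" "d > 0" "\<And>y. norm (y - v) < d \<Longrightarrow> B * norm (y - v) \<le> norm (X y - X v)"
    using has_derivative_inj_bounded_below[OF has_derivative_dir_deriv[OF diffs(4)[OF v(1)]] inj] by blast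
  obtain r where r: "r > 0" "ball v r \<subseteq> V" using open_V v open_contains_ball by blast
  have "X u \<noteq> 0" if "u \<in> ball v (min d r) - {v}" for u
  proof
    assume "X u = 0"
    moreover have "norm (u - v) < d" using that by (simp add: dist_norm norm_minus_commute)
    ultimately have "B * norm (u - v) \<le> 0" using B(3)[of u] v by simp
    then show False using B(1) that by (simp add: mult_le_0_iff)
  qed
  then show ?thesis using B r by (intro exI[of _ "min d r"]) auto
qed

end

section \<open>The differential equation of the profile\<close>

text \<open>\<open>\<beta>\<close> as a function of \<open>w = \<omega>\<close> and \<open>k = \<kappa>\<close>, for \<open>N = n - 1\<close> and \<open>l = lam + 1\<close>. With respect to \<open>q = \<bar>x\<bar>\<^sup>2\<close>,
  the derivatives of \<open>\<omega>\<close> and \<open>\<kappa>\<close> are \<open>- profile_curv\<close> and \<open>profile_rate\<close>.\<close>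

definition profile_curv :: "real \<Rightarrow> real \<Rightarrow> real \<Rightarrow> real \<Rightarrow> real" where
  "profile_curv N l w k = w / (2 * N) - (N - 1) * k / 2 + l * w / (2 * N * k)"

definition profile_rate :: "real \<Rightarrow> real \<Rightarrow> real \<Rightarrow> real \<Rightarrow> real \<Rightarrow> real" where
  "profile_rate N l q w k =
    ((profile_curv N l w k - k) / (q - w) * (1 + k) - k * profile_curv N l w k / w) / 2"

text \<open>The domain of the system: \<open>w = \<bar>\<nu>\<bar>\<^sup>2\<close> and \<open>q - w = \<bar>x\<^sup>T\<bar>\<^sup>2\<close> are positive, and \<open>k\<close> may vanish only if
  the term with \<open>k\<close> in its denominator is absent.\<close>

definition admissible :: "real \<Rightarrow> real \<Rightarrow> real \<Rightarrow> real \<Rightarrow> bool" where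
  "admissible l q w k \<longleftrightarrow> w > 0 \<and> q - w > 0 \<and> (l = 0 \<or> k \<noteq> 0)"

text \<open>A Lipschitz estimate along two given solutions only, whose distance at time \<open>t\<close> is \<open>d t\<close>: the
  functions \<open>u\<close> and \<open>v\<close> come from the two solutions, and their difference is bounded by a multiple
  of \<open>d\<close> on \<open>S\<close>. For compact \<open>S\<close> this relation is preserved by the field operations, hence it passes
  to the right-hand side of the system.\<close>

definition lip_pair :: "real set \<Rightarrow> (real \<Rightarrow> real) \<Rightarrow> (real \<Rightarrow> real) \<Rightarrow> (real \<Rightarrow> real) \<Rightarrow> bool" where
  "lip_pair S d u v \<longleftrightarrow> continuous_on S u \<and> continuous_on S v \<and> (\<exists>L. \<forall>t\<in>S. \<bar>u t - v t\<bar> \<le> L * d t)"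

context
  fixes S :: "real set" and d :: "real \<Rightarrow> real"
  assumes S: "compact S" and d: "\<And>t. d t \<ge> 0"
begin

lemma lip_pair_same: "continuous_on S u \<Longrightarrow> lip_pair S d u u"
  by (auto simp: lip_pair_def intro!: exI[of _ 0])

lemma lip_pair_add: "lip_pair S d u v \<Longrightarrow> lip_pair S d u' v' \<Longrightarrow> lip_pair S d (\<lambda>t. u t + u' t) (\<lambda>t. v t + v' t)"
  unfolding lip_pair_def
proof (elim conjE exE, intro conjI)
  fix L L' assume "\<forall>t\<in>S. \<bar>u t - v t\<bar> \<le> L * d t" "\<forall>t\<in>S. \<bar>u' t - v' t\<bar> \<le> L' * d t"
  then show "\<exists>L. \<forall>t\<in>S. \<bar>u t + u' t - (v t + v' t)\<bar> \<le> L * d t"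
    by (intro exI[of _ "L + L'"]) (fastforce simp: distrib_right)
qed (auto intro: continuous_intros)

lemma continuous_bound:
  fixes u :: "real \<Rightarrow> real"
  assumes "continuous_on S u"
  shows "\<exists>C\<ge>0. \<forall>t\<in>S. \<bar>u t\<bar> \<le> C"
proof -
  have "bounded (u ` S)" using compact_continuous_image[OF assms S] compact_imp_bounded by blast
  then obtain C where "\<forall>y\<in>u ` S. norm y \<le> C" unfolding bounded_iff by blast
  then show ?thesis by (intro exI[of _ "max C 0"]) (auto simp: le_max_iff_disj)
qed

lemma lip_pair_mult: 
  assumes "lip_pair S d u v" "lip_pair S d u' v'"
  shows "lip_pair S d (\<lambda>t. u t * u' t) (\<lambda>t. v t * v' t)"
proof -
  obtain L L' where L: "\<forall>t\<in>S. \<bar>u t - v t\<bar> \<le> L * d t" "\<forall>t\<in>S. \<bar>u' t - v' t\<bar> \<le> L' * d t"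
    using assms by (auto simp: lip_pair_def)
  have c: "continuous_on S u" "continuous_on S v" "continuous_on S u'" "continuous_on S v'"
    using assms by (auto simp: lip_pair_def)
  obtain C C' where C: "C \<ge> 0" "\<forall>t\<in>S. \<bar>u' t\<bar> \<le> C" "C' \<ge> 0" "\<forall>t\<in>S. \<bar>v t\<bar> \<le> C'"
    using continuous_bound[OF c(3)] continuous_bound[OF c(2)] by blast
  have "\<bar>u t * u' t - v t * v' t\<bar> \<le> (L * C + C' * L') * d t" if t: "t \<in> S" for t
  proof -
    have "u t * u' t - v t * v' t = (u t - v t) * u' t + v t * (u' t - v' t)" by (simp add: algebra_simps)
    also have "\<bar>\<dots>\<bar> \<le> \<bar>u t - v t\<bar> * \<bar>u' t\<bar> + \<bar>v t\<bar> * \<bar>u' t - v' t\<bar>"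
      using abs_triangle_ineq[of "(u t - v t) * u' t" "v t * (u' t - v' t)"] by (simp add: abs_mult)
    also have "\<dots> \<le> (L * d t) * C + C' * (L' * d t)"
    proof -
      have "0 \<le> L * d t" using L(1) t by (meson abs_ge_zero order_trans)
      then show ?thesis using L C t by (intro add_mono mult_mono) auto
    qed
    finally show ?thesis by (simp add: algebra_simps)
  qed
  then show ?thesis using c by (auto simp: lip_pair_def intro: continuous_intros)
qed

lemma lip_pair_inverse:
  assumes "lip_pair S d u v" "\<And>t. t \<in> S \<Longrightarrow> u t \<noteq> 0" "\<And>t. t \<in> S \<Longrightarrow> v t \<noteq> 0"
  shows "lip_pair S d (\<lambda>t. inverse (u t)) (\<lambda>t. inverse (v t))"
proof -
  have c: "continuous_on S u" "continuous_on S v" using assms by (auto simp: lip_pair_def)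
  obtain L where L: "\<forall>t\<in>S. \<bar>u t - v t\<bar> \<le> L * d t" using assms by (auto simp: lip_pair_def)
  have "continuous_on S (\<lambda>t. inverse (u t * v t))" using c assms by (intro continuous_intros) auto
  then obtain C where C: "C \<ge> 0" "\<forall>t\<in>S. \<bar>inverse (u t * v t)\<bar> \<le> C" using continuous_bound by blast
  have "\<bar>inverse (u t) - inverse (v t)\<bar> \<le> (L * C) * d t" if t: "t \<in> S" for t
  proof -
    have "inverse (u t) - inverse (v t) = - ((u t - v t) * inverse (u t * v t))"
      using assms(2,3)[OF t] by (simp add: field_simps)
    then have "\<bar>inverse (u t) - inverse (v t)\<bar> = \<bar>u t - v t\<bar> * \<bar>inverse (u t * v t)\<bar>"
      by (simp add: abs_mult)
    also have "\<dots> \<le> (L * d t) * C"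
    proof -
      have "0 \<le> L * d t" using L(1) t by (meson abs_ge_zero order_trans)
      then show ?thesis using L C t by (intro mult_mono) auto
    qed
    finally show ?thesis by (simp add: algebra_simps)
  qed
  then show ?thesis using c assms by (auto simp: lip_pair_def intro!: continuous_intros)
qed

lemma lip_pair_minus: "lip_pair S d u v \<Longrightarrow> lip_pair S d (\<lambda>t. - u t) (\<lambda>t. - v t)"
  using lip_pair_mult[OF lip_pair_same[of "\<lambda>t. -1"]] by (simp add: continuous_on_const)

lemma lip_pair_diff: "lip_pair S d u v \<Longrightarrow> lip_pair S d u' v' \<Longrightarrow> lip_pair S d (\<lambda>t. u t - u' t) (\<lambda>t. v t
    - v' t)"
  using lip_pair_add[OF _ lip_pair_minus, of u v u' v'] by simp

lemma lip_pair_divide: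
  assumes "lip_pair S d u v" "lip_pair S d u' v'" "\<And>t. t \<in> S \<Longrightarrow> u' t \<noteq> 0" "\<And>t. t \<in> S \<Longrightarrow> v' t \<noteq> 0"
  shows "lip_pair S d (\<lambda>t. u t / u' t) (\<lambda>t. v t / v' t)"
  unfolding divide_inverse by (intro lip_pair_mult lip_pair_inverse assms)

lemma lip_pair_profile_curv:
  assumes "N > 0" "lip_pair S d w w'" "lip_pair S d k k'" "continuous_on S q"
    and "\<And>t. t \<in> S \<Longrightarrow> admissible l (q t) (w t) (k t)" "\<And>t. t \<in> S \<Longrightarrow> admissible l (q t) (w' t) (k' t)"
  shows "lip_pair S d (\<lambda>t. profile_curv N l (w t) (k t)) (\<lambda>t. profile_curv N l (w' t) (k' t))"
proof -
  have c: "lip_pair S d (\<lambda>t. c) (\<lambda>t. c)" for c by (rule lip_pair_same) (rule continuous_on_const)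
  have "lip_pair S d (\<lambda>t. l * w t / (2 * N * k t)) (\<lambda>t. l * w' t / (2 * N * k' t))"
  proof (cases "l = 0")
    case False
    then show ?thesis using assms
      by (intro lip_pair_divide lip_pair_mult c) (auto simp: admissible_def)
  qed (simp add: c)
  then show ?thesis unfolding profile_curv_def
    by (rule lip_pair_add[rotated])
      (use assms in \<open>intro lip_pair_diff lip_pair_divide lip_pair_mult c; simp\<close>)
qed

lemma lip_pair_profile_rate:
  assumes "N > 0" "lip_pair S d w w'" "lip_pair S d k k'" "continuous_on S q"
    and "\<And>t. t \<in> S \<Longrightarrow> admissible l (q t) (w t) (k t)" "\<And>t. t \<in> S \<Longrightarrow> admissible l (q t) (w' t) (k' t)"
  shows "lip_pair S d (\<lambda>t. profile_rate N l (q t) (w t) (k t)) (\<lambda>t. profile_rate N l (q t) (w' t) (k' t))"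
proof -
  have c: "lip_pair S d (\<lambda>t. c) (\<lambda>t. c)" for c by (rule lip_pair_same) (rule continuous_on_const)
  have nz: "w t \<noteq> 0" "w' t \<noteq> 0" "q t - w t \<noteq> 0" "q t - w' t \<noteq> 0" if "t \<in> S" for t
    using assms(5,6)[OF that] by (auto simp: admissible_def)
  show ?thesis unfolding profile_rate_def
    by (intro lip_pair_add lip_pair_diff lip_pair_divide lip_pair_mult c lip_pair_same[OF assms(4)]
        lip_pair_profile_curv[OF assms] assms(2,3)) (simp_all only: nz, simp_all)
qed

end

text \<open>The system at time \<open>t\<close> when its parameter \<open>q\<close> moves with velocity \<open>q'\<close>, possibly back and forth.\<close>

definition follows_profile ::
  "real \<Rightarrow> real \<Rightarrow> (real \<Rightarrow> real) \<Rightarrow> real \<Rightarrow> (real \<Rightarrow> real) \<Rightarrow> (real \<Rightarrow> real) \<Rightarrow> real \<Rightarrow> bool" where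
  "follows_profile N l q q' w k t \<longleftrightarrow> admissible l (q t) (w t) (k t) \<and>
     (q has_real_derivative q') (at t) \<and>
     (w has_real_derivative - profile_curv N l (w t) (k t) * q') (at t) \<and>
     (k has_real_derivative profile_rate N l (q t) (w t) (k t) * q') (at t)"

text \<open>As \<open>q\<close> may run along any \<open>C\<^sup>1\<close> curve, this also compares the values of \<open>(\<omega>, \<kappa>)\<close> along a segment in a
  chart with a given solution.\<close>

lemma profile_uniqueness_along_curve:
  fixes q q' w k w' k' :: "real \<Rightarrow> real"
  assumes N: "N > 0"
    and f: "\<And>t. t \<in> {0..1} \<Longrightarrow> follows_profile N l q (q' t) w k t"
      "\<And>t. t \<in> {0..1} \<Longrightarrow> follows_profile N l q (q' t) w' k' t"
    and cont_q': "continuous_on {0..1} q'"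
    and init: "w 0 = w' 0" "k 0 = k' 0"
  shows "w 1 = w' 1 \<and> k 1 = k' 1"
proof -
  have adm: "admissible l (q t) (w t) (k t)" "admissible l (q t) (w' t) (k' t)" if "t \<in> {0..1}" for t
    using f[OF that] by (auto simp: follows_profile_def)
  have q: "(q has_real_derivative q' t) (at t)"
    and w: "(w has_real_derivative - profile_curv N l (w t) (k t) * q' t) (at t)"
    and k: "(k has_real_derivative profile_rate N l (q t) (w t) (k t) * q' t) (at t)"
    and w': "(w' has_real_derivative - profile_curv N l (w' t) (k' t) * q' t) (at t)"
    and k': "(k' has_real_derivative profile_rate N l (q t) (w' t) (k' t) * q' t) (at t)" if
        "t \<in> {0..1}" for t
    using f[OF that] unfolding follows_profile_def by blast+
  let ?S = "{0..1::real}"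
  let ?Z = "\<lambda>t. (w t - w' t, k t - k' t)"
  define d where "d t = norm (?Z t)" for t
  have d0: "d t \<ge> 0" for t by (simp add: d_def)
  note ctx = compact_Icc[of 0 1] d0
  have cont: "continuous_on ?S q" "continuous_on ?S w" "continuous_on ?S k" "continuous_on ?S w'"
      "continuous_on ?S k'"
    using DERIV_continuous_on[OF has_field_derivative_at_within[OF q]]
      DERIV_continuous_on[OF has_field_derivative_at_within[OF w]]
      DERIV_continuous_on[OF has_field_derivative_at_within[OF k]]
      DERIV_continuous_on[OF has_field_derivative_at_within[OF w']]
      DERIV_continuous_on[OF has_field_derivative_at_within[OF k']] by blast+
  have lw: "lip_pair ?S d w w'" and lk: "lip_pair ?S d k k'"
    using cont by (auto simp: lip_pair_def d_def norm_Pair intro!: exI[of _ 1] real_le_rsqrt)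
  have "lip_pair ?S d (\<lambda>t. profile_curv N l (w t) (k t) * q' t) (\<lambda>t. profile_curv N l (w' t) (k' t) * q' t)"
    by (intro lip_pair_mult ctx lip_pair_profile_curv[OF ctx N lw lk cont(1) adm] lip_pair_same cont_q')
  then obtain L1 where L1: "\<And>t. t \<in> ?S \<Longrightarrow> \<bar>profile_curv N l (w t) (k t) * q' t
      - profile_curv N l (w' t) (k' t) * q' t\<bar> \<le> L1 * d t"
    unfolding lip_pair_def by blast
  have "lip_pair ?S d (\<lambda>t. profile_rate N l (q t) (w t) (k t) * q' t) (\<lambda>t. profile_rate N l (q t)
      (w' t) (k' t) * q' t)"
    by (intro lip_pair_mult ctx lip_pair_profile_rate[OF ctx N lw lk cont(1) adm] lip_pair_same cont_q')
  then obtain L2 where L2: "\<And>t. t \<in> ?S \<Longrightarrow> \<bar>profile_rate N l (q t) (w t) (k t) * q' t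
      - profile_rate N l (q t) (w' t) (k' t) * q' t\<bar> \<le> L2 * d t"
    unfolding lip_pair_def by blast
  let ?Z' = "\<lambda>t. (- (profile_curv N l (w t) (k t) * q' t) + profile_curv N l (w' t) (k' t) * q' t,
      profile_rate N l (q t) (w t) (k t) * q' t - profile_rate N l (q t) (w' t) (k' t) * q' t)"
  have "?Z 1 = 0"
  proof (rule gronwall_zero[where L = "L1 + L2" and Z' = ?Z' and Z = ?Z and T = 1])
    fix t :: real assume "0 \<le> t" "t \<le> 1"
    then have t: "t \<in> ?S" by simp
    show "(?Z has_vector_derivative ?Z' t) (at t)"
      using w[OF t] k[OF t] w'[OF t] k'[OF t]
      by (intro has_vector_derivative_Pair)
        (auto simp flip: has_real_derivative_iff_has_vector_derivative intro!: derivative_eq_intros)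
    have "norm (?Z' t) \<le> \<bar>- (profile_curv N l (w t) (k t) * q' t) + profile_curv N l (w' t) (k' t) * q' t\<bar>
        + \<bar>profile_rate N l (q t) (w t) (k t) * q' t - profile_rate N l (q t) (w' t) (k' t) * q' t\<bar>"
      using norm_Pair_le by (metis real_norm_def)
    also have "\<dots> \<le> L1 * d t + L2 * d t"
      using L1[OF t] L2[OF t] by linarith
    finally show "norm (?Z' t) \<le> (L1 + L2) * norm (?Z t)"
      by (simp add: d_def algebra_simps)
  qed (use init in \<open>auto simp: zero_prod_def\<close>)
  then show ?thesis by (auto simp: zero_prod_def)
qed

definition profile_solution :: "real \<Rightarrow> real \<Rightarrow> real set \<Rightarrow> (real \<Rightarrow> real) \<Rightarrow> (real \<Rightarrow> real) \<Rightarrow> bool" where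
  "profile_solution N l J w k \<longleftrightarrow> open_interval J \<and> (\<forall>t\<in>J. follows_profile N l (\<lambda>t. t) 1 w k t)"

lemma profile_solutionD:
  assumes "profile_solution N l J w k"
  shows "open_interval J" "open J"
    and "\<And>t. t \<in> J \<Longrightarrow> admissible l t (w t) (k t)"
    and "\<And>t. t \<in> J \<Longrightarrow> (w has_real_derivative - profile_curv N l (w t) (k t)) (at t)"
    and "\<And>t. t \<in> J \<Longrightarrow> (k has_real_derivative profile_rate N l t (w t) (k t)) (at t)"
  using assms by (simp_all add: profile_solution_def follows_profile_def open_interval_def)

lemma follows_profile_compose:
  assumes "profile_solution N l J w k" "q t \<in> J" "(q has_real_derivative q') (at t)"
  shows "follows_profile N l q q' (\<lambda>t. w (q t)) (\<lambda>t. k (q t)) t"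
  using profile_solutionD[OF assms(1)] assms(2,3)
  unfolding follows_profile_def by (blast intro: DERIV_chain2)

lemma follows_profile_inverse:
  assumes f: "follows_profile N l h h' w k (g s)" and g: "(g has_real_derivative inverse h') (at s)"
    and "h' \<noteq> 0" "h (g s) = s"
  shows "follows_profile N l (\<lambda>s. s) 1 (\<lambda>s. w (g s)) (\<lambda>s. k (g s)) s"
proof -
  have c: "((\<lambda>s. u (g s)) has_real_derivative d * 1) (at s)" if
      "(u has_real_derivative d * h') (at (g s))" for u d
    using DERIV_chain2[OF that g] assms(3) by (simp add: mult.assoc)
  show ?thesis
    using f c[of w] c[of k] assms(4) unfolding follows_profile_def by (metis DERIV_ident)
qed

lemma follows_profile_transform:
  assumes f: "follows_profile N l (\<lambda>s. s) 1 w k t" and U: "open U" "t \<in> U"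
    and eq: "\<And>u. u \<in> U \<Longrightarrow> w0 u = w u" "\<And>u. u \<in> U \<Longrightarrow> k0 u = k u"
  shows "follows_profile N l (\<lambda>s. s) 1 w0 k0 t"
proof -
  have "(f0 has_real_derivative d) (at t)" if "(f has_real_derivative d) (at t)" "\<And>u. u \<in> U \<Longrightarrow> f0 u
      = f u" for f f0 d
    by (rule has_field_derivative_transform_within_open[OF that(1) U]) (simp add: that(2))
  from this[of w _ w0] this[of k _ k0] show ?thesis
    using f unfolding follows_profile_def eq[OF U(2)] by (metis eq)
qed

lemma profile_solution_unique:
  assumes N: "N > 0" and s: "profile_solution N l J w k" "profile_solution N l J' w' k'"
    and t0: "t0 \<in> J" "t0 \<in> J'" "w t0 = w' t0" "k t0 = k' t0"
    and t: "t \<in> J" "t \<in> J'"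
  shows "w t = w' t \<and> k t = k' t"
proof -
  let ?q = "\<lambda>s. t0 + s * (t - t0)"
  have mem: "?q s \<in> I" if "s \<in> {0..1}" "open_interval I" "t0 \<in> I" "t \<in> I" for s I
  proof -
    have "convex I" using that(2) by (simp add: open_interval_def is_interval_convex)
    then have "(1 - s) *\<^sub>R t0 + s *\<^sub>R t \<in> I" using that by (intro convexD) auto
    then show ?thesis by (simp add: algebra_simps)
  qed
  have dq: "(?q has_real_derivative (t - t0)) (at s)" for s
    by (auto intro!: derivative_eq_intros)
  note J = profile_solutionD(1)[OF s(1)] profile_solutionD(1)[OF s(2)]
  have "(\<lambda>s. w (?q s)) 1 = (\<lambda>s. w' (?q s)) 1 \<and> (\<lambda>s. k (?q s)) 1 = (\<lambda>s. k' (?q s)) 1"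
    by (rule profile_uniqueness_along_curve[OF N
          follows_profile_compose[OF s(1) mem[OF _ J(1) t0(1) t(1)] dq]
          follows_profile_compose[OF s(2) mem[OF _ J(2) t0(2) t(2)] dq] continuous_on_const])
      (use t0 in auto)
  then show ?thesis by simp
qed

text \<open>The right-hand side of the system is as smooth as the solution, so the solution is one order
  smoother.\<close>

lemma profile_solution_smooth:
  assumes N: "N > 0" and s: "profile_solution N l J w k"
  shows "smooth_on w J" "smooth_on k J"
proof -
  note J = profile_solutionD(2)[OF s] and sol = profile_solutionD(3-5)[OF s]
  have "Ck_on m w J \<and> Ck_on m k J" for m
  proof (induction m)
    case 0
    have "isCont w t \<and> isCont k t" if "t \<in> J" for t
      using sol(2,3)[OF that] DERIV_isCont by blast
    then show ?case by (simp add: continuous_at_imp_continuous_on)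
  next
    case (Suc m)
    have "Ck_on m (\<lambda>t. l * w t / (2 * N * k t)) J"
    proof (cases "l = 0")
      case False
      then show ?thesis using Suc sol(1) N
        by (intro Ck_on_divide Ck_on_mult Ck_on_const J) (auto simp: admissible_def)
    qed (simp add: Ck_on_const J)
    then have c: "Ck_on m (\<lambda>t. profile_curv N l (w t) (k t)) J"
      unfolding profile_curv_def
      by (rule Ck_on_add[OF J, rotated])
        (use Suc N in \<open>intro Ck_on_diff Ck_on_divide Ck_on_mult Ck_on_const J; simp\<close>)
    then have "Ck_on m (\<lambda>t. profile_rate N l t (w t) (k t)) J"
      unfolding profile_rate_def
    proof (intro Ck_on_add Ck_on_diff Ck_on_divide Ck_on_mult Ck_on_const Ck_on_ident J c)
      show "t - w t \<noteq> 0" "w t \<noteq> 0" if "t \<in> J" for t using sol(1)[OF that] by (auto simp: admissible_def)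
    qed (use Suc in auto)
    moreover have "Ck_on m (\<lambda>t. - profile_curv N l (w t) (k t)) J"
      using Ck_on_diff[OF J Ck_on_const[OF J, of m 0] c] by simp
    ultimately show ?case using sol(2,3) by (intro conjI Ck_on_Suc_realI[OF J])
  qed
  then show "smooth_on w J" "smooth_on k J" by (auto simp: smooth_on_def)
qed

lemma profile_solution_glue:
  assumes N: "N > 0" and s: "profile_solution N l J w k" "profile_solution N l J' w' k'"
    and t0: "t0 \<in> J" "t0 \<in> J'" "w t0 = w' t0" "k t0 = k' t0"
  shows "\<exists>w'' k''. profile_solution N l (J \<union> J') w'' k'' \<and>
    (\<forall>t\<in>J. w'' t = w t \<and> k'' t = k t) \<and> (\<forall>t\<in>J'. w'' t = w' t \<and> k'' t = k' t)"
proof -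
  define w'' k'' where "w'' t = (if t \<in> J then w t else w' t)" and "k'' t
      = (if t \<in> J then k t else k' t)" for t
  have on: "w'' t = w t" "k'' t = k t" if "t \<in> J" for t using that by (auto simp: w''_def k''_def)
  have on': "w'' t = w' t" "k'' t = k' t" if "t \<in> J'" for t
    using that profile_solution_unique[OF N s t0] by (auto simp: w''_def k''_def)
  note J = profile_solutionD(1,2)[OF s(1)] profile_solutionD(1,2)[OF s(2)]
  have "open_interval (J \<union> J')"
    using J t0 by (auto simp: open_interval_def is_interval_connected_1 intro!: connected_Un)
  moreover have "follows_profile N l (\<lambda>t. t) 1 w'' k'' t" if "t \<in> J \<union> J'" for t
  proof (cases "t \<in> J")
    case True
    show ?thesis
      by (rule follows_profile_transform[where w = w and k = k, OF _ J(2) True on])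
        (use s(1) True in \<open>simp_all add: profile_solution_def\<close>)
  next
    case False
    then have t: "t \<in> J'" using that by blast
    show ?thesis
      by (rule follows_profile_transform[where w = w' and k = k', OF _ J(4) t on'])
        (use s(2) t in \<open>simp_all add: profile_solution_def\<close>)
  qed
  ultimately show ?thesis using on on' unfolding profile_solution_def by blast
qed

text \<open>The squared length of \<open>\<nu> + \<kappa> x\<close>, for \<open>t = \<bar>x\<bar>\<^sup>2\<close>.\<close>

definition axial_sqnorm :: "real \<Rightarrow> real \<Rightarrow> real \<Rightarrow> real" where
  "axial_sqnorm t w k = k\<^sup>2 * t + 2 * k * w + w"

text \<open>The inner product of \<open>x\<close> with the unit vector in the direction of \<open>\<nu> + \<kappa> x\<close>.\<close>

definition height :: "real \<Rightarrow> real \<Rightarrow> real \<Rightarrow> real" where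
  "height t w k = (w + k * t) / sqrt (axial_sqnorm t w k)"

text \<open>It is the sum of the squared lengths of the normal part \<open>(1 + \<kappa>) \<nu>\<close> and the tangential part
  \<open>\<kappa> x\<^sup>T\<close>.\<close>

lemma axial_sqnorm_pos:
  assumes "admissible l t w k"
  shows "axial_sqnorm t w k > 0"
proof -
  have w: "w > 0" "t - w > 0" using assms by (auto simp: admissible_def)
  have eq: "axial_sqnorm t w k = (1 + k)\<^sup>2 * w + k\<^sup>2 * (t - w)"
    by (simp add: axial_sqnorm_def power2_eq_square algebra_simps)
  show ?thesis
  proof (cases "k = 0")
    case True
    then show ?thesis using w eq by simp
  next
    case False
    then have "k\<^sup>2 * (t - w) > 0" using w by simp
    moreover have "(1 + k)\<^sup>2 * w \<ge> 0" using w by simp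
    ultimately show ?thesis unfolding eq by linarith
  qed
qed

text \<open>The strict Cauchy-Schwarz inequality for \<open>x\<close> and \<open>\<nu> + \<kappa> x\<close>; their Gram determinant is \<open>w (t - w)\<close>.
  So points of the profile do not lie on the axis.\<close>

lemma height_sq_less:
  assumes "admissible l t w k"
  shows "(height t w k)\<^sup>2 < t"
proof -
  let ?D = "axial_sqnorm t w k"
  have D: "?D > 0" by (rule axial_sqnorm_pos[OF assms])
  have w: "w > 0" "t - w > 0" using assms by (auto simp: admissible_def)
  have "t * ?D - (w + k * t)\<^sup>2 = w * (t - w)"
    by (simp add: axial_sqnorm_def power2_eq_square algebra_simps)
  moreover have "w * (t - w) > 0" using w by simp
  ultimately have "(w + k * t)\<^sup>2 < t * ?D" by linarith
  then show ?thesis using D by (simp add: height_def power_divide divide_less_eq)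
qed

text \<open>Geometrically, the gradient of the height is the tangential part of the unit vector \<open>e\<close>, which
  is \<open>\<kappa> x\<^sup>T/\<bar>\<nu> + \<kappa> x\<bar>\<close>, and the gradient of \<open>t = \<bar>x\<bar>\<^sup>2\<close> is \<open>2 x\<^sup>T\<close>. In the computation, \<open>m\<close> is \<open>mu\<close>, and \<open>g\<close>
  is the logarithmic derivative \<open>mu - \<beta>/\<omega>\<close>, with respect to \<open>t/2\<close>, of the length of \<open>\<nu> + \<kappa> x\<close>.\<close>

lemma height_deriv:
  assumes s: "profile_solution N l J w k" and t: "t \<in> J"
  shows "((\<lambda>t. height t (w t) (k t)) has_real_derivative k t / (2 * sqrt (axial_sqnorm t (w t) (k
      t)))) (at t)"
proof -
  define b where "b = profile_curv N l (w t) (k t)"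
  define m where "m = (b - k t) / (t - w t)"
  define g where "g = m - b / w t"
  define D where "D = axial_sqnorm t (w t) (k t)"
  have adm: "admissible l t (w t) (k t)" by (rule profile_solutionD(3)[OF s t])
  have D: "D > 0" unfolding D_def by (rule axial_sqnorm_pos[OF adm])
  have w0: "w t > 0" "t - w t > 0" using adm by (auto simp: admissible_def)
  have dw: "(w has_real_derivative - b) (at t)"
    unfolding b_def by (rule profile_solutionD(4)[OF s t])
  have rate: "profile_rate N l t (w t) (k t) = (g * k t + m) / 2"
    unfolding profile_rate_def b_def[symmetric] m_def[symmetric] g_def by (simp add: algebra_simps)
  have dk: "(k has_real_derivative (g * k t + m) / 2) (at t)"
    unfolding rate[symmetric] by (rule profile_solutionD(5)[OF s t])
  have mw: "m * (t - w t) = b - k t" using w0 by (simp add: m_def)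
  have gw: "g * w t = m * w t - b" using w0 by (simp add: g_def algebra_simps)
  have "((\<lambda>t. w t + k t * t) has_real_derivative (- b + ((g * k t + m) / 2 * t + k t))) (at t)"
    by (auto intro!: derivative_eq_intros dw dk)
  moreover have "- b + ((g * k t + m) / 2 * t + k t) = (g * (w t + k t * t) + k t) / 2"
    using mw gw by (simp add: field_simps)
  ultimately have dn: "((\<lambda>t. w t + k t * t) has_real_derivative (g * (w t + k t * t) + k t) / 2) (at t)"
    by (simp only:)
  have dD: "((\<lambda>t. axial_sqnorm t (w t) (k t)) has_real_derivative g * D) (at t)"
  proof -
    have "((\<lambda>t. axial_sqnorm t (w t) (k t)) has_real_derivative
        ((g * k t + m) * k t * t + (k t)\<^sup>2 + ((g * k t + m) * w t - 2 * k t * b) - b)) (at t)"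
      unfolding axial_sqnorm_def
      by (auto intro!: derivative_eq_intros dw dk simp: power2_eq_square algebra_simps)
    moreover have "(g * k t + m) * k t * t + (k t)\<^sup>2 + ((g * k t + m) * w t - 2 * k t * b) - b = g * D"
    proof -
      have "g * D = g * k t * k t * t + 2 * k t * (g * w t) + g * w t"
        by (simp add: D_def axial_sqnorm_def power2_eq_square algebra_simps)
      moreover have "(g * k t + m) * k t * t + (k t)\<^sup>2 + ((g * k t + m) * w t - 2 * k t * b) - b
         = g * k t * k t * t + k t * (m * (t - w t)) + m * w t * k t + (k t)\<^sup>2 + k t * (g * w t)
             + m * w t - 2 * k t * b - b"
        by (simp add: power2_eq_square algebra_simps)
      ultimately show ?thesis unfolding mw gw by (simp add: power2_eq_square algebra_simps)
    qed
    ultimately show ?thesis by simp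
  qed
  have dS: "((\<lambda>t. sqrt (axial_sqnorm t (w t) (k t))) has_real_derivative g * sqrt D / 2) (at t)"
  proof -
    have "((\<lambda>t. sqrt (axial_sqnorm t (w t) (k t))) has_real_derivative (g * D) / (2 * sqrt D)) (at t)"
      using D dD by (auto intro!: derivative_eq_intros simp: D_def field_simps)
    moreover have "(g * D) / (2 * sqrt D) = g * sqrt D / 2"
      using D real_sqrt_mult_self[of D] by (simp add: field_simps)
    ultimately show ?thesis by simp
  qed
  have "sqrt D > 0" using D by simp
  then have "((\<lambda>t. (w t + k t * t) / sqrt (axial_sqnorm t (w t) (k t))) has_real_derivative
      (((g * (w t + k t * t) + k t) / 2) * sqrt D - (w t
          + k t * t) * (g * sqrt D / 2)) / (sqrt D * sqrt D)) (at t)"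
    using DERIV_divide[OF dn dS] by (simp add: D_def)
  moreover have "(((g * (w t + k t * t) + k t) / 2) * sqrt D - (w t
      + k t * t) * (g * sqrt D / 2)) / (sqrt D * sqrt D) = k t / (2 * sqrt D)"
    using \<open>sqrt D > 0\<close> by (simp add: field_simps)
  ultimately show ?thesis by (simp add: height_def D_def)
qed

lemma profile_smooth:
  assumes N: "N > 0" and s: "profile_solution N l J w k"
  shows "smooth_on (\<lambda>t. axial_sqnorm t (w t) (k t)) J"
    and "smooth_on (\<lambda>t. height t (w t) (k t)) J"
    and "smooth_on (\<lambda>t. sqrt (t - (height t (w t) (k t))\<^sup>2)) J"
proof -
  note J = profile_solutionD(2)[OF s] and adm = profile_solutionD(3)[OF s]
  note wk = profile_solution_smooth[OF N s]
  show D: "smooth_on (\<lambda>t. axial_sqnorm t (w t) (k t)) J"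
    unfolding axial_sqnorm_def power2_eq_square
    by (intro smooth_on_add smooth_on_mult smooth_on_const smooth_on_ident_real wk J)
  have sD: "smooth_on (\<lambda>t. sqrt (axial_sqnorm t (w t) (k t))) J"
    by (rule smooth_on_sqrt[OF J D]) (rule axial_sqnorm_pos[OF adm])
  have nz: "sqrt (axial_sqnorm t (w t) (k t)) \<noteq> 0" if "t \<in> J" for t
    using axial_sqnorm_pos[OF adm[OF that]] by simp
  show z: "smooth_on (\<lambda>t. height t (w t) (k t)) J"
    unfolding height_def
    by (intro smooth_on_divide[OF J _ sD nz] smooth_on_add smooth_on_mult smooth_on_ident_real wk J)
  show "smooth_on (\<lambda>t. sqrt (t - (height t (w t) (k t))\<^sup>2)) J"
  proof (rule smooth_on_sqrt[OF J])
    show "smooth_on (\<lambda>t. t - (height t (w t) (k t))\<^sup>2) J" unfolding power2_eq_square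
      by (intro smooth_on_diff smooth_on_mult smooth_on_ident_real z J)
    show "0 < t - (height t (w t) (k t))\<^sup>2" if "t \<in> J" for t using height_sq_less[OF adm[OF that]] by simp
  qed
qed

section \<open>The local profile\<close>

context dense_soliton_chart
begin

abbreviation "sqn v \<equiv> F v \<bullet> F v"

lemma smooth_sqn: "smooth_on (\<lambda>v. sqn v) V"
  by (intro smooth_on_inner smooth_F open_V)

lemma admissible_chart:
  assumes v: "v \<in> V" "X v \<noteq> 0"
  shows "admissible (lam + 1) (sqn v) (\<omega> v) (\<kappa> v)"
proof -
  have "\<omega> v > 0" using omega_nonzero[OF v] by (simp add: omega_def)
  moreover have "\<tau> v > 0" using tau_eq_0_iff[OF v(1)] v(2)
      by (simp add: tau_def order.not_eq_order_implies_strict)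
  ultimately show ?thesis using kappa_nonzero[OF v] tau_eq[OF v(1)] by (auto simp: admissible_def)
qed

lemma beta_profile_curv:
  assumes v: "v \<in> V" "X v \<noteq> 0"
  shows "\<beta> v = profile_curv (real CARD('n) - 1) (lam + 1) (\<omega> v) (\<kappa> v)"
  using beta_formula[OF v] by (simp add: profile_curv_def)

lemma deriv_chart_rates:
  assumes v: "v \<in> V" "X v \<noteq> 0"
  shows "dir_deriv \<omega> v a = - profile_curv (real CARD('n) - 1) (lam + 1) (\<omega> v) (\<kappa> v) * (2 * \<xi> v a)"
    and "dir_deriv \<kappa> v a = profile_rate (real CARD('n) - 1) (lam + 1) (sqn v) (\<omega> v) (\<kappa> v) * (2 * \<xi> v a)"
proof -
  show "dir_deriv \<omega> v a = - profile_curv (real CARD('n) - 1) (lam + 1) (\<omega> v) (\<kappa> v) * (2 * \<xi> v a)"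
    using deriv_omega[OF v(1)] beta_profile_curv[OF v] by simp
  have "mu v + growth v * \<kappa> v = mu v * (1 + \<kappa> v) - \<kappa> v * \<beta> v / \<omega> v"
    by (simp add: algebra_simps)
  also have "\<dots> = 2 * profile_rate (real CARD('n) - 1) (lam + 1) (sqn v) (\<omega> v) (\<kappa> v)"
    unfolding mu_eq[OF v] tau_eq[OF v(1)] beta_profile_curv[OF v] profile_rate_def
    by (simp add: ac_simps)
  finally show "dir_deriv \<kappa> v a = profile_rate (real CARD('n) - 1) (lam
      + 1) (sqn v) (\<omega> v) (\<kappa> v) * (2 * \<xi> v a)"
    using deriv_kappa_nondegenerate[OF v] by simp
qed

lemma chart_follows_profile:
  fixes c a :: "real^'n"
  assumes v: "c + t *\<^sub>R a \<in> V" "X (c + t *\<^sub>R a) \<noteq> 0"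
  shows "follows_profile (real CARD('n) - 1) (lam + 1) (\<lambda>t. sqn (c + t *\<^sub>R a)) (2 * \<xi> (c + t *\<^sub>R a) a)
    (\<lambda>t. \<omega> (c + t *\<^sub>R a)) (\<lambda>t. \<kappa> (c + t *\<^sub>R a)) t"
proof -
  have "((\<lambda>t. f (c + t *\<^sub>R a)) has_real_derivative dir_deriv f (c + t *\<^sub>R a) a) (at t)"
    if "smooth_on f V" for f
    unfolding has_real_derivative_iff_has_vector_derivative
    by (rule has_vector_derivative_along_line[OF smooth_on_has_derivative[OF that v(1)]])
  from this[OF smooth_sqn] this[OF smooth_omega] this[OF smooth_kappa] show ?thesis
    unfolding follows_profile_def deriv_sqnorm[OF v(1)] deriv_chart_rates[OF v]
    using admissible_chart[OF v] by blast
qed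

text \<open>On the line through \<open>v\<close> in the direction of \<open>x\<^sup>T\<close> the function \<open>q\<close> is increasing, so \<open>\<omega>\<close> and \<open>\<kappa>\<close> along
  this line are functions \<open>w\<close> and \<open>k\<close> of \<open>q\<close>, which solve the profile system. At any other point near
  \<open>v\<close> the formulas \<open>\<omega> = w(q)\<close> and \<open>\<kappa> = k(q)\<close> follow from uniqueness along the segment from \<open>v\<close>.\<close>

lemma local_profile:
  assumes v: "v \<in> V" "X v \<noteq> 0"
  shows "\<exists>r J w k. r > 0 \<and> ball v r \<subseteq> {u \<in> V. X u \<noteq> 0} \<and> profile_solution (real CARD('n) - 1) (lam
      + 1) J w k \<and>
    J \<subseteq> (\<lambda>u. sqn u) ` {u \<in> V. X u \<noteq> 0} \<and>
    (\<forall>u\<in>ball v r. sqn u \<in> J \<and> \<omega> u = w (sqn u) \<and> \<kappa> u = k (sqn u))"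
proof -
  define a where "a = X v"
  have N: "(real CARD('n) - 1) > 0" using dim_ge_2 by simp
  have pos: "\<xi> v a > 0" using xi_X[OF v(1)] tau_eq_0_iff[OF v(1)] v(2)
    by (simp add: a_def tau_def order.not_eq_order_implies_strict)
  have "continuous_on {u \<in> V. X u \<noteq> 0} (\<lambda>u. \<xi> u a)"
    by (rule continuous_on_subset[OF smooth_on_continuous[OF smooth_xi]]) auto
  then have "open ((\<lambda>u. \<xi> u a) -` {0<..} \<inter> {u \<in> V. X u \<noteq> 0})"
    using open_X_nonzero by (simp add: continuous_on_open_vimage)
  moreover have "v \<in> (\<lambda>u. \<xi> u a) -` {0<..} \<inter> {u \<in> V. X u \<noteq> 0}"
    using v pos by simp
  ultimately obtain r0 where r0: "r0 > 0" "ball v r0 \<subseteq> (\<lambda>u. \<xi> u a) -` {0<..} \<inter> {u \<in> V. X u \<noteq> 0}"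
    by (rule openE)
  define T where "T = r0 / (norm a + 1)"
  have n1: "norm a + 1 > 0" by (smt (verit) norm_ge_zero)
  have T: "T > 0" using r0 n1 by (simp add: T_def)
  have line: "v + t *\<^sub>R a \<in> V" "X (v + t *\<^sub>R a) \<noteq> 0" "\<xi> (v + t *\<^sub>R a) a > 0" if "t \<in> {-T<..<T}" for t
  proof -
    have "\<bar>t\<bar> * norm a \<le> \<bar>t\<bar> * (norm a + 1)" by (simp add: mult_left_mono)
    also have "\<dots> < T * (norm a + 1)" using that n1 by (intro mult_strict_right_mono) auto
    also have "\<dots> = r0" using n1 by (simp add: T_def)
    finally have "v + t *\<^sub>R a \<in> ball v r0" by (simp add: dist_norm)
    then show "v + t *\<^sub>R a \<in> V" "X (v + t *\<^sub>R a) \<noteq> 0" "\<xi> (v + t *\<^sub>R a) a > 0" using r0(2) by auto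
  qed
  let ?h = "\<lambda>t. sqn (v + t *\<^sub>R a)"
  define J where "J = ?h ` {-T<..<T}"
  have sqn_line: "(?h has_real_derivative 2 * \<xi> (v + t *\<^sub>R a) a) (at t)" if "t \<in> {-T<..<T}" for t
    using chart_follows_profile[OF line(1,2)[OF that]] by (simp add: follows_profile_def)
  have "open_interval {-T<..<T}" using T by (auto simp: open_interval_def is_interval_1)
  moreover have "2 * \<xi> (v + t *\<^sub>R a) a \<noteq> 0" if "t \<in> {-T<..<T}" for t using line(3)[OF that] by simp
  ultimately have "\<exists>g. open_interval (?h ` {-T<..<T}) \<and> (\<forall>t\<in>{-T<..<T}. g (?h t) = t \<and>
      (g has_real_derivative inverse (2 * \<xi> (v + t *\<^sub>R a) a)) (at (?h t)))"
    by (intro real_inverse_function sqn_line)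
  then
  obtain g where J: "open_interval J"
    and g: "\<And>t. t \<in> {-T<..<T} \<Longrightarrow> g (?h t) = t"
      "\<And>t. t \<in> {-T<..<T} \<Longrightarrow> (g has_real_derivative inverse (2 * \<xi> (v + t *\<^sub>R a) a)) (at (?h t))"
    unfolding J_def by blast
  define w where "w s = \<omega> (v + g s *\<^sub>R a)" for s
  define k where "k s = \<kappa> (v + g s *\<^sub>R a)" for s
  have sol: "profile_solution (real CARD('n) - 1) (lam + 1) J w k"
    unfolding profile_solution_def
  proof (intro conjI ballI J)
    fix s assume "s \<in> J"
    then obtain t where t: "t \<in> {-T<..<T}" "s = ?h t" unfolding J_def by blast
    have gs: "g s = t" using g(1) t by simp
    note l = line[OF t(1)]
    show "follows_profile (real CARD('n) - 1) (lam + 1) (\<lambda>s. s) 1 w k s"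
      unfolding w_def[abs_def] k_def[abs_def]
      by (rule follows_profile_inverse[where h = ?h and h' = "2 * \<xi> (v + t *\<^sub>R a) a" and g = g
            and w = "\<lambda>t. \<omega> (v + t *\<^sub>R a)" and k = "\<lambda>t. \<kappa> (v + t *\<^sub>R a)"])
        (use chart_follows_profile[OF l(1,2)] g(2)[OF t(1)] t(2) gs l(3) in auto)
  qed
  have "?h 0 \<in> J" unfolding J_def using T by (intro imageI) simp
  then have qv: "sqn v \<in> J" by simp
  have oJ: "open J" using J by (simp add: open_interval_def)
  have "open ((\<lambda>u. sqn u) -` J \<inter> V)"
    using smooth_on_continuous[OF smooth_sqn] open_V oJ by (simp add: continuous_on_open_vimage)
  then have "open ((\<lambda>u. sqn u) -` J \<inter> V \<inter> ball v r0)" by (rule open_Int[OF _ open_ball])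
  moreover have "v \<in> (\<lambda>u. sqn u) -` J \<inter> V \<inter> ball v r0" using qv v r0 by simp
  ultimately obtain r where r: "r > 0" "ball v r \<subseteq> (\<lambda>u. sqn u) -` J \<inter> V \<inter> ball v r0"
    by (rule openE)
  have "sqn u \<in> J \<and> \<omega> u = w (sqn u) \<and> \<kappa> u = k (sqn u)" if u: "u \<in> ball v r" for u
  proof -
    let ?c = "\<lambda>t. v + t *\<^sub>R (u - v)"
    have c: "?c t \<in> V" "X (?c t) \<noteq> 0" "sqn (?c t) \<in> J" if "t \<in> {0..1}" for t
    proof -
      have "(1 - t) *\<^sub>R v + t *\<^sub>R u \<in> ball v r"
        using u r that by (intro convexD[OF convex_ball]) auto
      then have "?c t \<in> ball v r" by (simp add: algebra_simps)
      then show "?c t \<in> V" "X (?c t) \<noteq> 0" "sqn (?c t) \<in> J" using r(2) r0(2) by auto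
    qed
    note f = chart_follows_profile[OF c(1,2)]
    have dq: "((\<lambda>t. sqn (?c t)) has_real_derivative 2 * \<xi> (?c t) (u - v)) (at t)" if "t \<in> {0..1}" for t
      using f[OF that that] by (simp add: follows_profile_def)
    have cont: "continuous_on {0..1} (\<lambda>t. 2 * \<xi> (?c t) (u - v))"
      by (intro continuous_intros continuous_on_compose2[OF smooth_on_continuous[OF smooth_xi]])
        (use c in auto)
    have g0: "g (sqn v) = 0" using g(1)[of 0] T by simp
    have "(\<lambda>t. \<omega> (?c t)) 1 = (\<lambda>t. w (sqn (?c t))) 1 \<and> (\<lambda>t. \<kappa> (?c t)) 1 = (\<lambda>t. k (sqn (?c t))) 1"
      by (rule profile_uniqueness_along_curve[OF N f follows_profile_compose[OF sol c(3) dq] cont])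
        (use g0 in \<open>auto simp: w_def k_def\<close>)
    then show ?thesis using c(3)[of 1] by simp
  qed
  moreover have "ball v r \<subseteq> {u \<in> V. X u \<noteq> 0}" using r(2) r0(2) by auto
  moreover have "J \<subseteq> (\<lambda>u. sqn u) ` {u \<in> V. X u \<noteq> 0}"
    using line(1,2) by (auto simp: J_def)
  ultimately show ?thesis using r(1) sol by blast
qed

end

section \<open>Inverse charts and connectedness\<close>

lemma local_paramD:
  assumes "local_param M x V \<phi>"
  shows "open V" "inj_on \<phi> V" "openin M (\<phi> ` V)" "smooth_on (x \<circ> \<phi>) V"
    "\<And>v. v \<in> V \<Longrightarrow> inj (frechet_derivative (x \<circ> \<phi>) (at v))"
    "homeomorphic_map (top_of_set V) (subtopology M (\<phi> ` V)) \<phi>"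
proof -
  show h: "homeomorphic_map (top_of_set V) (subtopology M (\<phi> ` V)) \<phi>"
    using assms by (simp add: local_param_def embedding_map_def)
  show "inj_on \<phi> V" using homeomorphic_imp_injective_map[OF h] by simp
qed (use assms in \<open>auto simp: local_param_def\<close>)

lemma local_param_in_topspace: "local_param M x V \<phi> \<Longrightarrow> v \<in> V \<Longrightarrow> \<phi> v \<in> topspace M"
  using local_paramD(3) openin_subset by blast

lemma local_param_open_image:
  assumes "local_param M x V \<phi>" "open U" "U \<subseteq> V"
  shows "openin M (\<phi> ` U)"
proof -
  have "openin (top_of_set V) U" using assms by (simp add: open_subset)
  then have "openin (subtopology M (\<phi> ` V)) (\<phi> ` U)"
    using homeomorphic_map_openness[OF local_paramD(6)[OF assms(1)], of U] assms(3) by simp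
  then show ?thesis using openin_trans_full local_paramD(3)[OF assms(1)] by blast
qed

lemma local_param_open_preimage:
  assumes "local_param M x V \<phi>" "openin M W"
  shows "open {v \<in> V. \<phi> v \<in> W}"
proof -
  have "continuous_map (top_of_set V) M \<phi>"
    using homeomorphic_imp_continuous_map[OF local_paramD(6)[OF assms(1)]]
        continuous_map_into_fulltopology by blast
  then have "openin (top_of_set V) {v \<in> V. \<phi> v \<in> W}"
    using openin_continuous_map_preimage[OF _ assms(2)] by force
  then show ?thesis using local_paramD(1)[OF assms(1)] openin_open_trans by blast
qed

lemma local_param_nbhd:
  assumes "local_param M x V \<phi>" "v \<in> V" "openin M W" "\<phi> v \<in> W"
  shows "\<exists>r>0. ball v r \<subseteq> V \<and> \<phi> ` ball v r \<subseteq> W"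
proof -
  have "v \<in> {v \<in> V. \<phi> v \<in> W}" using assms by simp
  then obtain r where "r > 0" "ball v r \<subseteq> {v \<in> V. \<phi> v \<in> W}"
    using local_param_open_preimage[OF assms(1,3)] openE by blast
  then show ?thesis by (intro exI[of _ r]) auto
qed

text \<open>Between two inverse charts of the same immersion the change of parameters is Lipschitz at each
  point: \<open>x \<circ> \<phi>'\<close> is bounded below near \<open>v'\<close>, and \<open>x \<circ> \<phi>\<close> is Lipschitz at \<open>v\<close>. A zero derivative
  survives such a change of parameters.\<close>

lemma zero_derivative_transfer:
  fixes h :: "'m \<Rightarrow> real"
  assumes P: "local_param M x V \<phi>" and P': "local_param M x V' \<phi>'"
    and v: "v \<in> V" "v' \<in> V'" "\<phi> v = \<phi>' v'"
    and h: "((\<lambda>u. h (\<phi>' u)) has_derivative (\<lambda>_. 0)) (at v')"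
  shows "((\<lambda>u. h (\<phi> u)) has_derivative (\<lambda>_. 0)) (at v)"
  unfolding has_derivative_at_alt
proof (intro conjI allI impI bounded_linear_zero)
  fix e :: real assume e: "e > 0"
  let ?F = "x \<circ> \<phi>" and ?F' = "x \<circ> \<phi>'"
  obtain B d where B: "B > 0" "d > 0" "\<And>y. norm (y - v') < d \<Longrightarrow> B * norm (y - v') \<le> norm (?F' y - ?F' v')"
    using has_derivative_inj_bounded_below[OF smooth_on_has_derivative[OF local_paramD(4)[OF P'] v(2)]
        local_paramD(5)[OF P' v(2)]] by blast
  obtain K d1 where K: "K > 0" "d1 > 0" "\<And>u. norm (u - v) < d1 \<Longrightarrow> norm (?F u - ?F v) \<le> K * norm (u - v)"
    using differentiable_imp_lipschitz_at[OF smooth_on_has_derivative[OF local_paramD(4)[OF P]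
        v(1)]] by blast
  define e' where "e' = e * B / K"
  have e': "e' > 0" using e B K by (simp add: e'_def)
  obtain d2 where d2: "d2 > 0" "\<And>y. norm (y - v') < d2 \<Longrightarrow> norm (h (\<phi>' y) - h (\<phi>' v')
      - 0) \<le> e' * norm (y - v')"
    using h e' unfolding has_derivative_at_alt by blast
  let ?U = "ball v' (min d d2) \<inter> V'"
  have "openin M (\<phi>' ` ?U)"
    by (rule local_param_open_image[OF P']) (auto intro: local_paramD(1)[OF P'])
  moreover have "\<phi> v \<in> \<phi>' ` ?U" using v B d2 by auto
  ultimately obtain r where r: "r > 0" "\<phi> ` ball v r \<subseteq> \<phi>' ` ?U"
    using local_param_nbhd[OF P v(1)] by blast
  have "norm (h (\<phi> u) - h (\<phi> v) - 0) \<le> e * norm (u - v)" if u: "norm (u - v) < min r d1" for u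
  proof -
    have "u \<in> ball v r" using u by (simp add: dist_norm norm_minus_commute)
    then obtain y where y: "y \<in> ?U" "\<phi> u = \<phi>' y" using r(2) by blast
    have yn: "norm (y - v') < d" "norm (y - v') < d2" using y(1)
        by (auto simp: dist_norm norm_minus_commute)
    have "norm (h (\<phi> u) - h (\<phi> v) - 0) \<le> e' * norm (y - v')" using d2(2)[OF yn(2)] y v by simp
    also have "\<dots> = (e / K) * (B * norm (y - v'))" by (simp add: e'_def)
    also have "\<dots> \<le> (e / K) * norm (?F' y - ?F' v')" using B(3)[OF yn(1)] e K by (intro mult_left_mono) auto
    also have "\<dots> = (e / K) * norm (?F u - ?F v)" using y(2) v(3) by simp
    also have "\<dots> \<le> (e / K) * (K * norm (u - v))" using K(3)[of u] u e K by (intro mult_left_mono) auto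
    also have "\<dots> = e * norm (u - v)" using K by simp
    finally show ?thesis .
  qed
  then show "\<exists>d>0. \<forall>y. norm (y - v) < d \<longrightarrow> norm (h (\<phi> y) - h (\<phi> v) - 0) \<le> e * norm (y - v)"
    using r(1) K(2) by (intro exI[of _ "min r d1"]) auto
qed

lemma immersed_chart_of_local_param:
  "local_param M x V \<phi> \<Longrightarrow> immersed_chart V (x \<circ> \<phi>)"
  using local_paramD[of M x V \<phi>] by unfold_locales auto

lemma tangential_zero_chart_independent:
  assumes P: "local_param M x V \<phi>" and P': "local_param M x V' \<phi>'"
    and v: "v \<in> V" "v' \<in> V'" "\<phi> v = \<phi>' v'"
    and 0: "position_tangential (x \<circ> \<phi>') v' = 0"
  shows "position_tangential (x \<circ> \<phi>) v = 0"
proof -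
  interpret A: immersed_chart V "x \<circ> \<phi>" by (rule immersed_chart_of_local_param[OF P])
  interpret B: immersed_chart V' "x \<circ> \<phi>'" by (rule immersed_chart_of_local_param[OF P'])
  show ?thesis
    using zero_derivative_transfer[OF P P' v, of "\<lambda>m. x m \<bullet> x m"] 0
    by (simp add: A.X_zero_iff_deriv_sqnorm_zero[OF v(1)] B.X_zero_iff_deriv_sqnorm_zero[OF v(2)])
qed

text \<open>Each of the two vectors is orthogonal to both tangent spaces, while their difference is a
  difference of tangent vectors.\<close>

lemma position_normal_chart_independent:
  assumes P: "local_param M x V \<phi>" and P': "local_param M x V' \<phi>'"
    and v: "v \<in> V" "v' \<in> V'" "\<phi> v = \<phi>' v'"
  shows "position_normal (x \<circ> \<phi>) v = position_normal (x \<circ> \<phi>') v'"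
proof -
  interpret A: immersed_chart V "x \<circ> \<phi>" by (rule immersed_chart_of_local_param[OF P])
  interpret B: immersed_chart V' "x \<circ> \<phi>'" by (rule immersed_chart_of_local_param[OF P'])
  let ?n = "position_normal (x \<circ> \<phi>) v" and ?n' = "position_normal (x \<circ> \<phi>') v'"
  have nB: "?n \<bullet> B.E v' b = 0" for b
    using zero_derivative_transfer[OF P' P v(2,1) v(3)[symmetric], of "\<lambda>m. ?n \<bullet> x m"]
      A.normal_iff_deriv_zero[OF v(1), of ?n] B.normal_iff_deriv_zero[OF v(2), of ?n]
          A.nu_orthogonal[OF v(1)] by simp
  have n'A: "?n' \<bullet> A.E v b = 0" for b
    using zero_derivative_transfer[OF P P' v, of "\<lambda>m. ?n' \<bullet> x m"]
      A.normal_iff_deriv_zero[OF v(1), of ?n'] B.normal_iff_deriv_zero[OF v(2), of ?n']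
          B.nu_orthogonal[OF v(2)] by simp
  have "A.E v (A.X v) + ?n = B.E v' (B.X v') + ?n'"
    using A.F_split[of v] B.F_split[of v'] v(3) by simp
  then have "?n - ?n' = B.E v' (B.X v') - A.E v (A.X v)" by (simp add: algebra_simps)
  then have "(?n - ?n') \<bullet> (?n - ?n') = (?n - ?n') \<bullet> (B.E v' (B.X v') - A.E v (A.X v))" by simp
  also have "\<dots> = 0"
    using nB n'A A.nu_orthogonal[OF v(1)] B.nu_orthogonal[OF v(2)]
        by (simp add: inner_diff_left inner_diff_right)
  finally show ?thesis by simp
qed

text \<open>In a separation of the complement, every punctured neighbourhood lies on one side, so the
  points of \<open>C\<close> could be distributed to give a separation of \<open>M\<close>.\<close>

lemma connected_minus_isolated:
  assumes conn: "connected_space M" and C: "closedin M C"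
    and iso: "\<And>c. c \<in> C \<Longrightarrow> \<exists>B. openin M B \<and> B \<inter> C = {c} \<and> connectedin M (B - {c}) \<and> B - {c} \<noteq> {}"
  shows "connectedin M (topspace M - C)"
proof (rule ccontr)
  assume "\<not> ?thesis"
  then have "\<not> connected_space (subtopology M (topspace M - C))" by (simp add: connectedin_def)
  then obtain E1 E2 where E: "openin (subtopology M (topspace M - C)) E1"
      "openin (subtopology M (topspace M - C)) E2"
    "topspace M - C \<subseteq> E1 \<union> E2" "E1 \<inter> E2 = {}" "E1 \<noteq> {}" "E2 \<noteq> {}"
    unfolding connected_space_def by (metis Diff_subset topspace_subtopology_subset)
  have oC: "openin M (topspace M - C)" using C by blast
  have oE: "openin M E1" "openin M E2" using E(1,2) oC openin_trans_full by blast+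
  have sE: "E1 \<subseteq> topspace M - C" "E2 \<subseteq> topspace M - C"
    using E(1,2) openin_subset by fastforce+
  obtain B where B: "\<And>c. c \<in> C \<Longrightarrow> openin M (B c)" "\<And>c. c \<in> C \<Longrightarrow> B c \<inter> C = {c}"
      "\<And>c. c \<in> C \<Longrightarrow> connectedin M (B c - {c})" "\<And>c. c \<in> C \<Longrightarrow> B c - {c} \<noteq> {}"
    using iso by metis
  have Bsub: "B c - {c} \<subseteq> E1 \<union> E2" if "c \<in> C" for c
    using B(1,2)[OF that] E(3) openin_subset[of M "B c"] by blast
  have alt: "B c - {c} \<subseteq> E1 \<or> B c - {c} \<subseteq> E2" if "c \<in> C" for c
  proof -
    have "E1 \<inter> E2 \<inter> (B c - {c}) = {}" using E(4) by blast
    then have "E1 \<inter> (B c - {c}) = {} \<or> E2 \<inter> (B c - {c}) = {}"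
      using B(3)[OF that] oE Bsub[OF that] unfolding connectedin by meson
    then show ?thesis using Bsub[OF that] by blast
  qed
  let ?U = "\<lambda>E. E \<union> {c \<in> C. B c - {c} \<subseteq> E}"
  have op: "openin M (?U E)" if "openin M E" "E = E1 \<or> E = E2" for E
  proof -
    have "?U E = E \<union> \<Union> (B ` {c \<in> C. B c - {c} \<subseteq> E})"
      using B(2) by blast
    moreover have "openin M (E \<union> \<Union> (B ` {c \<in> C. B c - {c} \<subseteq> E}))"
      using that B(1) by (intro openin_Un openin_Union) auto
    ultimately show ?thesis by simp
  qed
  have "topspace M \<subseteq> ?U E1 \<union> ?U E2" using E(3) alt by blast
  moreover have "?U E1 \<inter> ?U E2 = {}" using E(4) sE B(4) by blast
  ultimately show False
    using conn op[OF oE(1)] op[OF oE(2)] E(5,6) unfolding connected_space_def by blast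
qed

lemma connectedin_propagate:
  assumes "connectedin M S" "openin M S" "m0 \<in> S" "P m0" "m \<in> S"
    and loc: "\<And>m. m \<in> S \<Longrightarrow> \<exists>U. openin M U \<and> m \<in> U \<and> U \<subseteq> S \<and> ((\<exists>m'\<in>U. P m') \<longrightarrow> (\<forall>m'\<in>U. P m'))"
  shows "P m"
proof (rule ccontr)
  assume nP: "\<not> P m"
  obtain U where U: "\<And>m. m \<in> S \<Longrightarrow> openin M (U m) \<and> m \<in> U m \<and> U m \<subseteq> S \<and> ((\<exists>m'\<in>U m. P m') \<longrightarrow> (\<forall>m'\<in>U m. P m'))"
    using loc by metis
  let ?A = "\<Union> (U ` {m \<in> S. P m})" and ?B = "\<Union> (U ` {m \<in> S. \<not> P m})"
  have "openin M ?A" "openin M ?B" using U by (auto intro!: openin_Union)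
  moreover have "S \<subseteq> ?A \<union> ?B" using U by blast
  moreover have "?A \<inter> ?B \<inter> S = {}"
  proof -
    have "P m'" if "m' \<in> ?A" for m' using that U by blast
    moreover have "\<not> P m'" if "m' \<in> ?B" for m' using that U by blast
    ultimately show ?thesis by blast
  qed
  moreover have "?A \<inter> S \<noteq> {}" using assms(3,4) U by blast
  moreover have "?B \<inter> S \<noteq> {}" using assms(5) nP U by blast
  ultimately show False using assms(1) unfolding connectedin by blast
qed

section \<open>From charts to the hypersurface\<close>

locale position_soliton =
  fixes M :: "'m topology" and x :: "'m \<Rightarrow> (real^'n::finite) \<times> real" and lam :: real and mu :: "'m \<Rightarrow> real"
  assumes dim: "CARD('n) \<ge> 2" "CARD('n) = 2 \<Longrightarrow> lam \<noteq> -1"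
    and conn: "connected_space M"
    and proper: "proper_hypersurface M x"
    and soliton: "position_quasi_yamabe_soliton M x lam mu"
    and mu_nonzero: "\<And>m. m \<in> topspace M \<Longrightarrow> mu m \<noteq> 0"

context position_soliton
begin

abbreviation "nondeg \<equiv> nondegenerate_points M x"

lemma soliton_chart_of_local_param:
  assumes P: "local_param M x V \<phi>"
  shows "soliton_chart V (x \<circ> \<phi>) lam (mu \<circ> \<phi>)"
  using local_paramD[OF P] soliton P local_param_in_topspace[OF P] mu_nonzero dim
  by unfold_locales (auto simp: position_quasi_yamabe_soliton_def)

lemma chart_at:
  assumes "m \<in> topspace M"
  obtains V \<phi> v where "local_param M x V \<phi>" "v \<in> V" "\<phi> v = m"
proof -
  have "\<exists>V \<phi>. local_param M x V \<phi> \<and> m \<in> \<phi> ` V"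
    using assms proper unfolding proper_hypersurface_def hypersurface_def by blast
  then show thesis using that by blast
qed

lemma nondegenerate_iff:
  assumes P: "local_param M x V \<phi>" and v: "v \<in> V"
  shows "\<phi> v \<in> nondeg \<longleftrightarrow> position_tangential (x \<circ> \<phi>) v \<noteq> 0"
proof
  interpret A: soliton_chart V "x \<circ> \<phi>" lam "mu \<circ> \<phi>" by (rule soliton_chart_of_local_param[OF P])
  assume nz: "position_tangential (x \<circ> \<phi>) v \<noteq> 0"
  then have "position_normal (x \<circ> \<phi>) v \<noteq> 0" using A.normal_zero_imp(1)[OF v] by blast
  then show "\<phi> v \<in> nondeg" using nz P v local_param_in_topspace[OF P v]
    unfolding nondegenerate_points_def by blast
next
  assume "\<phi> v \<in> nondeg"
  then obtain V' \<phi>' v' where P': "local_param M x V' \<phi>'" "v' \<in> V'" "\<phi>' v' = \<phi> v"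
    "position_tangential (x \<circ> \<phi>') v' \<noteq> 0"
    unfolding nondegenerate_points_def by blast
  then show "position_tangential (x \<circ> \<phi>) v \<noteq> 0"
    using tangential_zero_chart_independent[OF P'(1) P P'(2) v P'(3)] by blast
qed

lemma dense_soliton_chart_of_local_param:
  assumes P: "local_param M x V \<phi>"
  shows "dense_soliton_chart V (x \<circ> \<phi>) lam (mu \<circ> \<phi>)"
proof -
  interpret A: soliton_chart V "x \<circ> \<phi>" lam "mu \<circ> \<phi>" by (rule soliton_chart_of_local_param[OF P])
  show ?thesis
  proof unfold_locales
    fix U :: "(real^'n) set" assume U: "open U" "U \<subseteq> V" "U \<noteq> {}"
    obtain D where D: "M closure_of D = topspace M" "D \<subseteq> nondeg"
      using proper unfolding proper_hypersurface_def by blast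
    have "openin M (\<phi> ` U)" using local_param_open_image[OF P U(1,2)] .
    moreover have "\<phi> ` U \<noteq> {}" using U by simp
    ultimately have "D \<inter> \<phi> ` U \<noteq> {}" using D(1) dense_intersects_open[of M D] by blast
    then obtain u where "u \<in> U" "\<phi> u \<in> nondeg" using D(2) by blast
    then show "\<exists>u\<in>U. position_tangential (x \<circ> \<phi>) u \<noteq> 0" using nondegenerate_iff[OF P] U(2) by blast
  qed
qed

text \<open>By \<open>deriv_test_function\<close> in the first chart, for each vector \<open>eta\<close> a certain function on \<open>M\<close> has
  zero derivative at the point. In the second chart take for \<open>eta\<close> a tangent vector orthogonal to
  \<open>x\<^sup>T\<close> and differentiate in its direction.\<close>

lemma kappa_chart_independent:
  assumes P: "local_param M x V \<phi>" and P': "local_param M x V' \<phi>'"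
    and v: "v \<in> V" "v' \<in> V'" "\<phi> v = \<phi>' v'"
  shows "scalar_curvature (induced_metric (x \<circ> \<phi>)) v = scalar_curvature (induced_metric (x \<circ> \<phi>')) v'"
proof -
  interpret A: soliton_chart V "x \<circ> \<phi>" lam "mu \<circ> \<phi>" by (rule soliton_chart_of_local_param[OF P])
  interpret B: soliton_chart V' "x \<circ> \<phi>'" lam "mu \<circ> \<phi>'" by (rule soliton_chart_of_local_param[OF P'])
  have "A.kappa v = B.kappa v'"
  proof (cases "A.nu v = 0")
    case True
    then have "B.nu v' = 0" using position_normal_chart_independent[OF P P' v] by simp
    then show ?thesis using True A.normal_zero_imp(2)[OF v(1)] B.normal_zero_imp(2)[OF v(2)] by simp
  next
    case False
    then have B0: "B.nu v' \<noteq> 0" using position_normal_chart_independent[OF P P' v] by simp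
    have oA: "A.omega v \<noteq> 0" and oB: "B.omega v' \<noteq> 0" using False B0 by (auto simp: A.omega_def B.omega_def)
    obtain a where a: "a \<noteq> 0" "B.dual_position v' a = 0" using B.horizontal_vector_exists[OF v(2)] by blast
    let ?eta = "B.E v' a"
    \<comment> \<open>\<open>\<nu>\<close> as a function on the union of the two chart domains.\<close>
    define N where "N m = (if m \<in> \<phi> ` V then position_normal (x \<circ> \<phi>) (inv_into V \<phi> m) else
        position_normal (x \<circ> \<phi>') (inv_into V' \<phi>' m))" for m
    have NA: "N (\<phi> u) = A.nu u" if "u \<in> V" for u
      using that local_paramD(2)[OF P] by (simp add: N_def)
    have NB: "N (\<phi>' u) = B.nu u" if u: "u \<in> V'" for u
    proof (cases "\<phi>' u \<in> \<phi> ` V")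
      case True
      then obtain t where t: "t \<in> V" "\<phi> t = \<phi>' u" by force
      then show ?thesis using NA[OF t(1)] position_normal_chart_independent[OF P P' t(1) u] by simp
    next
      case False
      then show ?thesis using u local_paramD(2)[OF P'] by (simp add: N_def)
    qed
    define d where "d = (?eta \<bullet> (A.growth v *\<^sub>R A.nu v - (mu \<circ> \<phi>) v *\<^sub>R (x \<circ> \<phi>) v)) / 2"
    let ?h = "\<lambda>m. ?eta \<bullet> (N m + A.kappa v *\<^sub>R x m) - d * (x m \<bullet> x m)"
    have "((\<lambda>u. ?eta \<bullet> (A.nu u + A.kappa v *\<^sub>R (x \<circ> \<phi>) u)
        - d * ((x \<circ> \<phi>) u \<bullet> (x \<circ> \<phi>) u)) has_derivative (\<lambda>_. 0)) (at v)"
      by (rule has_derivative_eq_rhs[OF A.deriv_test_function[OF v(1) oA]]) (simp add: d_def)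
    then have "((\<lambda>u. ?h (\<phi> u)) has_derivative (\<lambda>_. 0)) (at v)"
      by (rule has_derivative_transform_within_open[OF _ A.open_V v(1)]) (simp add: NA)
    then have "((\<lambda>u. ?h (\<phi>' u)) has_derivative (\<lambda>_. 0)) (at v')"
      using zero_derivative_transfer[OF P' P v(2,1) v(3)[symmetric], of ?h] by simp
    then have "((\<lambda>u. ?eta \<bullet> (B.nu u + A.kappa v *\<^sub>R (x \<circ> \<phi>') u)
        - d * ((x \<circ> \<phi>') u \<bullet> (x \<circ> \<phi>') u)) has_derivative (\<lambda>_. 0)) (at v')"
      by (rule has_derivative_transform_within_open[OF _ B.open_V v(2)]) (simp add: NB)
    from fun_cong[OF has_derivative_unique[OF this B.deriv_test_function[OF v(2) oB]], of a]
    have "(A.kappa v - B.kappa v') * (?eta \<bullet> ?eta) = 0" using a(2) by simp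
    moreover have "?eta \<noteq> 0" using B.E_eq_0_iff[OF v(2)] a(1) by blast
    ultimately have "A.kappa v - B.kappa v' = 0" by (simp del: right_minus_eq)
    then show ?thesis by simp
  qed
  then show ?thesis by (simp add: A.kappa_def B.kappa_def)
qed

text \<open>The functions \<open>\<nu>\<close> and \<open>\<kappa>\<close> on \<open>M\<close>, computed in any inverse chart.\<close>

definition Nu where "Nu m = (SOME y. \<exists>V \<phi> v. local_param M x V \<phi> \<and> v \<in> V \<and> \<phi> v = m \<and> y
    = position_normal (x \<circ> \<phi>) v)"

definition K where "K m = (SOME y. \<exists>V \<phi> v. local_param M x V \<phi> \<and> v \<in> V \<and> \<phi> v = m \<and>
    y = scalar_curvature (induced_metric (x \<circ> \<phi>)) v - lam - 1)"

lemma Nu_chart: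
  assumes P: "local_param M x V \<phi>" and v: "v \<in> V"
  shows "Nu (\<phi> v) = position_normal (x \<circ> \<phi>) v"
proof -
  have "\<exists>y. \<exists>V' \<phi>' v'. local_param M x V' \<phi>' \<and> v' \<in> V' \<and> \<phi>' v' = \<phi> v \<and> y = position_normal (x \<circ> \<phi>') v'"
    using P v by blast
  from someI_ex[OF this] obtain V' \<phi>' v' where *: "local_param M x V' \<phi>'" "v' \<in> V'" "\<phi>' v' = \<phi> v"
      "Nu (\<phi> v) = position_normal (x \<circ> \<phi>') v'"
    unfolding Nu_def by blast
  then show ?thesis using position_normal_chart_independent[OF P *(1) v *(2)] by simp
qed

lemma K_chart:
  assumes P: "local_param M x V \<phi>" and v: "v \<in> V"
  shows "K (\<phi> v) = scalar_curvature (induced_metric (x \<circ> \<phi>)) v - lam - 1"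
proof -
  have "\<exists>y. \<exists>V' \<phi>' v'. local_param M x V' \<phi>' \<and> v' \<in> V' \<and> \<phi>' v' = \<phi> v \<and>
      y = scalar_curvature (induced_metric (x \<circ> \<phi>')) v' - lam - 1"
    using P v by blast
  from someI_ex[OF this] obtain V' \<phi>' v' where *: "local_param M x V' \<phi>'" "v' \<in> V'" "\<phi>' v' = \<phi> v"
      "K (\<phi> v) = scalar_curvature (induced_metric (x \<circ> \<phi>')) v' - lam - 1"
    unfolding K_def by blast
  then show ?thesis using kappa_chart_independent[OF P *(1) v *(2)] by simp
qed

definition "sqd m = x m \<bullet> x m"

definition "Om m = Nu m \<bullet> Nu m"

lemma Nu_inner: "m \<in> topspace M \<Longrightarrow> Nu m \<bullet> x m = Om m"
proof -
  assume "m \<in> topspace M"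
  then obtain V \<phi> v where P: "local_param M x V \<phi>" "v \<in> V" "\<phi> v = m" using chart_at by blast
  interpret A: immersed_chart V "x \<circ> \<phi>" by (rule immersed_chart_of_local_param[OF P(1)])
  have "A.nu v \<bullet> (x \<circ> \<phi>) v = A.nu v \<bullet> A.nu v"
    using A.nu_orthogonal[OF P(2)] by (subst A.F_split) (simp add: inner_add_right)
  then show ?thesis using Nu_chart[OF P(1,2)] P(3) by (simp add: Om_def)
qed

definition "Ax m = Nu m + K m *\<^sub>R x m"

definition "dirn m = Ax m /\<^sub>R norm (Ax m)"

lemma nondeg_subset: "nondeg \<subseteq> topspace M"
  by (auto simp: nondegenerate_points_def)

lemma openin_nondeg: "openin M nondeg"
proof (subst openin_subopen, intro ballI)
  fix m assume m: "m \<in> nondeg"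
  then obtain V \<phi> v where P: "local_param M x V \<phi>" "v \<in> V" "\<phi> v = m" using nondeg_subset chart_at by blast
  interpret A: dense_soliton_chart V "x \<circ> \<phi>" lam "mu \<circ> \<phi>"
      by (rule dense_soliton_chart_of_local_param[OF P(1)])
  let ?U = "{u \<in> V. A.X u \<noteq> 0}"
  have "openin M (\<phi> ` ?U)" by (rule local_param_open_image[OF P(1) A.open_X_nonzero]) auto
  moreover have "m \<in> \<phi> ` ?U" using nondegenerate_iff[OF P(1,2)] P m by blast
  moreover have "\<phi> ` ?U \<subseteq> nondeg" using nondegenerate_iff[OF P(1)] by blast
  ultimately show "\<exists>T. openin M T \<and> m \<in> T \<and> T \<subseteq> nondeg" by blast
qed

lemma nondeg_nonempty: "nondeg \<noteq> {}"
proof -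
  obtain D where D: "M closure_of D = topspace M" "D \<subseteq> nondeg"
    using proper unfolding proper_hypersurface_def by blast
  have "topspace M \<noteq> {}" using proper by (simp add: proper_hypersurface_def hypersurface_def)
  then show ?thesis using D closure_of_empty by fastforce
qed

lemma local_structure:
  assumes m: "m \<in> nondeg"
  shows "\<exists>U J w k. openin M U \<and> m \<in> U \<and> U \<subseteq> nondeg \<and> profile_solution (real CARD('n) - 1) (lam + 1) J w k \<and>
    J \<subseteq> sqd ` nondeg \<and> (\<forall>m'\<in>U. sqd m' \<in> J \<and> Om m' = w (sqd m') \<and> K m' = k (sqd m') \<and> dirn m' = dirn m)"
proof -
  obtain V \<phi> v where P: "local_param M x V \<phi>" "v \<in> V" "\<phi> v = m" using m nondeg_subset chart_at by blast
  interpret A: dense_soliton_chart V "x \<circ> \<phi>" lam "mu \<circ> \<phi>"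
      by (rule dense_soliton_chart_of_local_param[OF P(1)])
  have X: "A.X v \<noteq> 0" using nondegenerate_iff[OF P(1,2)] P(3) m by simp
  obtain r J w k where r: "r > 0" "ball v r \<subseteq> {u \<in> V. A.X u \<noteq> 0}" "profile_solution (real CARD('n)
      - 1) (lam + 1) J w k"
    "J \<subseteq> (\<lambda>u. A.sqn u) ` {u \<in> V. A.X u \<noteq> 0}"
    "\<forall>u\<in>ball v r. A.sqn u \<in> J \<and> A.omega u = w (A.sqn u) \<and> A.kappa u = k (A.sqn u)"
    using A.local_profile[OF P(2) X] by blast
  have bV: "ball v r \<subseteq> V" using r(2) by blast
  have vals: "sqd (\<phi> u) = A.sqn u" "Om (\<phi> u) = A.omega u" "K (\<phi> u) = A.kappa u" "Ax (\<phi> u)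
      = A.axial u" if "u \<in> V" for u
    using Nu_chart[OF P(1) that] K_chart[OF P(1) that]
    by (simp_all add: sqd_def Om_def A.omega_def A.kappa_def Ax_def A.axial_def)
  have "((\<lambda>u. A.axial u /\<^sub>R norm (A.axial u)) has_derivative (\<lambda>_. 0)) (at u)" if "u \<in> ball v r" for u
  proof -
    have u: "u \<in> V" "A.X u \<noteq> 0" using that r(2) by auto
    note o = A.omega_nonzero[OF u]
    have nz: "A.axial u \<noteq> 0" using A.axial_nonzero[OF u(1) o] u(2) by blast
    let ?c = "\<lambda>a. A.growth u * A.dual_position u a"
    have d: "(A.axial has_derivative (\<lambda>a. ?c a *\<^sub>R A.axial u)) (at u)"
      by (rule has_derivative_eq_rhs[OF smooth_on_has_derivative[OF A.smooth_axial u(1)]])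
        (simp add: fun_eq_iff A.deriv_axial[OF u(1) o])
    show ?thesis by (rule has_derivative_direction_zero[OF d nz])
  qed
  then have "A.axial u /\<^sub>R norm (A.axial u) = A.axial v /\<^sub>R norm (A.axial v)" if "u \<in> ball v r" for u
    using that r(1)
    by (intro has_derivative_zero_unique_connected[where s = "ball v r" and
          f = "\<lambda>u. A.axial u /\<^sub>R norm (A.axial u)" and x = u and y = v]) auto
  then have "dirn (\<phi> u) = dirn m" if "u \<in> ball v r" for u
    using that bV vals(4) P(2,3) by (auto simp: dirn_def)
  moreover have "openin M (\<phi> ` ball v r)" using local_param_open_image[OF P(1) open_ball bV] .
  moreover have "m \<in> \<phi> ` ball v r" using P(3) r(1) by auto
  moreover have "\<phi> ` ball v r \<subseteq> nondeg" using r(2) nondegenerate_iff[OF P(1)] by blast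
  moreover have "J \<subseteq> sqd ` nondeg"
  proof
    fix s assume "s \<in> J"
    then obtain u where u: "u \<in> V" "A.X u \<noteq> 0" "s = A.sqn u" using r(4) by blast
    then have "\<phi> u \<in> nondeg" "s = sqd (\<phi> u)" using nondegenerate_iff[OF P(1)] vals(1) by auto
    then show "s \<in> sqd ` nondeg" by blast
  qed
  moreover have "sqd (\<phi> u) \<in> J \<and> Om (\<phi> u) = w (sqd (\<phi> u)) \<and> K (\<phi> u) = k (sqd (\<phi> u))" if "u \<in> ball v r" for u
    using r(5) that bV vals by auto
  ultimately show ?thesis using r(3) by (intro exI[of _
      "\<phi> ` ball v r"] exI[of _ J] exI[of _ w] exI[of _ k]) auto
qed

text \<open>A punctured ball in dimension at least 2 is connected. The last part takes the limit of
  \<open>\<nu> + \<kappa> x = \<bar>\<nu> + \<kappa> x\<bar> e\<close> at the zero of \<open>x\<^sup>T\<close>.\<close>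

lemma degenerate_structure:
  assumes m: "m \<in> topspace M - nondeg"
  shows "\<exists>B. openin M B \<and> m \<in> B \<and> B - {m} \<subseteq> nondeg \<and> connectedin M (B - {m}) \<and> B - {m} \<noteq> {} \<and>
    (\<forall>e. (\<forall>m'\<in>nondeg. dirn m' = e) \<longrightarrow> (\<exists>c. x m = c *\<^sub>R e))"
proof -
  obtain V \<phi> v where P: "local_param M x V \<phi>" "v \<in> V" "\<phi> v = m" using m chart_at by blast
  interpret A: dense_soliton_chart V "x \<circ> \<phi>" lam "mu \<circ> \<phi>"
      by (rule dense_soliton_chart_of_local_param[OF P(1)])
  have X: "A.X v = 0" using nondegenerate_iff[OF P(1,2)] P(3) m by blast
  obtain r where r: "r > 0" "ball v r \<subseteq> V" "\<forall>u\<in>ball v r - {v}. A.X u \<noteq> 0"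
    using A.degenerate_isolated[OF P(2) X] by blast
  let ?B = "\<phi> ` ball v r"
  have inj: "inj_on \<phi> V" by (rule local_paramD(2)[OF P(1)])
  have Bm: "?B - {m} = \<phi> ` (ball v r - {v})"
    using inj r(2) P(2,3) r(1) unfolding inj_on_def by blast
  have "connected (ball v r - {v})" using dim by (intro connected_punctured_ball) simp
  moreover have "continuous_map (top_of_set V) M \<phi>"
    using homeomorphic_imp_continuous_map[OF local_paramD(6)[OF P(1)]]
        continuous_map_into_fulltopology by blast
  ultimately have c: "connectedin M (?B - {m})"
    unfolding Bm using r(2) by (intro connectedin_continuous_map_image[where X = "top_of_set V"])
      (auto simp: connectedin_subtopology)
  have "v + (r / 2) *\<^sub>R axis undefined 1 \<in> ball v r - {v}"
    using r(1) by (simp add: dist_norm axis_eq_0_iff)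
  then have "ball v r - {v} \<noteq> {}" by blast
  then have ne: "?B - {m} \<noteq> {}" unfolding Bm by simp
  have sub: "?B - {m} \<subseteq> nondeg"
    unfolding Bm using r(2,3) nondegenerate_iff[OF P(1)] by blast
  have "\<exists>c. x m = c *\<^sub>R e" if e: "\<forall>m'\<in>nondeg. dirn m' = e" for e
  proof (cases "A.nu v = 0")
    case True
    then have "x m = 0" using A.F_split[of v] X linear_0[OF A.linear_E[OF P(2)]] P(3) by simp
    then show ?thesis by (intro exI[of _ 0]) simp
  next
    case False
    then have o: "A.omega v \<noteq> 0" by (simp add: A.omega_def)
    have k: "A.kappa v \<noteq> -1" by (rule A.degenerate_kappa[OF P(2) X])
    have nz: "A.axial v \<noteq> 0" using A.axial_nonzero[OF P(2) o] k by blast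
    have "x m = A.nu v" using A.F_split[of v] X linear_0[OF A.linear_E[OF P(2)]] P(3) by simp
    then have ax: "A.axial v = (1 + A.kappa v) *\<^sub>R x m" using P(3) by (simp add: A.axial_def algebra_simps)
    have "continuous_on V (\<lambda>u. A.axial u)" by (rule smooth_on_continuous[OF A.smooth_axial])
    then have "isCont A.axial v" using A.open_V P(2) continuous_on_eq_continuous_at by blast
    then have "((\<lambda>u. A.axial u - norm (A.axial u) *\<^sub>R e) \<longlongrightarrow> A.axial v - norm (A.axial v) *\<^sub>R e) (at v)"
      unfolding isCont_def by (intro tendsto_intros)
    moreover have "((\<lambda>u. A.axial u - norm (A.axial u) *\<^sub>R e) \<longlongrightarrow> 0) (at v)"
    proof (rule tendsto_eventually)
      have "A.axial u - norm (A.axial u) *\<^sub>R e = 0" if u: "u \<in> ball v r" "u \<noteq> v" for u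
      proof -
        have uV: "u \<in> V" "A.X u \<noteq> 0" using u r by auto
        have "\<phi> u \<in> nondeg" using uV nondegenerate_iff[OF P(1)] by blast
        then have "dirn (\<phi> u) = e" using e by blast
        moreover have "Ax (\<phi> u) = A.axial u"
          using Nu_chart[OF P(1) uV(1)] K_chart[OF P(1) uV(1)] by (simp add: Ax_def A.axial_def A.kappa_def)
        moreover have "A.axial u \<noteq> 0" using A.axial_nonzero[OF uV(1) A.omega_nonzero[OF uV]] uV(2) by blast
        ultimately show ?thesis by (auto simp: dirn_def)
      qed
      then show "\<forall>\<^sub>F u in at v. A.axial u - norm (A.axial u) *\<^sub>R e = 0"
        using r(1) by (auto simp: eventually_at_topological intro!: exI[of _ "ball v r"])
    qed
    ultimately have "A.axial v - norm (A.axial v) *\<^sub>R e = 0"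
      using tendsto_unique trivial_limit_at by blast
    then have "A.axial v = norm (A.axial v) *\<^sub>R e" by (simp only: right_minus_eq)
    then have "(1 + A.kappa v) *\<^sub>R x m = norm (A.axial v) *\<^sub>R e" using ax by metis
    moreover have "1 + A.kappa v \<noteq> 0" using k by simp
    then have "x m = (1 / (1 + A.kappa v)) *\<^sub>R ((1 + A.kappa v) *\<^sub>R x m)" by simp
    ultimately have "x m = (1 / (1 + A.kappa v) * norm (A.axial v)) *\<^sub>R e"
      by (metis scaleR_scaleR)
    then show ?thesis by blast
  qed
  moreover have "openin M ?B" using local_param_open_image[OF P(1) open_ball r(2)] .
  moreover have "m \<in> ?B" using P(3) r(1) by auto
  ultimately show ?thesis using c ne sub by blast
qed

lemma connectedin_nondeg: "connectedin M nondeg"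
proof -
  have "connectedin M (topspace M - (topspace M - nondeg))"
  proof (rule connected_minus_isolated[OF conn])
    show "closedin M (topspace M - nondeg)" using openin_nondeg by blast
    fix c assume c: "c \<in> topspace M - nondeg"
    then obtain B where "openin M B" "c \<in> B" "B - {c} \<subseteq> nondeg" "connectedin M (B - {c})" "B - {c} \<noteq> {}"
      using degenerate_structure[OF c] by (elim exE conjE) (rule that)
    then show "\<exists>B. openin M B \<and> B \<inter> (topspace M - nondeg) = {c} \<and> connectedin M (B - {c}) \<and> B - {c} \<noteq> {}"
      using c by (intro exI[of _ B]) blast
  qed
  moreover have "topspace M - (topspace M - nondeg) = nondeg" using nondeg_subset by blast
  ultimately show ?thesis by simp
qed

lemma dirn_constant: "\<exists>e. \<forall>m\<in>nondeg. dirn m = e"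
proof -
  obtain m0 where m0: "m0 \<in> nondeg" using nondeg_nonempty by blast
  have "dirn m = dirn m0" if "m \<in> nondeg" for m
  proof (rule connectedin_propagate[OF connectedin_nondeg openin_nondeg m0 refl that])
    fix m assume "m \<in> nondeg"
    from local_structure[OF this]
    show "\<exists>U. openin M U \<and> m \<in> U \<and> U \<subseteq> nondeg \<and> ((\<exists>m'\<in>U. dirn m' = dirn m0) \<longrightarrow> (\<forall>m'\<in>U. dirn m' = dirn m0))"
      by metis
  qed
  then show ?thesis by blast
qed

lemma dim_pos: "real CARD('n) - 1 > 0"
  using dim(1) by simp

text \<open>The points \<open>m\<close> at which \<open>\<omega>\<close> and \<open>\<kappa>\<close> take the values of a solution that starts with their values at a
  fixed point \<open>m0\<close> form an open and closed set, because a local solution near \<open>m\<close> can be glued to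
  one that comes from \<open>m0\<close>. All these solutions agree where they are defined.\<close>

lemma global_profile:
  "\<exists>w k. profile_solution (real CARD('n) - 1) (lam + 1) (sqd ` nondeg) w k \<and>
    (\<forall>m\<in>nondeg. Om m = w (sqd m) \<and> K m = k (sqd m))"
proof -
  let ?sol = "profile_solution (real CARD('n) - 1) (lam + 1)"
  obtain m0 where m0: "m0 \<in> nondeg" using nondeg_nonempty by blast
  let ?P = "\<lambda>m. \<exists>J w k. ?sol J w k \<and> sqd m0 \<in> J \<and> w (sqd m0) = Om m0 \<and> k (sqd m0) = K m0 \<and>
    sqd m \<in> J \<and> Om m = w (sqd m) \<and> K m = k (sqd m)"
  have Pm: "?P m" if m: "m \<in> nondeg" for m
  proof (rule connectedin_propagate[OF connectedin_nondeg openin_nondeg m0 _ m])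
    show "?P m0"
    proof -
      obtain U J w k where "m0 \<in> U" "?sol J w k" "\<forall>m'\<in>U. sqd m' \<in> J \<and> Om m' = w (sqd m') \<and> K m'
          = k (sqd m') \<and> dirn m' = dirn m0"
        using local_structure[OF m0] by (elim exE conjE) (rule that)
      then show ?thesis by (intro exI[of _ J] exI[of _ w] exI[of _ k]) auto
    qed
    fix m assume m: "m \<in> nondeg"
    obtain U J w k where U: "openin M U" "m \<in> U" "U \<subseteq> nondeg" "?sol J w k"
      "\<forall>m'\<in>U. sqd m' \<in> J \<and> Om m' = w (sqd m') \<and> K m' = k (sqd m') \<and> dirn m' = dirn m"
      using local_structure[OF m] by (elim exE conjE) (rule that)
    have "?P m''" if m': "m' \<in> U" "?P m'" and m'': "m'' \<in> U" for m' m''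
    proof -
      obtain J' w' k' where s: "?sol J' w' k'" "sqd m0 \<in> J'" "w' (sqd m0) = Om m0" "k' (sqd m0) = K m0"
        "sqd m' \<in> J'" "Om m' = w' (sqd m')" "K m' = k' (sqd m')" using m'(2) by blast
      have "w' (sqd m') = w (sqd m')" "k' (sqd m') = k (sqd m')" "sqd m' \<in> J" using U(5) m'(1) s by auto
      from profile_solution_glue[OF dim_pos s(1) U(4) s(5) this(3,1,2)]
      obtain w'' k'' where g: "?sol (J' \<union> J) w'' k''" "\<forall>t\<in>J'. w'' t = w' t \<and> k'' t = k' t"
         "\<forall>t\<in>J. w'' t = w t \<and> k'' t = k t" by blast
      show ?thesis
        using g s U(5) m'' by (intro exI[of _ "J' \<union> J"] exI[of _ w''] exI[of _ k'']) auto
    qed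
    then show "\<exists>U. openin M U \<and> m \<in> U \<and> U \<subseteq> nondeg \<and> ((\<exists>m'\<in>U. ?P m') \<longrightarrow> (\<forall>m'\<in>U. ?P m'))"
      using U(1-3) by (intro exI[of _ U] conjI impI ballI) (assumption | elim bexE | blast)+
  qed
  have uniq: "w t = w' t \<and> k t = k' t" if "?sol J w k" "?sol J' w' k'" "sqd m0 \<in> J" "sqd m0 \<in> J'"
      "w (sqd m0) = Om m0" "k (sqd m0) = K m0" "w' (sqd m0) = Om m0" "k' (sqd m0) = K m0" "t \<in> J" "t \<in> J'"
    for J J' w w' k k' t
    using profile_solution_unique[OF dim_pos that(1-4) _ _ that(9,10)] that(5-8) by simp
  \<comment> \<open>The value at \<open>t\<close> is read off at an arbitrary point with \<open>\<bar>x\<bar>\<^sup>2 = t\<close>.\<close>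
  define pt where "pt t = (SOME m. m \<in> nondeg \<and> sqd m = t)" for t
  have pt: "pt t \<in> nondeg \<and> sqd (pt t) = t" if "t \<in> sqd ` nondeg" for t
    unfolding pt_def by (rule someI_ex) (use that in blast)
  define w0 where "w0 t = Om (pt t)" for t
  define k0 where "k0 t = K (pt t)" for t
  have val: "w0 t = w t \<and> k0 t = k t"
    if s: "?sol J w k" "sqd m0 \<in> J" "w (sqd m0) = Om m0" "k (sqd m0) = K m0" and t: "t \<in> J"
        "t \<in> sqd ` nondeg" for J w k t
  proof -
    obtain J' w' k' where s': "?sol J' w' k'" "sqd m0 \<in> J'" "w' (sqd m0) = Om m0" "k' (sqd m0) = K m0"
      "t \<in> J'" "Om (pt t) = w' t" "K (pt t) = k' t" using Pm[of "pt t"] pt[OF t(2)] by metis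
    then show ?thesis using uniq[OF s(1) s'(1) s(2) s'(2) s(3,4) s'(3,4) t(1) s'(5)]
        by (simp add: w0_def k0_def)
  qed
  have oI: "open (sqd ` nondeg)"
  proof (subst open_subopen, intro ballI)
    fix t assume "t \<in> sqd ` nondeg"
    then obtain m where m: "m \<in> nondeg" "t = sqd m" by blast
    obtain U J w k where "m \<in> U" "?sol J w k" "J \<subseteq> sqd ` nondeg"
      "\<forall>m'\<in>U. sqd m' \<in> J \<and> Om m' = w (sqd m') \<and> K m' = k (sqd m') \<and> dirn m' = dirn m"
      using local_structure[OF m(1)] by (elim exE conjE) (rule that)
    then show "\<exists>T. open T \<and> t \<in> T \<and> T \<subseteq> sqd ` nondeg"
      using m(2) profile_solutionD(2) by (intro exI[of _ J]) auto
  qed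
  \<comment> \<open>A value missed by \<open>\<bar>x\<bar>\<^sup>2\<close> would separate the nondegenerate points.\<close>
  have cI: "is_interval (sqd ` nondeg)"
    unfolding is_interval_1
  proof (intro ballI allI impI)
    fix a b c assume ac: "a \<in> sqd ` nondeg" "b \<in> sqd ` nondeg" "a \<le> c \<and> c \<le> b"
    then obtain m1 m2 where m12: "m1 \<in> nondeg" "m2 \<in> nondeg" "a = sqd m1" "b = sqd m2" by blast
    obtain J1 w1 k1 where s1: "?sol J1 w1 k1" "sqd m0 \<in> J1" "sqd m1 \<in> J1" using Pm[OF m12(1)] by blast
    show "c \<in> sqd ` nondeg"
    proof (rule ccontr)
      assume c: "c \<notin> sqd ` nondeg"
      have "sqd m2 < c"
      proof (rule connectedin_propagate[OF connectedin_nondeg openin_nondeg m12(1) _ m12(2)])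
        show "sqd m1 < c" using ac m12 c by (metis image_eqI order_le_imp_less_or_eq)
        fix m assume m: "m \<in> nondeg"
        obtain U J w k where U: "openin M U" "m \<in> U" "U \<subseteq> nondeg" "?sol J w k" "J \<subseteq> sqd ` nondeg"
          "\<forall>m'\<in>U. sqd m' \<in> J \<and> Om m' = w (sqd m') \<and> K m' = k (sqd m') \<and> dirn m' = dirn m"
          using local_structure[OF m] by (elim exE conjE) (rule that)
        have "sqd m'' < c" if "m' \<in> U" "sqd m' < c" "m'' \<in> U" for m' m''
        proof (rule ccontr)
          assume "\<not> sqd m'' < c"
          then have "c \<in> J" using U(6) that profile_solutionD(1)[OF U(4)]
              unfolding open_interval_def is_interval_1
            by (meson less_imp_le not_less)
          then show False using c U(5) by blast
        qed
        then show "\<exists>U. openin M U \<and> m \<in> U \<and> U \<subseteq> nondeg \<and> ((\<exists>m'\<in>U. sqd m' < c) \<longrightarrow> (\<forall>m'\<in>U. sqd m' < c))"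
          using U(1-3) by blast
      qed
      then show False using ac m12 by simp
    qed
  qed
  have "profile_solution (real CARD('n) - 1) (lam + 1) (sqd ` nondeg) w0 k0"
    unfolding profile_solution_def
  proof (intro conjI ballI)
    show "open_interval (sqd ` nondeg)" using oI cI m0 by (auto simp: open_interval_def)
    fix t assume t: "t \<in> sqd ` nondeg"
    then obtain m where m: "m \<in> nondeg" "t = sqd m" by blast
    obtain J w k where s: "?sol J w k" "sqd m0 \<in> J" "w (sqd m0) = Om m0" "k (sqd m0) = K m0" "sqd m \<in> J"
      using Pm[OF m(1)] by blast
    have tJ: "t \<in> J \<inter> sqd ` nondeg" using s(5) m(2) t by blast
    have "follows_profile (real CARD('n) - 1) (lam + 1) (\<lambda>t. t) 1 w k t"
      using s(1) tJ by (simp add: profile_solution_def)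
    then show "follows_profile (real CARD('n) - 1) (lam + 1) (\<lambda>t. t) 1 w0 k0 t"
      by (rule follows_profile_transform[OF _ open_Int[OF profile_solutionD(2)[OF s(1)] oI] tJ])
        (use val[OF s(1-4)] in auto)
  qed
  moreover have "Om m = w0 (sqd m) \<and> K m = k0 (sqd m)" if m: "m \<in> nondeg" for m
  proof -
    obtain J w k where s: "?sol J w k" "sqd m0 \<in> J" "w (sqd m0) = Om m0" "k (sqd m0) = K m0"
      "sqd m \<in> J" "Om m = w (sqd m)" "K m = k (sqd m)"
      using Pm[OF m] by blast
    then show ?thesis using val[OF s(1-5)] m by simp
  qed
  ultimately show ?thesis by blast
qed

end

section \<open>Rotational hypersurfaces\<close>

text \<open>The reflection in the hyperplane orthogonal to \<open>u\<close>.\<close>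

definition reflect :: "'a::real_inner \<Rightarrow> 'a \<Rightarrow> 'a" where
  "reflect u p = p - (2 * (p \<bullet> u) / (u \<bullet> u)) *\<^sub>R u"

lemma reflect_inner: "reflect u p \<bullet> reflect u q = p \<bullet> q"
proof (cases "u = 0")
  case False
  then show ?thesis by (simp add: reflect_def inner_diff_left inner_diff_right inner_commute field_simps)
qed (simp add: reflect_def)

lemma linear_reflect: "linear (reflect u)"
  by (rule linearI) (simp_all add: reflect_def inner_add_left algebra_simps add_divide_distrib)

lemma reflect_reflect: "reflect u (reflect u p) = p"
proof (cases "u = 0")
  case False
  have "reflect u (reflect u p) = p - (2 * (p \<bullet> u) / (u \<bullet> u)) *\<^sub>R u
      - (2 * (reflect u p \<bullet> u) / (u \<bullet> u)) *\<^sub>R u"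
    by (simp add: reflect_def)
  moreover have "reflect u p \<bullet> u = - (p \<bullet> u)" using False by (simp add: reflect_def inner_diff_left)
  ultimately show ?thesis by simp
qed (simp add: reflect_def)

lemma reflect_swap:
  assumes "norm a = norm b"
  shows "reflect (a - b) a = b"
proof (cases "a = b")
  case False
  have "a \<bullet> a = b \<bullet> b" using assms by (simp add: norm_eq)
  then have eq: "(a - b) \<bullet> (a - b) = 2 * (a \<bullet> (a - b))"
    by (simp add: inner_diff_left inner_diff_right inner_commute)
  have "(a - b) \<bullet> (a - b) \<noteq> 0" using False by simp
  then have "2 * (a \<bullet> (a - b)) / ((a - b) \<bullet> (a - b)) = 1"
    unfolding eq[symmetric] by (rule divide_self)
  then show ?thesis unfolding reflect_def by (simp only: scaleR_one) simp
qed (simp add: reflect_def)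

lemma rigid_motion_linear:
  fixes f :: "'a::real_inner \<Rightarrow> 'a"
  assumes "linear f" "\<And>p q. f p \<bullet> f q = p \<bullet> q"
  shows "rigid_motion f"
  by (simp add: rigid_motion_def dist_norm norm_eq_sqrt_inner assms flip: linear_diff[OF assms(1)])

text \<open>The rotational hypersurface with the given profile; \<open>R\<close> takes the standard axis to its axis. The
  profile curve \<open>(rho, z)\<close> is parametrised by the squared distance to the origin.\<close>

locale profile_surface =
  fixes N l :: real and I :: "real set" and w k :: "real \<Rightarrow> real"
    and R :: "(real^'n::finite) \<times> real \<Rightarrow> (real^'n) \<times> real"
  assumes N: "N > 0" and sol: "profile_solution N l I w k"
    and R: "linear R" "\<And>p q. R p \<bullet> R q = p \<bullet> q" "\<And>p. R (R p) = p"

context profile_surface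
begin

definition "z t = height t (w t) (k t)"

definition "rho t = sqrt (t - (z t)\<^sup>2)"

definition "S = R ` sphere_times_curve I rho z"

definition "L = R ` standard_axis"

lemma interval_I: "open_interval I" "open I"
  using profile_solutionD(1,2)[OF sol] by auto

lemmas admissible_on_I = profile_solutionD(3)[OF sol]

lemma rho_z: assumes "t \<in> I" shows "rho t > 0" "(rho t)\<^sup>2 + (z t)\<^sup>2 = t"
  using height_sq_less[OF admissible_on_I[OF assms]] by (auto simp: rho_def z_def)

lemma smooth_profile: "smooth_on z I" "smooth_on rho I"
  using profile_smooth[OF N sol] by (simp_all add: z_def[abs_def] rho_def[abs_def])

lemma norm_R: "norm (R p) = norm p"
  using R(2) by (simp add: norm_eq)

lemma norm_fst_R:
  assumes "p \<bullet> p \<in> I" "snd (R p) = z (p \<bullet> p)"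
  shows "norm (fst (R p)) = rho (p \<bullet> p)"
proof -
  have "norm (R p) ^ 2 = p \<bullet> p" using norm_R by (simp add: power2_norm_eq_inner)
  then have "(norm (fst (R p)))\<^sup>2 + (snd (R p))\<^sup>2 = p \<bullet> p" by (simp add: norm_prod_def)
  then have "(norm (fst (R p)))\<^sup>2 = (rho (p \<bullet> p))\<^sup>2" using rho_z(2)[OF assms(1)] assms(2) by simp
  then show ?thesis using rho_z(1)[OF assms(1)] by (simp add: power2_eq_iff_nonneg)
qed

lemma mem_S_iff: "p \<in> S \<longleftrightarrow> p \<bullet> p \<in> I \<and> snd (R p) = z (p \<bullet> p)"
proof
  assume "p \<in> S"
  then obtain t y where ty: "t \<in> I" "norm y = 1" "p = R (rho t *\<^sub>R y, z t)"
    unfolding S_def sphere_times_curve_def by blast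
  have Rp: "R p = (rho t *\<^sub>R y, z t)" using ty(3) R(3) by simp
  have "p \<bullet> p = R p \<bullet> R p" using R(2) by simp
  also have "\<dots> = (rho t)\<^sup>2 + (z t)\<^sup>2"
    using ty(2) by (simp add: Rp inner_prod_def power2_eq_square norm_eq_1)
  finally have "p \<bullet> p = t" using rho_z(2)[OF ty(1)] by simp
  then show "p \<bullet> p \<in> I \<and> snd (R p) = z (p \<bullet> p)" using Rp ty(1) by simp
next
  assume p: "p \<bullet> p \<in> I \<and> snd (R p) = z (p \<bullet> p)"
  let ?t = "p \<bullet> p"
  let ?y = "fst (R p) /\<^sub>R rho ?t"
  have t: "?t \<in> I" "rho ?t > 0" using p rho_z by auto
  have "R p = (rho ?t *\<^sub>R ?y, z ?t)" using t(2) p by (simp add: prod_eq_iff)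
  moreover have "norm ?y = 1" using norm_fst_R[OF t(1)] p t(2) by simp
  ultimately have "R p \<in> sphere_times_curve I rho z"
    unfolding sphere_times_curve_def using t(1) by blast
  then show "p \<in> S" unfolding S_def using R(3) by (metis imageI)
qed

lemma orbit_point:
  assumes "p \<in> S"
  shows "\<exists>y. norm y = 1 \<and> p = R (rho (p \<bullet> p) *\<^sub>R y, z (p \<bullet> p))"
proof -
  have p: "p \<bullet> p \<in> I" "snd (R p) = z (p \<bullet> p)" using assms mem_S_iff by auto
  have pos: "rho (p \<bullet> p) > 0" by (rule rho_z(1)[OF p(1)])
  have "R p = (rho (p \<bullet> p) *\<^sub>R (fst (R p) /\<^sub>R rho (p \<bullet> p)), z (p \<bullet> p))"
    using pos p(2) by (simp add: prod_eq_iff)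
  then have "p = R (rho (p \<bullet> p) *\<^sub>R (fst (R p) /\<^sub>R rho (p \<bullet> p)), z (p \<bullet> p))"
    using R(3)[of p] by simp
  moreover have "norm (fst (R p) /\<^sub>R rho (p \<bullet> p)) = 1" using norm_fst_R[OF p] pos by simp
  ultimately show ?thesis by blast
qed

lemma regular_profile: "rotational_hypersurface_regular_profile S L"
  unfolding rotational_hypersurface_regular_profile_def
proof (rule exI[of _ R], rule exI[of _ I], rule exI[of _ rho], rule exI[of _ z], intro conjI)
  show "\<forall>t\<in>I. 0 < rho t \<and> (deriv rho t \<noteq> 0 \<or> deriv z t \<noteq> 0)"
  proof (intro ballI conjI)
    fix t assume t: "t \<in> I"
    show "0 < rho t" using rho_z(1)[OF t] .
    show "deriv rho t \<noteq> 0 \<or> deriv z t \<noteq> 0"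
    proof (rule ccontr)
      assume 0: "\<not> ?thesis"
      \<comment> \<open>\<open>rho\<^sup>2 + z\<^sup>2 = t\<close> has derivative 1.\<close>
      have "(rho has_real_derivative deriv rho t) (at t)" "(z has_real_derivative deriv z t) (at t)"
        using has_real_derivative_dir_deriv[OF smooth_on_differentiable[OF smooth_profile(2) t]]
          has_real_derivative_dir_deriv[OF smooth_on_differentiable[OF smooth_profile(1) t]]
              DERIV_imp_deriv by metis+
      then have "((\<lambda>t. (rho t)\<^sup>2 + (z t)\<^sup>2) has_real_derivative 0) (at t)"
        using 0 by (auto intro!: derivative_eq_intros)
      moreover have "((\<lambda>t. (rho t)\<^sup>2 + (z t)\<^sup>2) has_real_derivative 1) (at t)"
        by (rule has_field_derivative_transform_within_open[OF DERIV_ident interval_I(2) t]) (simp add: rho_z(2))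
      ultimately show False using DERIV_unique by fastforce
    qed
  qed
  have "homeomorphism I ((\<lambda>t. (rho t, z t)) ` I) (\<lambda>t. (rho t, z t)) (\<lambda>(a, b). a\<^sup>2 + b\<^sup>2)"
    using smooth_on_continuous[OF smooth_profile(1)] smooth_on_continuous[OF smooth_profile(2)] rho_z(2)
    by (auto simp: homeomorphism_def image_image case_prod_beta intro!: continuous_intros)
  then show "\<exists>h. homeomorphism I ((\<lambda>t. (rho t, z t)) ` I) (\<lambda>t. (rho t, z t)) h" by blast
qed (use rigid_motion_linear[OF R(1,2)] interval_I smooth_profile in \<open>auto simp: S_def L_def\<close>)

text \<open>The derivative of the height is a multiple of \<open>k\<close>, which has no zeros, so the curve can be
  reparametrised by the height.\<close>

lemma graph_profile:
  assumes l: "l \<noteq> 0"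
  shows "rotational_hypersurface S L"
proof -
  have k0: "k t \<noteq> 0" if "t \<in> I" for t using admissible_on_I[OF that] l by (auto simp: admissible_def)
  define z' where "z' t = k t / (2 * sqrt (axial_sqnorm t (w t) (k t)))" for t
  have z': "z' t \<noteq> 0" if "t \<in> I" for t using k0[OF that] axial_sqnorm_pos[OF admissible_on_I[OF that]]
      by (simp add: z'_def)
  have dz: "(z has_real_derivative z' t) (at t)" if "t \<in> I" for t
    using height_deriv[OF sol that] by (simp add: z_def[abs_def] z'_def)
  have sz': "smooth_on z' I" unfolding z'_def
  proof (intro smooth_on_divide smooth_on_mult smooth_on_const smooth_on_sqrt interval_I profile_smooth(1)[OF N sol])
    show "smooth_on k I" by (rule profile_solution_smooth(2)[OF N sol])
    show "axial_sqnorm t (w t) (k t) > 0" if "t \<in> I" for t by (rule axial_sqnorm_pos[OF admissible_on_I[OF that]])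
    show "2 * sqrt (axial_sqnorm t (w t) (k t)) \<noteq> 0" if "t \<in> I" for t
      using axial_sqnorm_pos[OF admissible_on_I[OF that]] by simp
  qed
  obtain g where J: "open_interval (z ` I)"
    and g: "\<And>t. t \<in> I \<Longrightarrow> g (z t) = t \<and> (g has_real_derivative inverse (z' t)) (at (z t))"
    using real_inverse_function[OF interval_I(1), of z z'] dz z' by blast
  have oJ: "open (z ` I)" using J by (simp add: open_interval_def)
  have sg: "smooth_on g (z ` I)" by (rule smooth_on_inverse_function[OF interval_I(2) oJ sz' z' g])
  have "g ` z ` I \<subseteq> I" using g by auto
  then have "smooth_on (\<lambda>u. rho (g u)) (z ` I)"
    using Ck_on_compose_real[OF oJ interval_I(2), of g _ rho] smooth_profile(2) sg unfolding smooth_on_def by blast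
  moreover have "sphere_times_curve I rho z = (sphere_times_curve (z ` I) (\<lambda>u. rho (g u)) (\<lambda>u. u) ::
      ((real^'n) \<times> real) set)"
  proof (intro set_eqI iffI)
    fix p :: "(real^'n) \<times> real" assume "p \<in> sphere_times_curve I rho z"
    then obtain t y where "t \<in> I" "norm y = 1" "p = (rho t *\<^sub>R y, z t)"
        unfolding sphere_times_curve_def by blast
    then have "z t \<in> z ` I" "p = (rho (g (z t)) *\<^sub>R y, z t)" "norm y = 1" using g by auto
    then show "p \<in> sphere_times_curve (z ` I) (\<lambda>u. rho (g u)) (\<lambda>u. u)"
        unfolding sphere_times_curve_def by blast
  next
    fix p :: "(real^'n) \<times> real" assume "p \<in> sphere_times_curve (z ` I) (\<lambda>u. rho (g u)) (\<lambda>u. u)"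
    then obtain t y where "t \<in> I" "norm y = 1" "p = (rho (g (z t)) *\<^sub>R y, z t)"
        unfolding sphere_times_curve_def by blast
    then have "t \<in> I" "norm y = 1" "p = (rho t *\<^sub>R y, z t)" using g by auto
    then show "p \<in> sphere_times_curve I rho z" unfolding sphere_times_curve_def by blast
  qed
  ultimately show ?thesis
    unfolding rotational_hypersurface_def
    using rigid_motion_linear[OF R(1,2)] J rho_z(1) g
    by (intro exI[of _ R] exI[of _ "z ` I"] exI[of _ "\<lambda>u. rho (g u)"]) (auto simp: S_def L_def)
qed

end

lemma excluded_type_image:
  fixes G :: "(real^'n::finite) \<times> real \<Rightarrow> (real^'n) \<times> real"
  assumes G: "rigid_motion G" "surj G"
    and H: "hypersphere H \<or> spherical_cylinder H \<or> spherical_cone H"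
  shows "hypersphere (G ` H) \<or> spherical_cylinder (G ` H) \<or> spherical_cone (G ` H)"
proof -
  have comp: "rigid_motion (G \<circ> f)" if "rigid_motion f" for f :: "(real^'n) \<times> real \<Rightarrow> (real^'n) \<times> real"
    using G(1) that unfolding rigid_motion_def by (metis comp_apply)
  have Gd: "dist (G p) (G q) = dist p q" for p q using G(1) unfolding rigid_motion_def by blast
  have sph: "G ` sphere c r = sphere (G c) r" for c r
  proof
    show "G ` sphere c r \<subseteq> sphere (G c) r" by (auto simp: Gd)
    show "sphere (G c) r \<subseteq> G ` sphere c r"
    proof
      fix y assume y: "y \<in> sphere (G c) r"
      obtain p where p: "y = G p" using G(2) by blast
      then have "p \<in> sphere c r" using y by (simp add: Gd)
      then show "y \<in> G ` sphere c r" using p by blast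
    qed
  qed
  from H show ?thesis
  proof (elim disjE)
    assume "hypersphere H"
    then show ?thesis unfolding hypersphere_def using sph by blast
  next
    assume "spherical_cylinder H"
    then obtain f I c where f: "rigid_motion f" "open_interval I" "c > 0"
      "H = f ` sphere_times_curve I (\<lambda>u. c) (\<lambda>u. u)" unfolding spherical_cylinder_def by blast
    have "G ` H = (G \<circ> f) ` sphere_times_curve I (\<lambda>u. c) (\<lambda>u. u)" unfolding f(4) by (rule image_comp)
    then show ?thesis unfolding spherical_cylinder_def using comp[OF f(1)] f(2,3) by blast
  next
    assume "spherical_cone H"
    then obtain f I c where f: "rigid_motion f" "open_interval I" "c \<noteq> 0" "\<forall>u\<in>I. c * u > 0"
      "H = f ` sphere_times_curve I (\<lambda>u. c * u) (\<lambda>u. u)" unfolding spherical_cone_def by blast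
    have "G ` H = (G \<circ> f) ` sphere_times_curve I (\<lambda>u. c * u) (\<lambda>u. u)" unfolding f(5) by (rule image_comp)
    then show ?thesis unfolding spherical_cone_def using comp[OF f(1)] f(2-4) by blast
  qed
qed

text \<open>A rotation about the axis moves a point of an excluded piece \<open>P\<close> of \<open>S\<close> to a point of \<open>Y\<close> and \<open>P\<close> to a
  piece of the same kind inside \<open>S\<close>; as \<open>Y\<close> is open in \<open>S\<close>, an open portion of the rotated piece lies
  in \<open>Y\<close>.\<close>

lemma excluded_portion_of_rotational:
  fixes R :: "(real^'n::finite) \<times> real \<Rightarrow> (real^'n) \<times> real"
  assumes R: "linear R" "\<And>p q. R p \<bullet> R q = p \<bullet> q" "\<And>p. R (R p) = p"
    and S: "S = R ` sphere_times_curve I \<rho> z"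
    and Y: "openin (top_of_set S) Y"
    and meets: "\<And>t. t \<in> I \<Longrightarrow> \<exists>y. norm y = 1 \<and> R (\<rho> t *\<^sub>R y, z t) \<in> Y"
    and exc: "contains_excluded_portion S"
  shows "contains_excluded_portion Y"
proof -
  obtain H P where HP: "hypersphere H \<or> spherical_cylinder H \<or> spherical_cone H"
    "openin (top_of_set H) P" "P \<noteq> {}" "P \<subseteq> S" using exc unfolding contains_excluded_portion_def by blast
  obtain p where p: "p \<in> P" using HP(3) by blast
  then obtain t y where ty: "t \<in> I" "norm y = 1" "p = R (\<rho> t *\<^sub>R y, z t)"
    using HP(4) S by (auto simp: sphere_times_curve_def)
  obtain y' where y': "norm y' = 1" "R (\<rho> t *\<^sub>R y', z t) \<in> Y" using meets[OF ty(1)] by blast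
  obtain T where T: "orthogonal_transformation T" "T y = y'"
    using orthogonal_transformation_exists[of y y'] ty(2) y'(1) by auto
  have Tl: "linear T" and Tn: "norm (T a) = norm a" for a
    using T(1) orthogonal_transformation by blast+
  have Tbij: "bij T" by (rule orthogonal_transformation_bij[OF T(1)])
  define G where "G q = R (T (fst (R q)), snd (R q))" for q
  have Gd: "dist (G q) (G q') = dist q q'" for q q'
  proof -
    have Rn: "norm (R q) = norm q" for q using R(2) by (simp add: norm_eq)
    have Rd: "dist (R a) (R b) = dist a b" for a b
      by (simp add: dist_norm Rn flip: linear_diff[OF R(1)])
    have "dist (G q) (G q') = dist (T (fst (R q)), snd (R q)) (T (fst (R q')), snd (R q'))"
      by (simp add: G_def Rd)
    also have "\<dots> = dist (R q) (R q')"
      using linear_diff[OF Tl] Tn by (simp add: dist_prod_def dist_norm flip: linear_diff[OF Tl])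
    finally show ?thesis by (simp add: Rd)
  qed
  have Gsurj: "surj G"
  proof (rule surjI)
    fix q
    show "G (R (inv T (fst (R q)), snd (R q))) = q"
      using Tbij by (simp add: G_def R(3) bij_is_surj surj_f_inv_f)
  qed
  have GS: "G ` S \<subseteq> S"
  proof
    fix q assume "q \<in> G ` S"
    then obtain s a where s: "s \<in> I" "norm a = 1" "q = G (R (\<rho> s *\<^sub>R a, z s))"
      using S by (auto simp: sphere_times_curve_def)
    then have "q = R (\<rho> s *\<^sub>R T a, z s)" by (simp add: G_def R(3) linear_scale[OF Tl])
    moreover have "(\<rho> s *\<^sub>R T a, z s) \<in> sphere_times_curve I \<rho> z"
      unfolding sphere_times_curve_def using s(1,2) Tn
      by (intro CollectI exI[of _ s] exI[of _ "T a"]) simp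
    ultimately show "q \<in> S" unfolding S by blast
  qed
  have Ginj: "inj G" using Gd by (metis dist_eq_0_iff injI)
  have Gcont: "continuous_on UNIV G"
    using Gd by (auto simp: continuous_on_iff)
  have Gop: "openin (top_of_set (G ` H)) (G ` P)"
  proof -
    obtain U where U: "open U" "P = H \<inter> U" using HP(2) by (auto simp: openin_open)
    have "open (G ` U)" using invariance_of_domain[of U G] Gcont U(1) Ginj
      by (auto intro: continuous_on_subset inj_on_subset)
    moreover have "G ` P = G ` H \<inter> G ` U" using U(2) Ginj by (simp add: image_Int)
    ultimately show ?thesis by (auto simp: openin_open)
  qed
  have GP: "G ` P \<subseteq> S" using HP(4) GS by blast
  have "G p = R (\<rho> t *\<^sub>R y', z t)" using ty(3) T(2) by (simp add: G_def R(3) linear_scale[OF Tl])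
  then have "G p \<in> G ` P \<inter> Y" using imageI[OF p, of G] y'(2) by (intro IntI) simp_all
  moreover have "openin (top_of_set (G ` P)) (G ` P \<inter> Y)"
    using Y GP by (metis inf.absorb_iff2 openin_subtopology_Int2 subtopology_subtopology)
  then have "openin (top_of_set (G ` H)) (G ` P \<inter> Y)" using Gop openin_trans by blast
  moreover have "hypersphere (G ` H) \<or> spherical_cylinder (G ` H) \<or> spherical_cone (G ` H)"
    by (rule excluded_type_image[OF _ Gsurj HP(1)]) (simp add: rigid_motion_def Gd)
  ultimately show ?thesis unfolding contains_excluded_portion_def by blast
qed

lemma contains_excluded_portion_mono:
  "contains_excluded_portion S \<Longrightarrow> S \<subseteq> T \<Longrightarrow> contains_excluded_portion T"
  unfolding contains_excluded_portion_def by blast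

text \<open>Points of \<open>S\<close> are determined by their squared length and their direction orthogonal to the axis,
  so \<open>psi\<close> embeds \<open>S\<close> into \<open>\<real>\<^sup>n\<close>, where invariance of domain applies.\<close>

lemma openin_rotational_image:
  fixes F :: "real^'n \<Rightarrow> (real^'n::finite) \<times> real" and R :: "(real^'n) \<times> real \<Rightarrow> (real^'n) \<times> real"
  assumes B: "open B" "continuous_on B F" "inj_on F B" "F ` B \<subseteq> S"
    and R: "linear R" "\<And>p. norm (R p) = norm p" "\<And>p. R (R p) = p"
    and S: "\<And>p. p \<in> S \<Longrightarrow> snd (R p) = z (p \<bullet> p) \<and> norm (fst (R p)) = \<rho> (p \<bullet> p) \<and> \<rho> (p \<bullet> p) > 0"
  shows "openin (top_of_set S) (F ` B)"
proof -
  \<comment> \<open>The factor \<open>p \<bullet> p\<close> records the radius, the unit vector the point on the sphere of rotation.\<close>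
  define psi where "psi p = (p \<bullet> p) *\<^sub>R (fst (R p) /\<^sub>R norm (fst (R p)))" for p
  have fnz: "fst (R p) \<noteq> 0" if "p \<in> S" for p using S[OF that] by auto
  have contR: "continuous_on S R" using R(1) by (simp add: linear_continuous_on linear_conv_bounded_linear)
  have cont: "continuous_on S psi" unfolding psi_def
    using fnz by (intro continuous_intros contR) auto
  have npsi: "norm (psi p) = p \<bullet> p" if "p \<in> S" for p
    using fnz[OF that] by (simp add: psi_def)
  have inj: "inj_on psi S"
  proof (rule inj_onI)
    fix p q assume pq: "p \<in> S" "q \<in> S" "psi p = psi q"
    then have eq: "p \<bullet> p = q \<bullet> q" using npsi by metis
    have "p \<noteq> 0" using fnz[OF pq(1)] linear_0[OF R(1)] by auto
    then have nz: "p \<bullet> p \<noteq> 0" by simp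
    have n: "norm (fst (R p)) = norm (fst (R q))" "snd (R p) = snd (R q)"
        using S[OF pq(1)] S[OF pq(2)] eq by auto
    have "(p \<bullet> p) *\<^sub>R (fst (R p) /\<^sub>R norm (fst (R p))) = (p \<bullet> p) *\<^sub>R (fst (R q) /\<^sub>R norm (fst (R p)))"
      using pq(3) by (simp add: psi_def eq n(1))
    then have "fst (R p) = fst (R q)" using nz fnz[OF pq(1)] by simp
    then have "R p = R q" using n(2) by (simp add: prod_eq_iff)
    then show "p = q" using R(3) by metis
  qed
  have "open ((psi \<circ> F) ` B)"
    using B by (intro invariance_of_domain continuous_on_compose continuous_on_subset[OF cont] comp_inj_on
        inj_on_subset[OF inj]) auto
  then have "openin (top_of_set S) (S \<inter> psi -` ((psi \<circ> F) ` B))"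
    by (rule continuous_openin_preimage_gen[OF cont])
  moreover have "S \<inter> psi -` ((psi \<circ> F) ` B) = F ` B"
    using B(4) inj by (auto simp: inj_on_def)
  ultimately show ?thesis by simp
qed

context position_soliton
begin

lemma x_locally_open:
  assumes m: "m \<in> nondeg"
    and R: "linear R" "\<And>p. norm (R p) = norm p" "\<And>p. R (R p) = p"
    and sub: "x ` nondeg \<subseteq> S"
    and S: "\<And>p. p \<in> S \<Longrightarrow> snd (R p) = z (p \<bullet> p) \<and> norm (fst (R p)) = \<rho> (p \<bullet> p) \<and> \<rho> (p \<bullet> p) > 0"
  shows "\<exists>T. openin (top_of_set S) T \<and> x m \<in> T \<and> T \<subseteq> x ` nondeg"
proof -
  obtain V \<phi> v where P: "local_param M x V \<phi>" "v \<in> V" "\<phi> v = m" using m nondeg_subset chart_at by blast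
  interpret A: immersed_chart V "x \<circ> \<phi>" by (rule immersed_chart_of_local_param[OF P(1)])
  obtain r1 where r1: "r1 > 0" "ball v r1 \<subseteq> V" "inj_on (x \<circ> \<phi>) (ball v r1)"
    using A.locally_injective[OF P(2)] by blast
  obtain r2 where r2: "r2 > 0" "ball v r2 \<subseteq> V" "\<phi> ` ball v r2 \<subseteq> nondeg"
    using local_param_nbhd[OF P(1,2) openin_nondeg] P(3) m by blast
  let ?B = "ball v r1 \<inter> ball v r2"
  have sub': "(x \<circ> \<phi>) ` ?B \<subseteq> x ` nondeg" using r2(3) by auto
  have "openin (top_of_set S) ((x \<circ> \<phi>) ` ?B)"
  proof (rule openin_rotational_image[OF _ _ _ _ R S])
    show "continuous_on ?B (x \<circ> \<phi>)"
      by (rule continuous_on_subset[OF smooth_on_continuous[OF A.smooth_F]]) (use r1 in auto)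
    show "inj_on (x \<circ> \<phi>) ?B" by (rule inj_on_subset[OF r1(3)]) auto
    show "(x \<circ> \<phi>) ` ?B \<subseteq> S" using sub' sub by blast
  qed auto
  moreover have "x m \<in> (x \<circ> \<phi>) ` ?B" using P(3) r1(1) r2(1) by (intro image_eqI[of _ _ v]) auto
  ultimately show ?thesis using sub' by blast
qed

lemma axis_values:
  assumes m: "m \<in> nondeg" and e: "dirn m = e"
    and adm: "admissible l (sqd m) (Om m) (K m)"
  shows "x m \<bullet> e = height (sqd m) (Om m) (K m)" "norm e = 1"
proof -
  let ?D = "axial_sqnorm (sqd m) (Om m) (K m)"
  have nx: "Nu m \<bullet> x m = Om m" using Nu_inner m nondeg_subset by blast
  have "Ax m \<bullet> Ax m = ?D"
    using nx by (simp add: Ax_def axial_sqnorm_def inner_add_left inner_add_right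
        inner_commute[of "x m"] power2_eq_square algebra_simps flip: Om_def sqd_def)
  then have n: "norm (Ax m) = sqrt ?D" by (simp add: norm_eq_sqrt_inner)
  then have nz: "Ax m \<noteq> 0" using axial_sqnorm_pos[OF adm] by auto
  have eAx: "e = Ax m /\<^sub>R norm (Ax m)" using e by (simp add: dirn_def)
  show "norm e = 1" unfolding eAx using nz by simp
  have "x m \<bullet> Ax m = Om m + K m * sqd m"
    using nx by (simp add: Ax_def inner_add_right inner_commute[of "x m" "Nu m"] flip: sqd_def)
  then show "x m \<bullet> e = height (sqd m) (Om m) (K m)"
    unfolding eAx n by (simp add: height_def divide_inverse mult.commute)
qed

text \<open>The rigid motion is a reflection that takes the last basis vector to the direction \<open>e\<close> of the
  axis.\<close>

lemma rotational:
  "\<exists>S L. rotational_hypersurface_regular_profile S L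
     \<and> (lam \<noteq> -1 \<longrightarrow> rotational_hypersurface S L)
     \<and> 0 \<in> L
     \<and> openin (top_of_set S) (x ` nondeg)
     \<and> x ` (topspace M - nondeg) \<subseteq> L
     \<and> (\<not> contains_excluded_portion (x ` topspace M) \<longrightarrow> \<not> contains_excluded_portion S)"
proof -
  obtain e where e: "\<forall>m\<in>nondeg. dirn m = e" using dirn_constant by blast
  obtain w k where sol: "profile_solution (real CARD('n) - 1) (lam + 1) (sqd ` nondeg) w k"
    and val: "\<forall>m\<in>nondeg. Om m = w (sqd m) \<and> K m = k (sqd m)"
    using global_profile by blast
  have ev: "x m \<bullet> e = height (sqd m) (w (sqd m)) (k (sqd m))" "norm e = 1" if m: "m \<in> nondeg" for m
  proof -
    have "admissible (lam + 1) (sqd m) (Om m) (K m)"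
      using profile_solutionD(3)[OF sol] val m by simp
    from axis_values[OF m _ this, of e] show "x m \<bullet> e = height (sqd m) (w (sqd m)) (k (sqd m))" "norm e = 1"
      using e val m by auto
  qed
  have ne: "norm e = 1" using ev(2) nondeg_nonempty by blast
  define R where "R = reflect (((0, 1) :: (real^'n) \<times> real) - e)"
  have Re: "R (0, 1) = e" unfolding R_def by (rule reflect_swap) (simp add: ne norm_Pair)
  interpret P: profile_surface "real CARD('n) - 1" "lam + 1" "sqd ` nondeg" w k R
    by (intro profile_surface.intro dim_pos sol) (simp_all add: R_def linear_reflect reflect_inner
        reflect_reflect)
  have Rsnd: "snd (R p) = p \<bullet> e" for p
  proof -
    have "snd (R p) = R p \<bullet> (0, 1)" by (simp add: inner_prod_def)
    also have "\<dots> = R (R p) \<bullet> R (0, 1)" using P.R(2) by simp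
    finally show ?thesis using P.R(3) Re by simp
  qed
  have xS: "x ` nondeg \<subseteq> P.S"
  proof (rule image_subsetI)
    fix m assume "m \<in> nondeg"
    then show "x m \<in> P.S" using ev(1)[of m] by (simp add: P.mem_S_iff P.z_def Rsnd flip: sqd_def)
  qed
  have Sprop: "snd (R p) = P.z (p \<bullet> p) \<and> norm (fst (R p)) = P.rho (p \<bullet> p) \<and> P.rho (p \<bullet> p) > 0" if
      "p \<in> P.S" for p
    using that P.norm_fst_R P.rho_z(1) by (simp add: P.mem_S_iff)
  have "0 \<in> P.L"
  proof -
    have "R (0, 0) = 0" using linear_0[OF P.R(1)] by (simp add: zero_prod_def)
    then show ?thesis unfolding P.L_def standard_axis_def by (metis (mono_tags, lifting) CollectI image_eqI)
  qed
  moreover have op: "openin (top_of_set P.S) (x ` nondeg)"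
    using x_locally_open[OF _ P.R(1) P.norm_R P.R(3) xS Sprop]
    by (subst openin_subopen) blast
  moreover have "x ` (topspace M - nondeg) \<subseteq> P.L"
  proof
    fix p assume "p \<in> x ` (topspace M - nondeg)"
    then obtain m where m: "m \<in> topspace M - nondeg" "p = x m" by blast
    obtain c where "x m = c *\<^sub>R e" using degenerate_structure[OF m(1)] e by meson
    then have "p = R (c *\<^sub>R (0, 1))" using m(2) Re linear_scale[OF P.R(1)] by metis
    then have "p = R (0, c)" by simp
    then show "p \<in> P.L" unfolding P.L_def standard_axis_def by blast
  qed
  moreover have "contains_excluded_portion (x ` topspace M)" if "contains_excluded_portion P.S"
  proof -
    have "contains_excluded_portion (x ` nondeg)"
    proof (rule excluded_portion_of_rotational[OF P.R P.S_def op _ that])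
      fix t assume "t \<in> sqd ` nondeg"
      then obtain m where m: "m \<in> nondeg" "x m \<bullet> x m = t" by (auto simp: sqd_def)
      have "x m \<in> P.S" using xS m(1) by blast
      then obtain y where y: "norm y = 1" "x m = R (P.rho t *\<^sub>R y, P.z t)"
        using P.orbit_point[of "x m"] m(2) by auto
      then show "\<exists>y. norm y = 1 \<and> R (P.rho t *\<^sub>R y, P.z t) \<in> x ` nondeg"
        using imageI[OF m(1), of x] by (intro exI[of _ y]) simp
    qed
    then show ?thesis by (rule contains_excluded_portion_mono) (rule image_mono[OF nondeg_subset])
  qed
  moreover have "rotational_hypersurface_regular_profile P.S P.L" by (rule P.regular_profile)
  moreover have "rotational_hypersurface P.S P.L" if "lam \<noteq> -1" using that by (intro P.graph_profile) simp
  ultimately show ?thesis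
    by - (rule exI[of _ P.S], rule exI[of _ P.L], auto)
qed

end

theorem corollary4p1:
  fixes M :: "'m topology"
    and x :: "'m \<Rightarrow> (real^'n::finite) \<times> real"
    and lam :: real
    and mu :: "'m \<Rightarrow> real"
  assumes dim: "CARD('n) \<ge> 2" "CARD('n) = 2 \<Longrightarrow> lam \<noteq> -1"
    and conn: "connected_space M"
    and proper: "proper_hypersurface M x"
    and soliton: "position_quasi_yamabe_soliton M x lam mu"
    and mu_nonzero: "\<And>m. m \<in> topspace M \<Longrightarrow> mu m \<noteq> 0"
  shows "\<exists>S L. rotational_hypersurface_regular_profile S L
     \<and> (lam \<noteq> -1 \<longrightarrow> rotational_hypersurface S L)
     \<and> 0 \<in> L
     \<and> openin (top_of_set S) (x ` nondegenerate_points M x)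
     \<and> x ` (topspace M - nondegenerate_points M x) \<subseteq> L
     \<and> (\<not> contains_excluded_portion (x ` topspace M) \<longrightarrow> \<not> contains_excluded_portion S)"
proof -
  interpret position_soliton M x lam mu
    using assms by unfold_locales auto
  show ?thesis by (rule rotational)
qed

end
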